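(* Let $k\ge2$ and $r\ge1$ be integers, and let $G_{k,r}$ be the graph obtained from the complete graph on hubs $u_1,\dots,u_k$ by attaching a set $L_i$ of $r$ pendant leaves to each hub $u_i$. Consider the first-passage location game on $G_{k,r}$ with centered payoff $A=A_{G_{k,r}}$. Then $A(u_i,u_j)=0$ for all hubs $u_i,u_j$; $A(\ell,\ell')=0$ for all leaves $\ell,\ell'$; and there are numbers $h_{k,r},d_{k,r}$ such that $A(u_i,\ell)=h_{k,r}$ for $\ell\in L_i$ and $A(u_i,\ell)=-d_{k,r}$ for $\ell\in L_j$ with $j\ne i$. With $p=k-2$, $s=r-2$ and the polynomials $\mathsf L,\mathsf H,\mathsf D$ given in the context, $$h_{k,r}=\frac{\mathsf H(p,s)}{2(k+2r)\,\mathsf L(p,s)},\qquad d_{k,r}=\frac{\mathsf D(p,s)}{2(k+2r)(2k+3r)\,\mathsf L(p,s)},$$ where $\mathsf L(p,s)>0$. Moreover $h_{k,r}>0$ for all $k\ge2,r\ge1$; $d_{k,r}>0$ if $r\ge2$; and $d_{k,1}<0$. The optimal strategies and equilibria are as follows. (1) If $r=1$: $\mathcal O(G_{k,1})=\mathcal P(\{u_1,\dots,u_k\})$ and $\operatorname{PNE}(G_{k,1})=\{u_1,\dots,u_k\}^2$. (2) If $r\ge2$: $\operatorname{PNE}(G_{k,r})=\varnothing$. Moreover, with $t=t_{k,r}=\dfrac{d_{k,r}}{h_{k,r}+d_{k,r}}$: (2a) if $kt<1$, then $$\mathcal O(G_{k,r})=\Bigl\{\sum_{i=1}^kx_i\delta_{u_i}:\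 \sum_{i=1}^kx_i=1,\ x_i\ge t\text{ for every }i\Bigr\},$$ so that every optimal strategy has support of size exactly $k$; (2b) if $kt>1$, then $$\mathcal O(G_{k,r})=\Bigl\{\mu\in\mathcal P\bigl(\textstyle\bigcup_{i=1}^kL_i\bigr):\ \mu(L_i)\le t\text{ for every }i\Bigr\},$$ and the minimum support size of an optimal strategy is $\lceil 1/t\rceil$; (2c) if $kt=1$, then $\mathcal O(G_{k,r})$ is the set of all probability measures $\mu$ on the vertex set for which there is $X\in[0,1]$ with $\mu(u_i)=X/k$ and $\mu(L_i)=(1-X)/k$ for all $i$ (the distribution within each $L_i$ being arbitrary). (3) In all cases $\operatorname{MNE}(G_{k,r})=\mathcal O(G_{k,r})\times\mathcal O(G_{k,r})$.
   Context: Walk: on a finite connected graph $G=(V,E)$ the constant-speed walk waits at each vertex an exponential time of mean one and then jumps to a uniformly random neighbor (so a leaf also has total jump rate one). Payoffs: for independent walks started at $a,b\in V$, let $\tau_z^{(a)},\tau_z^{(b)}$ be the first hitting times of $z\in V$ (equal to $0$ if the start is $z$), and set $$q_z(a,b)=\Pr(\tau_z^{(a)}<\tau_z^{(b)})+\tfrac12\Pr(\tau_z^{(a)}=\tau_z^{(b)}),\qquad U_G(a,b)=\sum_{z\in V}q_z(a,b),\qquad A_G(a,b)=U_G(a,b)-\tfrac{|V|}{2}.$$ Co-location is permitted, with the two walks independent given their common start. Game: two players simultaneously choose starting vertices $a$ and $b$ (or probability distributions over vertices); they receive $U_G(a,b)$ and $U_G(b,a)=|V|-U_G(a,b)$ (expectations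 in the mixed case). $\operatorname{PNE}(G)$ and $\operatorname{MNE}(G)$ are the sets of pure and mixed Nash equilibria. $\mathcal P(S)$ is the set of probability measures supported on $S$, and $$\mathcal O(G)=\Bigl\{\mu\in\mathcal P(V):\ \sum_{a\in V}\mu(a)A_G(a,b)\ge 0\ \text{ for every } b\in V\Bigr\}.$$ Polynomials: $$\begin{aligned} \mathsf L(p,s)={}&(7248+9904s+5052s^2+1140s^3+96s^4)\\ &+p(9368+10448s+4122s^2+656s^3+32s^4)\\ &+p^2(4829+4109s+1108s^2+92s^3)\\ &+p^3(1239+713s+98s^2)+p^4(158+46s)+8p^5, \end{aligned}$$ $$\begin{aligned} \mathsf H(p,s)={}&(18480+32872s+23136s^2+8068s^3+1396s^4+96s^5)\\ &+p(32552+48080s+27104s^2+7154s^3+848s^4+32s^5)\\ &+p^2(23003+27187s+11534s^2+2048s^3+124s^4)\\ &+p^3(8441+7493s+2126s^2+190s^3)\\ &+p^4(1709+1013s+144s^2)+p^5(182+54s)+8p^6, \end{aligned}$$ $$\begin{aligned} \mathsf D(p,s)={}&(21888+73632s+89888s^2+54104s^3+17392s^4+2872s^5+192s^6)\\ &+p(40224+122224s+129728s^2+65640s^3+17004s^4+2124s^5+96s^6)\\ &+p^2(30888+81676s+71654s^2+28158s^3+5088s^4+340s^5)\\ &+p^3(12534+27907s+18964s^2+5117s^3+478s^4)\\ &+p^4(2818+5094s+2402s^2+334s^3)\\ &+p^5(332+464s+116s^2)+p^6(16+16s). \end{aligned}$$ *)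

theory Defs
  imports "HOL-Probability.Probability"
begin

record 'v ugraph =
  verts :: "'v set"
  edges :: "'v set set"

definition neighbors :: "'v ugraph \<Rightarrow> 'v \<Rightarrow> 'v set" where
  "neighbors G v = {w \<in> verts G. w \<noteq> v \<and> {v, w} \<in> edges G}"

text \<open>
  The walk is realised on a canonical sample space. A sample point is a stream of independent pairs
  \<open>(e, f)\<close>: the \<open>n\<close>-th pair contains the mean-one exponential time \<open>e\<close> that the walk waits before
  its \<open>n\<close>-th jump and, for every vertex \<open>v\<close>, a uniformly random neighbor \<open>f v\<close>, to which the walk
  jumps if it is at \<open>v\<close> at that moment.
\<close>

definition step_space :: "'v ugraph \<Rightarrow> (real \<times> ('v \<Rightarrow> 'v)) measure" where
  "step_space G =
     density lborel (exponential_density 1) \<Otimes>\<^sub>M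
     (\<Pi>\<^sub>M v\<in>verts G. measure_pmf (pmf_of_set (neighbors G v)))"

definition walk_space :: "'v ugraph \<Rightarrow> (real \<times> ('v \<Rightarrow> 'v)) stream measure" where
  "walk_space G = stream_space (step_space G)"

primrec jump_chain :: "'v \<Rightarrow> (real \<times> ('v \<Rightarrow> 'v)) stream \<Rightarrow> nat \<Rightarrow> 'v" where
  "jump_chain a \<omega> 0 = a"
| "jump_chain a \<omega> (Suc n) = snd (\<omega> !! n) (jump_chain a \<omega> n)"

definition jump_time :: "(real \<times> ('v \<Rightarrow> 'v)) stream \<Rightarrow> nat \<Rightarrow> real" where
  "jump_time \<omega> n = (\<Sum>i<n. fst (\<omega> !! i))"

text \<open>
  The number of jumps made up to time \<open>t\<close> is the least \<open>n\<close> such that \<open>t\<close> precedes the jump number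
  \<open>n + 1\<close>; it exists for all \<open>t\<close> almost surely.
\<close>

definition walk_at :: "'v \<Rightarrow> (real \<times> ('v \<Rightarrow> 'v)) stream \<Rightarrow> real \<Rightarrow> 'v" where
  "walk_at a \<omega> t = jump_chain a \<omega> (LEAST n. t < jump_time \<omega> (Suc n))"

definition hitting_time :: "'v \<Rightarrow> 'v \<Rightarrow> (real \<times> ('v \<Rightarrow> 'v)) stream \<Rightarrow> ereal" where
  "hitting_time a z \<omega> = Inf {ereal t | t. 0 \<le> t \<and> walk_at a \<omega> t = z}"

definition capture_prob :: "'v ugraph \<Rightarrow> 'v \<Rightarrow> 'v \<Rightarrow> 'v \<Rightarrow> real" where
  "capture_prob G z a b =
     (let M = walk_space G \<Otimes>\<^sub>M walk_space G in
        measure M {\<omega> \<in> space M. hitting_time a z (fst \<omega>) < hitting_time b z (snd \<omega>)} +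
        1 / 2 * measure M {\<omega> \<in> space M. hitting_time a z (fst \<omega>) = hitting_time b z (snd \<omega>)})"

definition payoff :: "'v ugraph \<Rightarrow> 'v \<Rightarrow> 'v \<Rightarrow> real" where
  "payoff G a b = (\<Sum>z\<in>verts G. capture_prob G z a b)"

definition centered_payoff :: "'v ugraph \<Rightarrow> 'v \<Rightarrow> 'v \<Rightarrow> real" where
  "centered_payoff G a b = payoff G a b - real (card (verts G)) / 2"

definition strategies_on :: "'v set \<Rightarrow> 'v pmf set" where
  "strategies_on S = {\<mu>. set_pmf \<mu> \<subseteq> S}"

definition mixed_payoff :: "'v ugraph \<Rightarrow> 'v pmf \<Rightarrow> 'v pmf \<Rightarrow> real" where
  "mixed_payoff G \<mu> \<nu> = measure_pmf.expectation (pair_pmf \<mu> \<nu>) (\<lambda>(a, b). payoff G a b)"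

text \<open>
  A player who plays \<open>a\<close> against \<open>b\<close> receives \<open>payoff G a b\<close>, whichever of the two players it is.
\<close>

definition PNE :: "'v ugraph \<Rightarrow> ('v \<times> 'v) set" where
  "PNE G = {(a, b). a \<in> verts G \<and> b \<in> verts G \<and>
     (\<forall>a'\<in>verts G. payoff G a' b \<le> payoff G a b) \<and>
     (\<forall>b'\<in>verts G. payoff G b' a \<le> payoff G b a)}"

definition MNE :: "'v ugraph \<Rightarrow> ('v pmf \<times> 'v pmf) set" where
  "MNE G = {(\<mu>, \<nu>). \<mu> \<in> strategies_on (verts G) \<and> \<nu> \<in> strategies_on (verts G) \<and>
     (\<forall>\<mu>'\<in>strategies_on (verts G). mixed_payoff G \<mu>' \<nu> \<le> mixed_payoff G \<mu> \<nu>) \<and>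
     (\<forall>\<nu>'\<in>strategies_on (verts G). mixed_payoff G \<nu>' \<mu> \<le> mixed_payoff G \<nu> \<mu>)}"

definition optimal_strategies :: "'v ugraph \<Rightarrow> 'v pmf set" where
  "optimal_strategies G = {\<mu> \<in> strategies_on (verts G).
     \<forall>b\<in>verts G. (\<Sum>a\<in>verts G. pmf \<mu> a * centered_payoff G a b) \<ge> 0}"

datatype hl_vertex = Hub nat | Leaf nat nat

definition hubs :: "nat \<Rightarrow> hl_vertex set" where
  "hubs k = Hub ` {1..k}"

definition leaves_at :: "nat \<Rightarrow> nat \<Rightarrow> hl_vertex set" where
  "leaves_at r i = Leaf i ` {1..r}"

definition all_leaves :: "nat \<Rightarrow> nat \<Rightarrow> hl_vertex set" where
  "all_leaves k r = (\<Union>i\<in>{1..k}. leaves_at r i)"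

definition hub_leaf_graph :: "nat \<Rightarrow> nat \<Rightarrow> hl_vertex ugraph" where
  "hub_leaf_graph k r =
     \<lparr>verts = hubs k \<union> all_leaves k r,
      edges = {{Hub i, Hub j} | i j. i \<in> {1..k} \<and> j \<in> {1..k} \<and> i \<noteq> j} \<union>
              {{Hub i, l} | i l. i \<in> {1..k} \<and> l \<in> leaves_at r i}\<rparr>"

definition L_poly :: "real \<Rightarrow> real \<Rightarrow> real" where
  "L_poly p s =
     (7248 + 9904 * s + 5052 * s^2 + 1140 * s^3 + 96 * s^4)
     + p * (9368 + 10448 * s + 4122 * s^2 + 656 * s^3 + 32 * s^4)
     + p^2 * (4829 + 4109 * s + 1108 * s^2 + 92 * s^3)
     + p^3 * (1239 + 713 * s + 98 * s^2) + p^4 * (158 + 46 * s) + 8 * p^5"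

definition H_poly :: "real \<Rightarrow> real \<Rightarrow> real" where
  "H_poly p s =
     (18480 + 32872 * s + 23136 * s^2 + 8068 * s^3 + 1396 * s^4 + 96 * s^5)
     + p * (32552 + 48080 * s + 27104 * s^2 + 7154 * s^3 + 848 * s^4 + 32 * s^5)
     + p^2 * (23003 + 27187 * s + 11534 * s^2 + 2048 * s^3 + 124 * s^4)
     + p^3 * (8441 + 7493 * s + 2126 * s^2 + 190 * s^3)
     + p^4 * (1709 + 1013 * s + 144 * s^2) + p^5 * (182 + 54 * s) + 8 * p^6"

definition D_poly :: "real \<Rightarrow> real \<Rightarrow> real" where
  "D_poly p s =
     (21888 + 73632 * s + 89888 * s^2 + 54104 * s^3 + 17392 * s^4 + 2872 * s^5 + 192 * s^6)
     + p * (40224 + 122224 * s + 129728 * s^2 + 65640 * s^3 + 17004 * s^4 + 2124 * s^5 + 96 * s^6)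
     + p^2 * (30888 + 81676 * s + 71654 * s^2 + 28158 * s^3 + 5088 * s^4 + 340 * s^5)
     + p^3 * (12534 + 27907 * s + 18964 * s^2 + 5117 * s^3 + 478 * s^4)
     + p^4 * (2818 + 5094 * s + 2402 * s^2 + 334 * s^3)
     + p^5 * (332 + 464 * s + 116 * s^2) + p^6 * (16 + 16 * s)"

end

theory Submission
  imports Defs
begin

text \<open>
  The hitting time of \<open>z\<close> from \<open>a \<noteq> z\<close> is the first holding time plus the hitting time of the shifted
  walk, started at a uniform neighbor of \<open>a\<close>. For independent mean-one exponential clocks racing on
  top of arbitrary independent times, each clock rings first with probability \<open>1/2\<close> and the other one
  then starts afresh. Hence \<open>q\<^sub>z\<close> is the unique solution, by the maximum principle, of a discrete
  Dirichlet problem on pairs of vertices. On \<open>G\<^sub>k\<^sub>,\<^sub>r\<close> the solution depends only on the classes of the two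
  vertices relative to \<open>z\<close> (3 classes for a hub, 4 for a leaf, besides \<open>z\<close> itself), which leaves linear
  systems in 3 and 6 unknowns with explicit solutions; summing over \<open>z\<close> gives the payoffs.
  The payoff matrix is skew, so an equilibrium is a pair of optimal strategies, and for \<open>r \<ge> 2\<close> optimality of \<open>\<mu>\<close>
  amounts to \<open>\<mu>(u\<^sub>i) \<ge> t X\<close> and \<open>\<mu>(L\<^sub>i) \<le> t (1 - X)\<close> for all \<open>i\<close>, where \<open>X\<close> is the mass of the hubs.
\<close>

section \<open>Measurability and shift structure of the hitting times\<close>

text \<open>When one walk jumps, the other is in the middle of a waiting period, so the pair has no
  common renewal time on the sample space. The way out is to freeze all but the two current clocks:
  given the residual times s and t, which contain all later clocks and jump targets, two independent
  exponentials decide the race. The memoryless identity is proved for fixed s and t, which are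
  integrated out only afterwards. The unknowns are the margins q - 1/2. Exchanging the racers
  negates them, so equal classes give 0 and only unordered pairs of classes remain: 3 for a hub
  target, 6 for a leaf target. The factors k + 2r and 2k + 3r in the denominators of h and d come
  from solving the hub system, L from the leaf system. The comparison of kt with 1 enters by summing
  the bounds over i. With Y = 1 - X they give k t X \<le> X and Y \<le> k t Y, so kt decides which
  of the two masses must vanish; at kt = 1 every bound is an equality.\<close>

definition jump_dist :: "'v ugraph \<Rightarrow> ('v \<Rightarrow> 'v) measure" where
  "jump_dist G = (\<Pi>\<^sub>M v\<in>verts G. measure_pmf (pmf_of_set (neighbors G v)))"

lemma step_space_eq: "step_space G = density lborel (exponential_density 1) \<Otimes>\<^sub>M jump_dist G"
  by (simp add: step_space_def jump_dist_def)

text \<open>Wanted for all v, because the countable gluing below ranges over the whole vertex type.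
  Off \<open>verts G\<close> the points of the product space take the constant value
  \<open>undefined\<close>.\<close>

lemma measurable_jump_dist: "(\<lambda>f. f v) \<in> jump_dist G \<rightarrow>\<^sub>M count_space UNIV"
proof (cases "v \<in> verts G")
  case True
  then have "(\<lambda>f. f v) \<in> jump_dist G \<rightarrow>\<^sub>M measure_pmf (pmf_of_set (neighbors G v))"
    unfolding jump_dist_def by (rule measurable_component_singleton)
  then show ?thesis
    by simp
next
  case False
  have "f v = undefined" if "f \<in> space (jump_dist G)" for f
  proof -
    have "f \<in> (\<Pi>\<^sub>E v\<in>verts G. UNIV)"
      using that by (simp add: jump_dist_def space_PiM)
    then show ?thesis
      using False by (rule PiE_arb)
  qed
  then show ?thesis
    by (subst measurable_cong[where g = "\<lambda>_. undefined"]) simp_all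
qed

lemma measurable_snd_step_space: "(\<lambda>x. snd x v) \<in> step_space G \<rightarrow>\<^sub>M count_space UNIV"
  unfolding step_space_eq by (rule measurable_compose[OF measurable_snd measurable_jump_dist])

lemma measurable_fst_step_space [measurable]: "fst \<in> borel_measurable (step_space G)"
  unfolding step_space_def by measurable

text \<open>A jump reads the coordinate at a random position, so measurability is glued from the
  countably many possible positions. The same device later handles a random number of jumps and a
  random starting vertex.\<close>

lemma measurable_jump_chain [measurable]:
  fixes G :: "'v::countable ugraph"
  shows "(\<lambda>\<omega>. jump_chain a \<omega> n) \<in> walk_space G \<rightarrow>\<^sub>M count_space UNIV"
proof (induction n)
  case (Suc n)
  have "(\<lambda>\<omega>. snd (\<omega> !! n) v) \<in> walk_space G \<rightarrow>\<^sub>M count_space UNIV" for v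
    unfolding walk_space_def
    by (rule measurable_compose[OF measurable_snth measurable_snd_step_space])
  then show ?case
    using Suc by (auto intro: measurable_compose_countable)
qed simp

lemma measurable_jump_time [measurable]:
  "(\<lambda>\<omega>. jump_time \<omega> n) \<in> borel_measurable (walk_space G)"
  unfolding jump_time_def walk_space_def by measurable

lemma measurable_walk_at [measurable]:
  fixes G :: "'v::countable ugraph"
  shows "(\<lambda>\<omega>. walk_at a \<omega> t) \<in> walk_space G \<rightarrow>\<^sub>M count_space UNIV"
  unfolding walk_at_def
  by (rule measurable_compose_countable[where g = "\<lambda>\<omega>. LEAST n. t < jump_time \<omega> (Suc n)"])
     measurable

text \<open>Jump times need not be monotone here. If N is the least index with t < T(N+1), all
  earlier jump times are at most t, hence at most t', so N stays least until time T(N+1).\<close>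

lemma walk_at_right_constant:
  "\<exists>u>t. \<forall>t'. t \<le> t' \<and> t' < u \<longrightarrow> walk_at a \<omega> t' = walk_at a \<omega> t"
proof (cases "\<exists>n. t < jump_time \<omega> (Suc n)")
  case True
  define N where "N = (LEAST n. t < jump_time \<omega> (Suc n))"
  have N: "t < jump_time \<omega> (Suc N)"
    unfolding N_def using True by (rule LeastI_ex)
  have less: "jump_time \<omega> (Suc m) \<le> t" if "m < N" for m
    using not_less_Least[of m "\<lambda>n. t < jump_time \<omega> (Suc n)"] that by (auto simp: N_def)
  have "(LEAST n. t' < jump_time \<omega> (Suc n)) = N" if "t \<le> t'" "t' < jump_time \<omega> (Suc N)" for t'
  proof (rule Least_equality)
    show "t' < jump_time \<omega> (Suc N)"
      by (rule that(2))
    show "N \<le> m" if "t' < jump_time \<omega> (Suc m)" for m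
      using less[of m] that \<open>t \<le> t'\<close> by (cases "m < N") auto
  qed
  then show ?thesis
    using N unfolding walk_at_def N_def[symmetric] by metis
next
  case False
  then have le: "jump_time \<omega> (Suc n) \<le> t" for n
    using not_le by blast
  \<comment> \<open>Past all jump times the \<open>LEAST\<close> is unspecified, but the predicate
    inside is one and the same function for every later t', so the unspecified value does not change
    either.\<close>
  have eq: "(\<lambda>n. t' < jump_time \<omega> (Suc n)) = (\<lambda>n. t < jump_time \<omega> (Suc n))" if "t \<le> t'" for t'
  proof
    show "t' < jump_time \<omega> (Suc n) \<longleftrightarrow> t < jump_time \<omega> (Suc n)" for n
      using le[of n] that by linarith
  qed
  have "walk_at a \<omega> t' = walk_at a \<omega> t" if "t \<le> t'" for t'
    unfolding walk_at_def eq[OF that] ..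
  then show ?thesis
    by (meson gt_ex)
qed

text \<open>Paths are right-continuous, even on the null set of explosive or non-increasing jump times, so
  the infimum may be taken over rational times.\<close>

lemma hitting_time_eq_INF_rat:
  "hitting_time a z \<omega> = (INF q::rat. if 0 \<le> q \<and> walk_at a \<omega> (of_rat q) = z then ereal (of_rat q) else \<infinity>)"
  (is "_ = ?R")
proof (rule antisym)
  show "hitting_time a z \<omega> \<le> ?R"
    unfolding hitting_time_def
    by (intro INF_greatest) (auto intro!: Inf_lower)
  show "?R \<le> hitting_time a z \<omega>"
    unfolding hitting_time_def
  proof (rule Inf_greatest, safe)
    fix t :: real assume t: "0 \<le> t" "z = walk_at a \<omega> t"
    obtain u where u: "u > t" "\<And>t'. t \<le> t' \<Longrightarrow> t' < u \<Longrightarrow> walk_at a \<omega> t' = z"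
      using walk_at_right_constant[of t a \<omega>] t by auto
    show "(INF q::rat. if 0 \<le> q \<and> walk_at a \<omega> (of_rat q) = walk_at a \<omega> t
        then ereal (of_rat q) else \<infinity>) \<le> ereal t"
    proof (rule ereal_le_epsilon2)
      fix e :: real assume "0 < e"
      then obtain q where q: "t < of_rat q" "of_rat q < min u (t + e)"
        using of_rat_dense[of t "min u (t + e)"] u by auto
      then have "0 \<le> q" "walk_at a \<omega> (of_rat q) = walk_at a \<omega> t"
        using t u(2)[of "of_rat q"] by (auto simp: zero_le_of_rat_iff[symmetric, where 'a = real]
          simp del: zero_le_of_rat_iff)
      then have "(INF q::rat. if 0 \<le> q \<and> walk_at a \<omega> (of_rat q) = walk_at a \<omega> t
          then ereal (of_rat q) else \<infinity>) \<le> ereal (of_rat q)"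
        by (intro INF_lower2[of q]) auto
      also have "\<dots> \<le> ereal t + ereal e"
        using q by simp
      finally show "(INF q::rat. if 0 \<le> q \<and> walk_at a \<omega> (of_rat q) = walk_at a \<omega> t
          then ereal (of_rat q) else \<infinity>) \<le> ereal t + ereal e" .
    qed
  qed
qed

lemma measurable_hitting_time [measurable]:
  fixes G :: "'v::countable ugraph"
  shows "hitting_time a z \<in> borel_measurable (walk_space G)"
proof -
  have "(\<lambda>\<omega>. INF q::rat. if 0 \<le> q \<and> walk_at a \<omega> (of_rat q) = z then ereal (of_rat q) else \<infinity>)
      \<in> borel_measurable (walk_space G)"
    by measurable
  then show ?thesis
    by (simp add: hitting_time_eq_INF_rat[abs_def])
qed

section \<open>The path after its first jump\<close>

lemma jump_time_Suc_Stream: "jump_time (x ## \<omega>) (Suc n) = fst x + jump_time \<omega> n"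
  by (simp add: jump_time_def sum.lessThan_Suc_shift del: sum.lessThan_Suc)

lemma jump_chain_Suc_Stream: "jump_chain a (x ## \<omega>) (Suc n) = jump_chain (snd x a) \<omega> n"
  by (induction n) auto

lemma jump_time_0 [simp]: "jump_time \<omega> 0 = 0"
  by (simp add: jump_time_def)

text \<open>A zero first holding time would already have moved the walk away at time 0, because
  \<open>walk_at\<close> compares strictly.\<close>

lemma hitting_time_start:
  assumes "0 < fst (shd \<omega>)"
  shows "hitting_time a a \<omega> = 0"
proof -
  have "(LEAST n. 0 < jump_time \<omega> (Suc n)) = 0"
    using assms by (intro Least_eq_0) (simp add: jump_time_def)
  then have "walk_at a \<omega> 0 = a"
    by (simp add: walk_at_def)
  then have "hitting_time a a \<omega> \<le> ereal 0"
    unfolding hitting_time_def by (intro Inf_lower) auto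
  moreover have "0 \<le> hitting_time a a \<omega>"
    unfolding hitting_time_def by (intro Inf_greatest) auto
  ultimately show ?thesis
    by (simp add: zero_ereal_def)
qed

lemma walk_at_before:
  assumes "t < fst x"
  shows "walk_at a (x ## \<omega>) t = a"
proof -
  have "(LEAST n. t < jump_time (x ## \<omega>) (Suc n)) = 0"
    using assms by (intro Least_eq_0) (simp add: jump_time_Suc_Stream)
  then show ?thesis
    by (simp add: walk_at_def)
qed

text \<open>The least index drops by one under the shift. Without a jump time beyond t both
  \<open>LEAST\<close> terms would be unspecified and unrelated, whence the second
  assumption.\<close>

lemma walk_at_after:
  assumes "fst x \<le> t" and "\<exists>n. t - fst x < jump_time \<omega> (Suc n)"
  shows "walk_at a (x ## \<omega>) t = walk_at (snd x a) \<omega> (t - fst x)"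
proof -
  let ?P = "\<lambda>n. t < jump_time (x ## \<omega>) (Suc n)"
  obtain n where "t - fst x < jump_time \<omega> (Suc n)"
    using assms(2) by blast
  then have "(LEAST n. ?P n) = Suc (LEAST n. ?P (Suc n))"
    using assms(1) by (intro Least_Suc[of _ "Suc n"]) (auto simp: jump_time_Suc_Stream)
  also have "(\<lambda>n. ?P (Suc n)) = (\<lambda>n. t - fst x < jump_time \<omega> (Suc n))"
    by (auto simp: jump_time_Suc_Stream)
  finally show ?thesis
    by (simp add: walk_at_def jump_chain_Suc_Stream del: jump_chain.simps(2))
qed

text \<open>Before time \<open>fst x\<close> the walk rests at a, which is not z, so every visit to
  z belongs to the shifted path.\<close>

lemma hitting_time_Stream:
  assumes "a \<noteq> z" and "0 < fst x" and "\<And>t. \<exists>n. t < jump_time \<omega> (Suc n)"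
  shows "hitting_time a z (x ## \<omega>) = ereal (fst x) + hitting_time (snd x a) z \<omega>"
proof -
  let ?S = "{ereal t | t. 0 \<le> t \<and> walk_at (snd x a) \<omega> t = z}"
  have "{ereal t | t. 0 \<le> t \<and> walk_at a (x ## \<omega>) t = z} = (\<lambda>y. ereal (fst x) + y) ` ?S"
    (is "?L = ?R")
  proof (intro set_eqI iffI)
    fix y assume "y \<in> ?L"
    then obtain t where t: "y = ereal t" "0 \<le> t" "walk_at a (x ## \<omega>) t = z"
      by auto
    then have "fst x \<le> t"
      using walk_at_before[of t x a \<omega>] assms(1) by (cases "t < fst x") auto
    then have "walk_at (snd x a) \<omega> (t - fst x) = z" "0 \<le> t - fst x"
        "y = ereal (fst x) + ereal (t - fst x)"
      using walk_at_after[of x t \<omega> a] assms(3) t by auto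
    then show "y \<in> ?R"
      by blast
  next
    fix y assume "y \<in> ?R"
    then obtain t where t: "y = ereal (fst x) + ereal t" "0 \<le> t" "walk_at (snd x a) \<omega> t = z"
      by auto
    then have "walk_at a (x ## \<omega>) (fst x + t) = z"
      using walk_at_after[of x "fst x + t" \<omega> a] assms(3) by auto
    then show "y \<in> ?L"
      using t assms(2) by (auto intro!: exI[of _ "fst x + t"])
  qed
  then have "hitting_time a z (x ## \<omega>) = (INF y\<in>?S. ereal (fst x) + y)"
    by (simp add: hitting_time_def)
  also have "\<dots> = ereal (fst x) + Inf ?S"
  \<comment> \<open>\<open>INF_ereal_add_right\<close> asks for a nonempty index set; if z is never
    reached, both sides are infinite.\<close>
  proof (cases "?S = {}")
    case True
    show ?thesis
      unfolding True by (simp add: top_ereal_def)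
  next
    case False
    then have "(INF y\<in>?S. ereal (fst x) + y) = ereal (fst x) + (INF y\<in>?S. y)"
      by (rule INF_ereal_add_right) auto
    then show ?thesis
      by simp
  qed
  finally show ?thesis
    by (simp add: hitting_time_def)
qed

section \<open>The law of the hitting time\<close>

abbreviation hold_dist :: "real measure" where
  "hold_dist \<equiv> density lborel (exponential_density 1)"

lemma prob_space_hold_dist: "prob_space hold_dist"
  by (rule prob_space_exponential_density) simp

lemma prob_space_jump_dist: "prob_space (jump_dist G)"
  unfolding jump_dist_def by (intro prob_space_PiM prob_space_measure_pmf)

lemma prob_space_step_space: "prob_space (step_space G)"
proof -
  interpret H: prob_space hold_dist by (rule prob_space_hold_dist)
  interpret J: prob_space "jump_dist G" by (rule prob_space_jump_dist)
  interpret P: pair_prob_space hold_dist "jump_dist G" ..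
  show ?thesis
    unfolding step_space_eq by (rule P.prob_space_axioms)
qed

lemma prob_space_walk_space: "prob_space (walk_space G)"
  unfolding walk_space_def by (rule prob_space.prob_space_stream_space[OF prob_space_step_space])

lemma AE_hold_dist_pos: "AE e in hold_dist. 0 < e"
proof -
  have "AE e in lborel. e \<noteq> (0::real)"
    by (rule AE_lborel_singleton)
  then show ?thesis
    by (subst AE_density) (auto simp: exponential_density_def elim!: eventually_mono)
qed

text \<open>The integrand against Lebesgue measure is half the density of the exponential law of
  rate 2. This 1/2 drives both the non-explosion argument and the fair race of two clocks.\<close>

lemma nn_integral_hold_dist_exp: "(\<integral>\<^sup>+e. ennreal (exp (- e)) \<partial>hold_dist) = ennreal (1 / 2)"
proof -
  have "(\<integral>\<^sup>+e. ennreal (exp (- e)) \<partial>hold_dist)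
      = (\<integral>\<^sup>+e. ennreal (exponential_density 1 e) * ennreal (exp (- e)) \<partial>lborel)"
    by (subst nn_integral_density) auto
  also have "\<dots> = (\<integral>\<^sup>+e. ennreal (1 / 2) * ennreal (exponential_density 2 e) \<partial>lborel)"
    by (intro nn_integral_cong)
       (auto simp: exponential_density_def ennreal_mult[symmetric] exp_add[symmetric]
             simp del: ennreal_half)
  also have "\<dots> = ennreal (1 / 2) * (\<integral>\<^sup>+e. ennreal (exponential_density 2 e) \<partial>lborel)"
    by (rule nn_integral_cmult) simp
  also have "(\<integral>\<^sup>+e. ennreal (exponential_density 2 e) \<partial>lborel) = 1"
    using prob_space.emeasure_space_1[OF prob_space_exponential_density[of 2]]
    by (simp add: emeasure_density)
  finally show ?thesis
    by (simp del: ennreal_half)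
qed

lemma nn_integral_step_space:
  assumes "f \<in> borel_measurable (step_space G)"
  shows "(\<integral>\<^sup>+x. f x \<partial>step_space G) = (\<integral>\<^sup>+e. \<integral>\<^sup>+g. f (e, g) \<partial>jump_dist G \<partial>hold_dist)"
proof -
  interpret J: prob_space "jump_dist G" by (rule prob_space_jump_dist)
  show ?thesis
    using assms unfolding step_space_eq by (rule J.nn_integral_fst[symmetric])
qed

lemma AE_step_space_pos: "AE x in step_space G. 0 < fst x"
proof -
  interpret H: prob_space hold_dist by (rule prob_space_hold_dist)
  interpret J: prob_space "jump_dist G" by (rule prob_space_jump_dist)
  interpret P: pair_sigma_finite hold_dist "jump_dist G" ..
  show ?thesis
    unfolding step_space_eq
  proof (rule P.AE_pair_measure)
    show "{x \<in> space (hold_dist \<Otimes>\<^sub>M jump_dist G). 0 < fst x} \<in> sets (hold_dist \<Otimes>\<^sub>M jump_dist G)"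
      by measurable
    show "AE e in hold_dist. AE f in jump_dist G. 0 < fst (e, f)"
      using AE_hold_dist_pos by (auto elim!: eventually_mono)
  qed
qed

lemma AE_walk_space_Stream_pos: "AE \<omega> in walk_space G. 0 < fst (shd \<omega>)"
proof -
  interpret S: prob_space "step_space G" by (rule prob_space_step_space)
  have "AE \<omega> in walk_space G. stream_all (\<lambda>x. 0 < fst x) \<omega>"
    unfolding walk_space_def by (rule S.AE_stream_all[OF _ AE_step_space_pos]) measurable
  then show ?thesis
    by eventually_elim (auto dest: bspec[OF _ shd_sset])
qed

text \<open>The random variable \<open>\<psi> = exp (- explosion time)\<close> satisfies \<open>E \<psi> = E \<psi> / 2\<close> by conditioning on
  the first holding time, so the explosion time is almost surely infinite.\<close>

lemma AE_walk_space_nonexplosive: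
  "AE \<omega> in walk_space G. \<forall>t. \<exists>n. t < jump_time \<omega> (Suc n)"
proof -
  interpret S: prob_space "step_space G" by (rule prob_space_step_space)
  interpret W: prob_space "walk_space G" by (rule prob_space_walk_space)
  define \<psi> :: "(real \<times> ('a \<Rightarrow> 'a)) stream \<Rightarrow> ennreal"
    where "\<psi> \<omega> = (INF n. ennreal (exp (- jump_time \<omega> n)))" for \<omega>
  have \<psi>_meas [measurable]: "\<psi> \<in> borel_measurable (walk_space G)"
    unfolding \<psi>_def[abs_def] by measurable
  have \<psi>_le1: "\<psi> \<omega> \<le> 1" for \<omega>
    unfolding \<psi>_def by (rule INF_lower2[of 0]) auto
  have \<psi>_Stream: "\<psi> (x ## \<omega>) \<le> ennreal (exp (- fst x)) * \<psi> \<omega>" for x \<omega>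
  proof -
    \<comment> \<open>Scaling up by \<open>exp (fst x)\<close> bounds each term of the infimum
      \<psi> \<omega>; scaling back down then gives the claim.\<close>
    have "ennreal (exp (fst x)) * \<psi> (x ## \<omega>) \<le> ennreal (exp (- jump_time \<omega> n))" for n
    proof -
      have "\<psi> (x ## \<omega>) \<le> ennreal (exp (- (fst x + jump_time \<omega> n)))"
        unfolding \<psi>_def by (rule INF_lower2[of "Suc n"]) (auto simp: jump_time_Suc_Stream)
      then have "ennreal (exp (fst x)) * \<psi> (x ## \<omega>)
          \<le> ennreal (exp (fst x)) * ennreal (exp (- (fst x + jump_time \<omega> n)))"
        by (intro mult_left_mono) auto
      also have "\<dots> = ennreal (exp (- jump_time \<omega> n))"
        by (simp add: ennreal_mult[symmetric] exp_add[symmetric])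
      finally show ?thesis .
    qed
    then have "ennreal (exp (fst x)) * \<psi> (x ## \<omega>) \<le> \<psi> \<omega>"
      unfolding \<psi>_def[of \<omega>] by (intro INF_greatest)
    then have "ennreal (exp (- fst x)) * (ennreal (exp (fst x)) * \<psi> (x ## \<omega>))
        \<le> ennreal (exp (- fst x)) * \<psi> \<omega>"
      by (intro mult_left_mono) auto
    also have "ennreal (exp (- fst x)) * (ennreal (exp (fst x)) * \<psi> (x ## \<omega>)) = \<psi> (x ## \<omega>)"
      by (simp add: mult.assoc[symmetric] ennreal_mult[symmetric] exp_add[symmetric])
    finally show ?thesis .
  qed
  define I where "I = (\<integral>\<^sup>+\<omega>. \<psi> \<omega> \<partial>walk_space G)"
  have "I \<le> (\<integral>\<^sup>+\<omega>. 1 \<partial>walk_space G)"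
    unfolding I_def by (intro nn_integral_mono \<psi>_le1)
  then have I1: "I \<le> 1"
    by (simp add: W.emeasure_space_1)
  have "I = (\<integral>\<^sup>+x. (\<integral>\<^sup>+\<omega>. \<psi> (x ## \<omega>) \<partial>walk_space G) \<partial>step_space G)"
    unfolding I_def walk_space_def
    by (rule S.nn_integral_stream_space) (use \<psi>_meas in \<open>simp add: walk_space_def\<close>)
  also have "\<dots> \<le> (\<integral>\<^sup>+x. (\<integral>\<^sup>+\<omega>. ennreal (exp (- fst x)) * \<psi> \<omega> \<partial>walk_space G) \<partial>step_space G)"
    by (intro nn_integral_mono \<psi>_Stream)
  also have "\<dots> = (\<integral>\<^sup>+x. ennreal (exp (- fst x)) * I \<partial>step_space G)"
    unfolding I_def by (subst nn_integral_cmult) auto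
  also have "\<dots> = (\<integral>\<^sup>+e. \<integral>\<^sup>+g. ennreal (exp (- e)) * I \<partial>jump_dist G \<partial>hold_dist)"
    by (subst nn_integral_step_space) auto
  also have "\<dots> = (\<integral>\<^sup>+e. ennreal (exp (- e)) * I \<partial>hold_dist)"
    by (simp add: prob_space.emeasure_space_1[OF prob_space_jump_dist])
  also have "\<dots> = (\<integral>\<^sup>+e. ennreal (exp (- e)) \<partial>hold_dist) * I"
    by (rule nn_integral_multc) simp
  finally have I2: "I \<le> ennreal (1 / 2) * I"
    unfolding nn_integral_hold_dist_exp .
  \<comment> \<open>The inequality I \<le> I / 2 also holds for I = \<infinity>, so the bound I
    \<le> 1 is what allows passing to a real number.\<close>
  have "I = 0"
  proof -
    obtain i where i: "I = ennreal i" "0 \<le> i"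
      using I1 by (cases I) (auto simp: top_unique)
    have "ennreal (1 / 2) * I = ennreal (i / 2)"
      unfolding i(1) using i(2) by (subst ennreal_mult[symmetric]) auto
    then have "ennreal i \<le> ennreal (i / 2)"
      using I2 i(1) by simp
    then have "i \<le> i / 2"
      using i by (subst (asm) ennreal_le_iff) auto
    then show ?thesis
      using i by simp
  qed
  then have "AE \<omega> in walk_space G. \<psi> \<omega> = 0"
    unfolding I_def by (subst (asm) nn_integral_0_iff_AE) auto
  with AE_walk_space_Stream_pos show ?thesis
  proof eventually_elim
    case (elim \<omega>)
    show ?case
    proof
      fix t
      \<comment> \<open>The maximum with 0 rules out n = 0, since \<open>jump_time\<close> vanishes
        there; so n is a successor, as the goal demands.\<close>
      have "(INF n. ennreal (exp (- jump_time \<omega> n))) < ennreal (exp (- max t 0))"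
        using elim by (simp add: \<psi>_def)
      then obtain n where n: "ennreal (exp (- jump_time \<omega> n)) < ennreal (exp (- max t 0))"
        by (auto simp: INF_less_iff)
      then have "max t 0 < jump_time \<omega> n"
        by (simp add: ennreal_less_iff)
      then show "\<exists>n. t < jump_time \<omega> (Suc n)"
        by (cases n) auto
    qed
  qed
qed

section \<open>First-step decomposition of the hitting-time law\<close>

definition hit_law :: "'v ugraph \<Rightarrow> 'v \<Rightarrow> 'v \<Rightarrow> ereal measure" where
  "hit_law G z a = distr (walk_space G) borel (hitting_time a z)"

text \<open>The law of the time still needed after the first ring at a: the jump is made at once and
  the first holding time left out. Separating it from the clock is what lets the two current clocks
  race with everything else frozen.\<close>

definition hit_law_jump :: "'v ugraph \<Rightarrow> 'v \<Rightarrow> 'v \<Rightarrow> ereal measure" where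
  "hit_law_jump G z a =
     distr (jump_dist G \<Otimes>\<^sub>M walk_space G) borel (\<lambda>(f, \<omega>). hitting_time (f a) z \<omega>)"

lemma sets_hit_law [measurable_cong, simp]: "sets (hit_law G z a) = sets borel"
  by (simp add: hit_law_def)

lemma sets_hit_law_jump [measurable_cong, simp]: "sets (hit_law_jump G z a) = sets borel"
  by (simp add: hit_law_jump_def)

lemma measurable_hitting_time_jump [measurable]:
  fixes G :: "'v::countable ugraph"
  shows "(\<lambda>(f, \<omega>). hitting_time (f a) z \<omega>) \<in> borel_measurable (jump_dist G \<Otimes>\<^sub>M walk_space G)"
  unfolding case_prod_beta
  by (rule measurable_compose_countable[where g = "\<lambda>x. fst x a"])
     (auto intro: measurable_compose[OF measurable_snd measurable_hitting_time]
       measurable_compose[OF measurable_fst measurable_jump_dist])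

lemma prob_space_hit_law:
  fixes G :: "'v::countable ugraph"
  shows "prob_space (hit_law G z a)"
  unfolding hit_law_def by (rule prob_space.prob_space_distr[OF prob_space_walk_space]) measurable

lemma prob_space_hit_law_jump:
  fixes G :: "'v::countable ugraph"
  shows "prob_space (hit_law_jump G z a)"
proof -
  interpret J: prob_space "jump_dist G" by (rule prob_space_jump_dist)
  interpret W: prob_space "walk_space G" by (rule prob_space_walk_space)
  interpret P: pair_prob_space "jump_dist G" "walk_space G" ..
  show ?thesis
    unfolding hit_law_jump_def by (rule P.prob_space_distr) measurable
qed

lemma nn_integral_hit_law_start:
  fixes G :: "'v::countable ugraph"
  assumes [measurable]: "g \<in> borel_measurable borel"
  shows "(\<integral>\<^sup>+t. g t \<partial>hit_law G z z) = g 0"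
proof -
  have "(\<integral>\<^sup>+t. g t \<partial>hit_law G z z) = (\<integral>\<^sup>+\<omega>. g (hitting_time z z \<omega>) \<partial>walk_space G)"
    unfolding hit_law_def by (rule nn_integral_distr) measurable
  also have "\<dots> = (\<integral>\<^sup>+\<omega>. g 0 \<partial>walk_space G)"
    using AE_walk_space_Stream_pos[of G]
    by (intro nn_integral_cong_AE) (auto simp: hitting_time_start elim!: eventually_mono)
  finally show ?thesis
    by (simp add: prob_space.emeasure_space_1[OF prob_space_walk_space])
qed

text \<open>The hitting time is a holding time plus an independent residual time. Stated for all
  test functions g, this is exactly the form that \<open>nn_integral_race_first_step\<close> assumes
  of T and T'.\<close>

lemma nn_integral_hit_law:
  fixes G :: "'v::countable ugraph"
  assumes [measurable]: "g \<in> borel_measurable borel" and "a \<noteq> z"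
  shows "(\<integral>\<^sup>+t. g t \<partial>hit_law G z a) = (\<integral>\<^sup>+e. \<integral>\<^sup>+t. g (ereal e + t) \<partial>hit_law_jump G z a \<partial>hold_dist)"
proof -
  interpret S: prob_space "step_space G" by (rule prob_space_step_space)
  interpret W: prob_space "walk_space G" by (rule prob_space_walk_space)
  have meas [measurable]:
    "(\<lambda>(x, \<omega>). g (ereal (fst x) + hitting_time (snd x a) z \<omega>))
       \<in> borel_measurable (step_space G \<Otimes>\<^sub>M walk_space G)"
  proof -
    have "(\<lambda>x. hitting_time (snd (fst x) a) z (snd x)) \<in> borel_measurable (step_space G \<Otimes>\<^sub>M walk_space G)"
      by (rule measurable_compose_countable[where g = "\<lambda>x. snd (fst x) a"])
         (auto intro: measurable_compose[OF measurable_snd measurable_hitting_time]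
           measurable_compose[OF measurable_fst measurable_snd_step_space])
    then show ?thesis
      unfolding case_prod_beta by measurable
  qed
  have "(\<integral>\<^sup>+t. g t \<partial>hit_law G z a) = (\<integral>\<^sup>+\<omega>. g (hitting_time a z \<omega>) \<partial>walk_space G)"
    unfolding hit_law_def by (rule nn_integral_distr) measurable
  also have "\<dots> = (\<integral>\<^sup>+x. (\<integral>\<^sup>+\<omega>. g (hitting_time a z (x ## \<omega>)) \<partial>walk_space G) \<partial>step_space G)"
    unfolding walk_space_def
    by (rule S.nn_integral_stream_space)
       (use measurable_compose[OF measurable_hitting_time assms(1)] in \<open>simp add: walk_space_def\<close>)
  also have "\<dots> = (\<integral>\<^sup>+x. (\<integral>\<^sup>+\<omega>. g (ereal (fst x) + hitting_time (snd x a) z \<omega>) \<partial>walk_space G) \<partial>step_space G)"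
  proof (rule nn_integral_cong_AE)
    show "AE x in step_space G. (\<integral>\<^sup>+\<omega>. g (hitting_time a z (x ## \<omega>)) \<partial>walk_space G)
        = (\<integral>\<^sup>+\<omega>. g (ereal (fst x) + hitting_time (snd x a) z \<omega>) \<partial>walk_space G)"
      using AE_step_space_pos
    proof eventually_elim
      case (elim x)
      show ?case
        using AE_walk_space_nonexplosive[of G]
        by (intro nn_integral_cong_AE)
           (auto simp: hitting_time_Stream[OF assms(2) elim] elim!: eventually_mono)
    qed
  qed
  also have "\<dots> = (\<integral>\<^sup>+e. \<integral>\<^sup>+f. (\<integral>\<^sup>+\<omega>. g (ereal e + hitting_time (f a) z \<omega>) \<partial>walk_space G)
      \<partial>jump_dist G \<partial>hold_dist)"
    using W.borel_measurable_nn_integral[OF meas] by (subst nn_integral_step_space) simp_all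
  also have "\<dots> = (\<integral>\<^sup>+e. \<integral>\<^sup>+t. g (ereal e + t) \<partial>hit_law_jump G z a \<partial>hold_dist)"
  proof (rule nn_integral_cong)
    fix e
    have "(\<integral>\<^sup>+t. g (ereal e + t) \<partial>hit_law_jump G z a)
        = (\<integral>\<^sup>+x. g (ereal e + (case x of (f, \<omega>) \<Rightarrow> hitting_time (f a) z \<omega>)) \<partial>(jump_dist G \<Otimes>\<^sub>M walk_space G))"
      unfolding hit_law_jump_def by (rule nn_integral_distr) measurable
    also have "\<dots> = (\<integral>\<^sup>+f. (\<integral>\<^sup>+\<omega>. g (ereal e + hitting_time (f a) z \<omega>) \<partial>walk_space G) \<partial>jump_dist G)"
      by (subst W.nn_integral_fst[symmetric]) simp_all
    finally show "(\<integral>\<^sup>+f. (\<integral>\<^sup>+\<omega>. g (ereal e + hitting_time (f a) z \<omega>) \<partial>walk_space G) \<partial>jump_dist G)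
        = (\<integral>\<^sup>+t. g (ereal e + t) \<partial>hit_law_jump G z a)" ..
  qed
  finally show ?thesis .
qed

lemma nn_integral_hit_law_jump:
  fixes G :: "'v::countable ugraph"
  assumes [measurable]: "g \<in> borel_measurable borel" and "a \<in> verts G"
    and N: "finite (neighbors G a)" "neighbors G a \<noteq> {}"
  shows "(\<integral>\<^sup>+t. g t \<partial>hit_law_jump G z a)
    = (\<Sum>a'\<in>neighbors G a. \<integral>\<^sup>+t. g t \<partial>hit_law G z a') / card (neighbors G a)"
proof -
  interpret W: prob_space "walk_space G" by (rule prob_space_walk_space)
  have "(\<integral>\<^sup>+t. g t \<partial>hit_law_jump G z a)
      = (\<integral>\<^sup>+x. g (case x of (f, \<omega>) \<Rightarrow> hitting_time (f a) z \<omega>) \<partial>(jump_dist G \<Otimes>\<^sub>M walk_space G))"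
    unfolding hit_law_jump_def by (rule nn_integral_distr) measurable
  also have "\<dots> = (\<integral>\<^sup>+f. (\<integral>\<^sup>+\<omega>. g (hitting_time (f a) z \<omega>) \<partial>walk_space G) \<partial>jump_dist G)"
    by (subst W.nn_integral_fst[symmetric]) simp_all
  also have "\<dots> = (\<integral>\<^sup>+f. (\<integral>\<^sup>+t. g t \<partial>hit_law G z (f a)) \<partial>jump_dist G)"
    unfolding hit_law_def by (intro nn_integral_cong nn_integral_distr[symmetric]) measurable
  also have "\<dots> = (\<integral>\<^sup>+v. (\<integral>\<^sup>+t. g t \<partial>hit_law G z v)
      \<partial>distr (jump_dist G) (measure_pmf (pmf_of_set (neighbors G a))) (\<lambda>f. f a))"
    by (rule nn_integral_distr[symmetric]) (use measurable_jump_dist in simp_all)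
  also have "distr (jump_dist G) (measure_pmf (pmf_of_set (neighbors G a))) (\<lambda>f. f a)
      = measure_pmf (pmf_of_set (neighbors G a))"
    unfolding jump_dist_def using assms(2)
    by (intro distr_PiM_component) (auto intro: prob_space_measure_pmf)
  also have "(\<integral>\<^sup>+v. (\<integral>\<^sup>+t. g t \<partial>hit_law G z v) \<partial>measure_pmf (pmf_of_set (neighbors G a)))
      = (\<Sum>a'\<in>neighbors G a. \<integral>\<^sup>+t. g t \<partial>hit_law G z a') / card (neighbors G a)"
    by (rule nn_integral_pmf_of_set[OF N(2,1)])
  finally show ?thesis .
qed

section \<open>The first-step equation\<close>

text \<open>Turns the capture probability into one expectation. Giving ties weight 1/2 makes
  swapping the racers a complement for all arguments, infinite ones included.\<close>

definition race :: "ereal \<Rightarrow> ereal \<Rightarrow> ennreal" where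
  "race s t = (if s < t then 1 else if s = t then ennreal (1 / 2) else 0)"

lemma measurable_race [measurable]:
  assumes [measurable]: "f \<in> borel_measurable M" "g \<in> borel_measurable M"
  shows "(\<lambda>x. race (f x) (g x)) \<in> borel_measurable M"
  unfolding race_def by measurable

lemma race_swap: "race s t + race t s = 1"
  by (auto simp: race_def ennreal_plus[symmetric] simp del: ennreal_plus ennreal_half)

lemma race_le_1: "race s t \<le> 1"
  using race_swap[of s t] by (metis le_iff_add)

lemma ennreal_eq_diff_of_add_eq_1:
  assumes "I + ennreal c = 1" "0 \<le> c"
  shows "I = ennreal (1 - c)"
proof (cases I)
  case (real i)
  then have "ennreal (i + c) = ennreal 1"
    using assms by simp
  then have "i + c = 1"
    using real assms by (subst (asm) ennreal_inj) auto
  then show ?thesis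
    using real by (simp add: algebra_simps)
qed (use assms in simp)

lemma emeasure_hold_dist_UNIV [simp]: "emeasure hold_dist UNIV = 1"
  using prob_space.emeasure_space_1[OF prob_space_hold_dist] by simp

lemma nn_integral_race_hold:
  assumes "0 \<le> u"
  shows "(\<integral>\<^sup>+e. race (ereal u) (ereal e) \<partial>hold_dist) = ennreal (exp (- u))"
proof -
  interpret H: prob_space hold_dist by (rule prob_space_hold_dist)
  have "AE e in lborel. e \<noteq> u"
    by (rule AE_lborel_singleton)
  then have "AE e in hold_dist. e \<noteq> u"
    by (subst AE_density) (auto elim!: eventually_mono)
  then have "(\<integral>\<^sup>+e. race (ereal u) (ereal e) \<partial>hold_dist) = (\<integral>\<^sup>+e. indicator {u<..} e \<partial>hold_dist)"
    by (intro nn_integral_cong_AE) (auto simp: race_def indicator_def elim!: eventually_mono)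
  also have "\<dots> = emeasure hold_dist {u<..}"
    by simp
  also have "\<dots> = ennreal (H.prob {u<..})"
    by (rule H.emeasure_eq_measure)
  also have "H.prob {u<..} = exp (- u)"
  proof -
    have "distributed hold_dist lborel (\<lambda>e. e) (exponential_density 1)"
      by (auto simp: distributed_def distr_id2 intro!: distr_id2)
    from H.exponential_distributedD_gt[OF this assms] show ?thesis
      by (simp add: greaterThan_def)
  qed
  finally show ?thesis .
qed

lemma nn_integral_race_hold_right:
  assumes "y \<le> x"
  shows "(\<integral>\<^sup>+e. race (ereal x) (ereal e + ereal y) \<partial>hold_dist) = ennreal (exp (y - x))"
proof -
  have "race (ereal x) (ereal e + ereal y) = race (ereal (x - y)) (ereal e)" for e
    by (auto simp: race_def)
  then show ?thesis
    using nn_integral_race_hold[of "x - y"] assms by simp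
qed

text \<open>A racer that is not ahead and still has to wait almost surely loses; positivity of e
  excludes a tie when x = y.\<close>

lemma nn_integral_race_hold_left:
  assumes "y \<le> x"
  shows "(\<integral>\<^sup>+e. race (ereal e + ereal x) (ereal y) \<partial>hold_dist) = 0"
proof -
  have "(\<integral>\<^sup>+e. race (ereal e + ereal x) (ereal y) \<partial>hold_dist) = (\<integral>\<^sup>+e. 0 \<partial>hold_dist)"
    using AE_hold_dist_pos assms
    by (intro nn_integral_cong_AE) (auto simp: race_def elim!: eventually_mono)
  then show ?thesis
    by simp
qed

text \<open>Given e > 0, the second clock must outlast e + x - y, which has probability exp (y - x)
  exp (- e); the last factor averages to 1/2.\<close>

lemma nn_integral_race_hold_both:
  assumes "y \<le> x"
  shows "(\<integral>\<^sup>+e. \<integral>\<^sup>+e'. race (ereal e + ereal x) (ereal e' + ereal y) \<partial>hold_dist \<partial>hold_dist)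
    = ennreal (exp (y - x) / 2)"
proof -
  have "(\<integral>\<^sup>+e. \<integral>\<^sup>+e'. race (ereal e + ereal x) (ereal e' + ereal y) \<partial>hold_dist \<partial>hold_dist)
      = (\<integral>\<^sup>+e. ennreal (exp (y - x)) * ennreal (exp (- e)) \<partial>hold_dist)"
  proof (rule nn_integral_cong_AE)
    show "AE e in hold_dist. (\<integral>\<^sup>+e'. race (ereal e + ereal x) (ereal e' + ereal y) \<partial>hold_dist)
        = ennreal (exp (y - x)) * ennreal (exp (- e))"
      using AE_hold_dist_pos
    proof eventually_elim
      case (elim e)
      then show ?case
        using nn_integral_race_hold_right[of y "e + x"] assms
        by (simp add: ennreal_mult[symmetric] exp_add[symmetric] algebra_simps)
    qed
  qed
  also have "\<dots> = ennreal (exp (y - x)) * ennreal (1 / 2)"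
    unfolding nn_integral_hold_dist_exp[symmetric] by (rule nn_integral_cmult) simp
  also have "\<dots> = ennreal (exp (y - x) / 2)"
    by (subst ennreal_mult[symmetric]) auto
  finally show ?thesis .
qed

lemma nn_integral_race_hold_complement:
  "(\<integral>\<^sup>+e. race (ereal e + ereal x) (ereal y) \<partial>hold_dist)
    + (\<integral>\<^sup>+e. race (ereal y) (ereal e + ereal x) \<partial>hold_dist) = 1"
proof -
  have "(\<integral>\<^sup>+e. race (ereal e + ereal x) (ereal y) \<partial>hold_dist)
      + (\<integral>\<^sup>+e. race (ereal y) (ereal e + ereal x) \<partial>hold_dist)
      = (\<integral>\<^sup>+e. race (ereal e + ereal x) (ereal y) + race (ereal y) (ereal e + ereal x) \<partial>hold_dist)"
    by (rule nn_integral_add[symmetric]) measurable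
  then show ?thesis
    by (simp add: race_swap)
qed

text \<open>Reduces x < y to the computed case y \<le> x: swapping the racers complements the race,
  and Fubini restores the order of the two clocks.\<close>

lemma nn_integral_race_hold_both_complement:
  "(\<integral>\<^sup>+e. \<integral>\<^sup>+e'. race (ereal e + ereal x) (ereal e' + ereal y) \<partial>hold_dist \<partial>hold_dist)
    + (\<integral>\<^sup>+e. \<integral>\<^sup>+e'. race (ereal e + ereal y) (ereal e' + ereal x) \<partial>hold_dist \<partial>hold_dist) = 1"
proof -
  interpret H: prob_space hold_dist by (rule prob_space_hold_dist)
  interpret P: pair_sigma_finite hold_dist hold_dist ..
  have "(\<integral>\<^sup>+e. \<integral>\<^sup>+e'. race (ereal e + ereal y) (ereal e' + ereal x) \<partial>hold_dist \<partial>hold_dist)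
      = (\<integral>\<^sup>+e'. \<integral>\<^sup>+e. race (ereal e + ereal y) (ereal e' + ereal x) \<partial>hold_dist \<partial>hold_dist)"
    by (rule P.Fubini'[symmetric]) measurable
  then have "(\<integral>\<^sup>+e. \<integral>\<^sup>+e'. race (ereal e + ereal x) (ereal e' + ereal y) \<partial>hold_dist \<partial>hold_dist)
      + (\<integral>\<^sup>+e. \<integral>\<^sup>+e'. race (ereal e + ereal y) (ereal e' + ereal x) \<partial>hold_dist \<partial>hold_dist)
    = (\<integral>\<^sup>+e. (\<integral>\<^sup>+e'. race (ereal e + ereal x) (ereal e' + ereal y) \<partial>hold_dist)
      + (\<integral>\<^sup>+e'. race (ereal e' + ereal y) (ereal e + ereal x) \<partial>hold_dist) \<partial>hold_dist)"
    by (simp add: nn_integral_add)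
  also have "\<dots> = (\<integral>\<^sup>+e. 1 \<partial>hold_dist)"
  proof (rule nn_integral_cong)
    show "(\<integral>\<^sup>+e'. race (ereal e + ereal x) (ereal e' + ereal y) \<partial>hold_dist)
        + (\<integral>\<^sup>+e'. race (ereal e' + ereal y) (ereal e + ereal x) \<partial>hold_dist) = 1" for e
      using nn_integral_race_hold_complement[of y "e + x"] by (subst add.commute) simp
  qed
  finally show ?thesis
    by simp
qed

text \<open>Whichever clock rings first, the other one starts afresh, so each walk jumps first with
  probability \<open>1/2\<close>.\<close>

lemma nn_integral_race_first_ring:
  "(\<integral>\<^sup>+e. \<integral>\<^sup>+e'. race (ereal e + s) (ereal e' + t) \<partial>hold_dist \<partial>hold_dist)
    = ennreal (1 / 2) * (\<integral>\<^sup>+e'. race s (ereal e' + t) \<partial>hold_dist)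
    + ennreal (1 / 2) * (\<integral>\<^sup>+e. race (ereal e + s) t \<partial>hold_dist)"
proof -
  have half2: "ennreal (1 / 2) * x + ennreal (1 / 2) * x = x" for x
    by (simp only: distrib_right[symmetric] ennreal_plus[symmetric]) simp
  \<comment> \<open>Covers infinite residual times: the finite clocks cannot change the outcome, so
    all three integrals have the same value.\<close>
  have const: "?thesis" if "\<And>e e'. race (ereal e + s) (ereal e' + t) = c"
    "\<And>e'. race s (ereal e' + t) = c" "\<And>e. race (ereal e + s) t = c" for c
    by (simp add: that half2 del: ennreal_half)
  consider (fin) x y where "s = ereal x" "t = ereal y" | "s = \<infinity>" | "s = - \<infinity>" | "t = \<infinity>" | "t = - \<infinity>"
    by (cases s; cases t) auto
  then show ?thesis
  proof cases
    case fin
    show ?thesis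
    proof (cases "y \<le> x")
      case True
      then show ?thesis
        unfolding fin
        by (simp add: nn_integral_race_hold_both nn_integral_race_hold_right nn_integral_race_hold_left
            ennreal_mult[symmetric] del: ennreal_half plus_ereal.simps)
    next
      case False
      then have le: "x \<le> y" by simp
      \<comment> \<open>The probability that a clock outlasts the lead y - x. By complements the
        three integrals become 1 - c/2 for both clocks, 1 for the second alone and 1 - c for the
        first alone.\<close>
      define c where "c = exp (x - y)"
      have c: "0 \<le> c" "c \<le> 1"
        using le by (auto simp: c_def)
      have "(\<integral>\<^sup>+e. \<integral>\<^sup>+e'. race (ereal e + ereal x) (ereal e' + ereal y) \<partial>hold_dist \<partial>hold_dist)
          = ennreal (1 - c / 2)"
        using nn_integral_race_hold_both_complement[of x y] nn_integral_race_hold_both[OF le] c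
        by (intro ennreal_eq_diff_of_add_eq_1) (auto simp: c_def simp del: plus_ereal.simps)
      moreover have "(\<integral>\<^sup>+e. race (ereal e + ereal x) (ereal y) \<partial>hold_dist) = ennreal (1 - c)"
        using nn_integral_race_hold_complement[of x y] nn_integral_race_hold_right[OF le] c
        by (intro ennreal_eq_diff_of_add_eq_1) (auto simp: c_def simp del: plus_ereal.simps)
      moreover have "(\<integral>\<^sup>+e. race (ereal x) (ereal e + ereal y) \<partial>hold_dist) = ennreal 1"
        using nn_integral_race_hold_complement[of y x] nn_integral_race_hold_left[OF le]
        by (simp del: plus_ereal.simps)
      moreover have "ennreal (1 - c / 2) = ennreal (1 / 2) * ennreal 1 + ennreal (1 / 2) * ennreal (1 - c)"
        using c by (simp add: ennreal_mult[symmetric] ennreal_plus[symmetric] field_simps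
            del: ennreal_plus ennreal_half ennreal_1)
      ultimately show ?thesis
        unfolding fin by simp
    qed
  next
    case 2
    then show ?thesis
      by (intro const[of "race s t"]) (cases t; simp add: race_def)+
  next
    case 3
    then show ?thesis
      by (intro const[of "race s t"]) (cases t; simp add: race_def)+
  next
    case 4
    then show ?thesis
      by (intro const[of "race s t"]) (cases s; simp add: race_def)+
  next
    case 5
    then show ?thesis
      by (intro const[of "race s t"]) (cases s; simp add: race_def)+
  qed
qed

text \<open>R and R' are the residual laws of T and T'. Both times are split into clock and
  residual, Fubini moves the clocks innermost, \<open>nn_integral_race_first_ring\<close> applies
  for each fixed pair of residuals, and the surviving clock is folded back into T or T'.\<close>

lemma nn_integral_race_first_step:
  fixes R R' T T' :: "ereal measure"
  assumes prob: "prob_space R" "prob_space R'" "prob_space T" "prob_space T'"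
    and sets [measurable_cong]: "sets R = sets borel" "sets R' = sets borel"
      "sets T = sets borel" "sets T' = sets borel"
    and T: "\<And>g. g \<in> borel_measurable borel \<Longrightarrow>
        (\<integral>\<^sup>+t. g t \<partial>T) = (\<integral>\<^sup>+e. \<integral>\<^sup>+t. g (ereal e + t) \<partial>R \<partial>hold_dist)"
    and T': "\<And>g. g \<in> borel_measurable borel \<Longrightarrow>
        (\<integral>\<^sup>+t. g t \<partial>T') = (\<integral>\<^sup>+e. \<integral>\<^sup>+t. g (ereal e + t) \<partial>R' \<partial>hold_dist)"
  shows "(\<integral>\<^sup>+x. \<integral>\<^sup>+y. race x y \<partial>T' \<partial>T)
    = ennreal (1 / 2) * (\<integral>\<^sup>+x. \<integral>\<^sup>+y. race x y \<partial>T' \<partial>R)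
    + ennreal (1 / 2) * (\<integral>\<^sup>+x. \<integral>\<^sup>+y. race x y \<partial>R' \<partial>T)"
proof -
  interpret H: prob_space hold_dist by (rule prob_space_hold_dist)
  interpret R: prob_space R by (rule prob)
  interpret R': prob_space R' by (rule prob)
  interpret T: prob_space T by (rule prob)
  interpret T': prob_space T' by (rule prob)
  interpret HR: pair_sigma_finite hold_dist R ..
  interpret HR': pair_sigma_finite hold_dist R' ..
  interpret RR': pair_sigma_finite R R' ..
  have "(\<integral>\<^sup>+x. \<integral>\<^sup>+y. race x y \<partial>T' \<partial>T)
      = (\<integral>\<^sup>+e. \<integral>\<^sup>+x. \<integral>\<^sup>+y. race (ereal e + x) y \<partial>T' \<partial>R \<partial>hold_dist)"
    by (rule T) measurable
  also have "\<dots> = (\<integral>\<^sup>+x. \<integral>\<^sup>+e. \<integral>\<^sup>+y. race (ereal e + x) y \<partial>T' \<partial>hold_dist \<partial>R)"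
    by (rule HR.Fubini'[symmetric]) measurable
  also have "\<dots> = (\<integral>\<^sup>+x. \<integral>\<^sup>+e. \<integral>\<^sup>+e'. \<integral>\<^sup>+y. race (ereal e + x) (ereal e' + y) \<partial>R' \<partial>hold_dist \<partial>hold_dist \<partial>R)"
    by (subst T') measurable
  also have "\<dots> = (\<integral>\<^sup>+x. \<integral>\<^sup>+e. \<integral>\<^sup>+y. \<integral>\<^sup>+e'. race (ereal e + x) (ereal e' + y) \<partial>hold_dist \<partial>R' \<partial>hold_dist \<partial>R)"
    by (intro nn_integral_cong HR'.Fubini'[symmetric]) measurable
  also have "\<dots> = (\<integral>\<^sup>+x. \<integral>\<^sup>+y. \<integral>\<^sup>+e. \<integral>\<^sup>+e'. race (ereal e + x) (ereal e' + y) \<partial>hold_dist \<partial>hold_dist \<partial>R' \<partial>R)"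
    by (intro nn_integral_cong HR'.Fubini'[symmetric]) measurable
  also have "\<dots> = (\<integral>\<^sup>+x. \<integral>\<^sup>+y. ennreal (1 / 2) * (\<integral>\<^sup>+e'. race x (ereal e' + y) \<partial>hold_dist)
      + ennreal (1 / 2) * (\<integral>\<^sup>+e. race (ereal e + x) y \<partial>hold_dist) \<partial>R' \<partial>R)"
    by (simp only: nn_integral_race_first_ring)
  also have "\<dots> = (\<integral>\<^sup>+x. (\<integral>\<^sup>+y. ennreal (1 / 2) * (\<integral>\<^sup>+e'. race x (ereal e' + y) \<partial>hold_dist) \<partial>R')
      + (\<integral>\<^sup>+y. ennreal (1 / 2) * (\<integral>\<^sup>+e. race (ereal e + x) y \<partial>hold_dist) \<partial>R') \<partial>R)"
    by (intro nn_integral_cong nn_integral_add) measurable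
  also have "\<dots> = (\<integral>\<^sup>+x. \<integral>\<^sup>+y. ennreal (1 / 2) * (\<integral>\<^sup>+e'. race x (ereal e' + y) \<partial>hold_dist) \<partial>R' \<partial>R)
      + (\<integral>\<^sup>+x. \<integral>\<^sup>+y. ennreal (1 / 2) * (\<integral>\<^sup>+e. race (ereal e + x) y \<partial>hold_dist) \<partial>R' \<partial>R)"
    by (rule nn_integral_add) measurable
  also have "(\<integral>\<^sup>+x. \<integral>\<^sup>+y. ennreal (1 / 2) * (\<integral>\<^sup>+e'. race x (ereal e' + y) \<partial>hold_dist) \<partial>R' \<partial>R)
      = ennreal (1 / 2) * (\<integral>\<^sup>+x. \<integral>\<^sup>+y. \<integral>\<^sup>+e'. race x (ereal e' + y) \<partial>hold_dist \<partial>R' \<partial>R)"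
    by (simp add: nn_integral_cmult del: ennreal_half)
  also have "(\<integral>\<^sup>+x. \<integral>\<^sup>+y. \<integral>\<^sup>+e'. race x (ereal e' + y) \<partial>hold_dist \<partial>R' \<partial>R)
      = (\<integral>\<^sup>+x. \<integral>\<^sup>+e'. \<integral>\<^sup>+y. race x (ereal e' + y) \<partial>R' \<partial>hold_dist \<partial>R)"
    by (intro nn_integral_cong HR'.Fubini') measurable
  also have "\<dots> = (\<integral>\<^sup>+x. \<integral>\<^sup>+y. race x y \<partial>T' \<partial>R)"
    by (intro nn_integral_cong T'[symmetric]) measurable
  also have "(\<integral>\<^sup>+x. \<integral>\<^sup>+y. ennreal (1 / 2) * (\<integral>\<^sup>+e. race (ereal e + x) y \<partial>hold_dist) \<partial>R' \<partial>R)
      = ennreal (1 / 2) * (\<integral>\<^sup>+x. \<integral>\<^sup>+y. \<integral>\<^sup>+e. race (ereal e + x) y \<partial>hold_dist \<partial>R' \<partial>R)"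
    by (simp add: nn_integral_cmult del: ennreal_half)
  also have "(\<integral>\<^sup>+x. \<integral>\<^sup>+y. \<integral>\<^sup>+e. race (ereal e + x) y \<partial>hold_dist \<partial>R' \<partial>R)
      = (\<integral>\<^sup>+x. \<integral>\<^sup>+e. \<integral>\<^sup>+y. race (ereal e + x) y \<partial>R' \<partial>hold_dist \<partial>R)"
    by (intro nn_integral_cong HR'.Fubini') measurable
  also have "\<dots> = (\<integral>\<^sup>+e. \<integral>\<^sup>+x. \<integral>\<^sup>+y. race (ereal e + x) y \<partial>R' \<partial>R \<partial>hold_dist)"
    by (rule HR.Fubini') measurable
  also have "\<dots> = (\<integral>\<^sup>+x. \<integral>\<^sup>+y. race x y \<partial>R' \<partial>T)"
    by (rule T[symmetric]) measurable
  finally show ?thesis .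
qed

definition race_value :: "'v ugraph \<Rightarrow> 'v \<Rightarrow> 'v \<Rightarrow> 'v \<Rightarrow> ennreal" where
  "race_value G z a b = (\<integral>\<^sup>+x. \<integral>\<^sup>+y. race x y \<partial>hit_law G z b \<partial>hit_law G z a)"

lemma race_value_le_1:
  fixes G :: "'v::countable ugraph"
  shows "race_value G z a b \<le> 1"
proof -
  interpret A: prob_space "hit_law G z a" by (rule prob_space_hit_law)
  interpret B: prob_space "hit_law G z b" by (rule prob_space_hit_law)
  have "race_value G z a b \<le> (\<integral>\<^sup>+x. \<integral>\<^sup>+y. 1 \<partial>hit_law G z b \<partial>hit_law G z a)"
    unfolding race_value_def by (intro nn_integral_mono race_le_1)
  then show ?thesis
    by (simp add: A.emeasure_space_1 B.emeasure_space_1)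
qed

lemma capture_prob_eq_race_value:
  fixes G :: "'v::countable ugraph"
  shows "capture_prob G z a b = enn2real (race_value G z a b)"
proof -
  interpret W: prob_space "walk_space G" by (rule prob_space_walk_space)
  interpret P: pair_prob_space "walk_space G" "walk_space G" ..
  let ?M = "walk_space G \<Otimes>\<^sub>M walk_space G"
  let ?L = "{\<omega> \<in> space ?M. hitting_time a z (fst \<omega>) < hitting_time b z (snd \<omega>)}"
  let ?E = "{\<omega> \<in> space ?M. hitting_time a z (fst \<omega>) = hitting_time b z (snd \<omega>)}"
  have [measurable]: "(\<lambda>\<omega>. hitting_time a z (fst \<omega>)) \<in> borel_measurable ?M"
      "(\<lambda>\<omega>. hitting_time b z (snd \<omega>)) \<in> borel_measurable ?M"
    by (auto intro: measurable_compose[OF measurable_fst measurable_hitting_time]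
        measurable_compose[OF measurable_snd measurable_hitting_time])
  have sets: "?L \<in> sets ?M" "?E \<in> sets ?M"
    by measurable
  have "race_value G z a b
      = (\<integral>\<^sup>+\<omega>. \<integral>\<^sup>+\<omega>'. race (hitting_time a z \<omega>) (hitting_time b z \<omega>') \<partial>walk_space G \<partial>walk_space G)"
    unfolding race_value_def hit_law_def by (simp add: nn_integral_distr)
  also have "\<dots> = (\<integral>\<^sup>+\<omega>. race (hitting_time a z (fst \<omega>)) (hitting_time b z (snd \<omega>)) \<partial>?M)"
    by (subst W.nn_integral_fst[symmetric]) simp_all
  also have "\<dots> = (\<integral>\<^sup>+\<omega>. indicator ?L \<omega> + ennreal (1 / 2) * indicator ?E \<omega> \<partial>?M)"
    by (intro nn_integral_cong) (auto simp: race_def indicator_def)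
  also have "\<dots> = emeasure ?M ?L + ennreal (1 / 2) * emeasure ?M ?E"
    using sets by (subst nn_integral_add) (auto simp: nn_integral_cmult simp del: ennreal_half)
  also have "\<dots> = ennreal (measure ?M ?L + 1 / 2 * measure ?M ?E)"
    by (simp add: P.emeasure_eq_measure ennreal_mult[symmetric] del: ennreal_half)
  finally have eq: "race_value G z a b = ennreal (measure ?M ?L + 1 / 2 * measure ?M ?E)" .
  show ?thesis
    unfolding eq capture_prob_def Let_def by (simp del: ennreal_plus)
qed

text \<open>In effect the pair of walks is a discrete chain in which a fair coin chooses the walk
  that moves: the capture probability is harmonic for this chain as long as neither walk is at
  z.\<close>

lemma capture_prob_first_step:
  fixes G :: "'v::countable ugraph"
  assumes "a \<in> verts G" "b \<in> verts G" "a \<noteq> z" "b \<noteq> z"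
    and "finite (neighbors G a)" "neighbors G a \<noteq> {}" "finite (neighbors G b)" "neighbors G b \<noteq> {}"
  shows "capture_prob G z a b =
    ((\<Sum>a'\<in>neighbors G a. capture_prob G z a' b) / card (neighbors G a)
     + (\<Sum>b'\<in>neighbors G b. capture_prob G z a b') / card (neighbors G b)) / 2"
proof -
  interpret B: prob_space "hit_law G z b" by (rule prob_space_hit_law)
  have "race_value G z a b
    = ennreal (1 / 2) * (\<integral>\<^sup>+x. \<integral>\<^sup>+y. race x y \<partial>hit_law G z b \<partial>hit_law_jump G z a)
    + ennreal (1 / 2) * (\<integral>\<^sup>+x. \<integral>\<^sup>+y. race x y \<partial>hit_law_jump G z b \<partial>hit_law G z a)"
    unfolding race_value_def
    by (rule nn_integral_race_first_step)
       (use assms in \<open>simp_all add: prob_space_hit_law prob_space_hit_law_jump nn_integral_hit_law\<close>)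
  also have "(\<integral>\<^sup>+x. \<integral>\<^sup>+y. race x y \<partial>hit_law G z b \<partial>hit_law_jump G z a)
      = (\<Sum>a'\<in>neighbors G a. race_value G z a' b) / card (neighbors G a)"
    unfolding race_value_def using assms by (intro nn_integral_hit_law_jump) auto
  also have "(\<integral>\<^sup>+x. \<integral>\<^sup>+y. race x y \<partial>hit_law_jump G z b \<partial>hit_law G z a)
      = (\<integral>\<^sup>+x. (\<Sum>b'\<in>neighbors G b. \<integral>\<^sup>+y. race x y \<partial>hit_law G z b') / card (neighbors G b) \<partial>hit_law G z a)"
    using assms by (intro nn_integral_cong nn_integral_hit_law_jump) auto
  also have "\<dots> = (\<Sum>b'\<in>neighbors G b. race_value G z a b') / card (neighbors G b)"
  proof -
    have [measurable]: "(\<lambda>x. \<integral>\<^sup>+y. race x y \<partial>hit_law G z b') \<in> borel_measurable borel" for b'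
    proof -
      interpret prob_space "hit_law G z b'" by (rule prob_space_hit_law)
      show ?thesis by measurable
    qed
    show ?thesis
      unfolding race_value_def by (simp add: nn_integral_divide nn_integral_sum)
  qed
  finally have eq: "race_value G z a b =
      ennreal (1 / 2) * ((\<Sum>a'\<in>neighbors G a. race_value G z a' b) / card (neighbors G a))
      + ennreal (1 / 2) * ((\<Sum>b'\<in>neighbors G b. race_value G z a b') / card (neighbors G b))" .
  have real: "race_value G z x y = ennreal (capture_prob G z x y)" for x y
  proof -
    have "race_value G z x y < top"
      using race_value_le_1[of G z x y] by (rule order.strict_trans1) simp
    then show ?thesis
      by (simp add: capture_prob_eq_race_value)
  qed
  have nonneg: "0 \<le> capture_prob G z x y" for x y
    by (simp add: capture_prob_eq_race_value)
  have card: "0 < card (neighbors G a)" "0 < card (neighbors G b)"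
    using assms by (auto simp: card_gt_0_iff)
  have "ennreal (capture_prob G z a b) = ennreal
    (1 / 2 * ((\<Sum>a'\<in>neighbors G a. capture_prob G z a' b) / card (neighbors G a))
     + 1 / 2 * ((\<Sum>b'\<in>neighbors G b. capture_prob G z a b') / card (neighbors G b)))"
    using eq card
    by (simp add: real sum_ennreal nonneg sum_nonneg divide_ennreal ennreal_of_nat_eq_real_of_nat
        ennreal_mult[symmetric] ennreal_plus[symmetric] del: ennreal_half ennreal_plus)
  then show ?thesis
    by (subst (asm) ennreal_inj) (auto simp: nonneg sum_nonneg)
qed

section \<open>Boundary values for walks started at the target\<close>

lemma hitting_time_pos:
  assumes "a \<noteq> z" "0 < fst (shd \<omega>)"
  shows "0 < hitting_time a z \<omega>"
proof -
  have "ereal (fst (shd \<omega>)) \<le> hitting_time a z \<omega>"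
    unfolding hitting_time_def
  proof (rule Inf_greatest, safe)
    fix t assume "z = walk_at a \<omega> t"
    with walk_at_before[of t "shd \<omega>" a "stl \<omega>"] assms(1) show "ereal (fst (shd \<omega>)) \<le> ereal t"
      by (cases "t < fst (shd \<omega>)") auto
  qed
  with assms(2) show ?thesis
    by (metis ereal_less(2) order_less_le_trans)
qed

lemma AE_hit_law_pos:
  fixes G :: "'v::countable ugraph"
  assumes "a \<noteq> z"
  shows "AE t in hit_law G z a. 0 < t"
  unfolding hit_law_def
  by (subst AE_distr_iff)
     (use AE_walk_space_Stream_pos[of G] hitting_time_pos[OF assms] in \<open>auto elim!: eventually_mono\<close>)

lemma capture_prob_start_left:
  fixes G :: "'v::countable ugraph"
  assumes "b \<noteq> z"
  shows "capture_prob G z z b = 1"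
proof -
  interpret B: prob_space "hit_law G z b" by (rule prob_space_hit_law)
  have "race_value G z z b = (\<integral>\<^sup>+y. race 0 y \<partial>hit_law G z b)"
    unfolding race_value_def by (rule nn_integral_hit_law_start) measurable
  also have "\<dots> = (\<integral>\<^sup>+y. 1 \<partial>hit_law G z b)"
    by (intro nn_integral_cong_AE, use AE_hit_law_pos[OF assms, of G] in eventually_elim)
       (auto simp: race_def)
  finally show ?thesis
    by (simp add: capture_prob_eq_race_value B.emeasure_space_1)
qed

lemma capture_prob_start_right:
  fixes G :: "'v::countable ugraph"
  assumes "a \<noteq> z"
  shows "capture_prob G z a z = 0"
proof -
  have "race_value G z a z = (\<integral>\<^sup>+x. race x 0 \<partial>hit_law G z a)"
    unfolding race_value_def by (intro nn_integral_cong nn_integral_hit_law_start) measurable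
  also have "\<dots> = (\<integral>\<^sup>+x. 0 \<partial>hit_law G z a)"
    by (intro nn_integral_cong_AE, use AE_hit_law_pos[OF assms, of G] in eventually_elim)
       (auto simp: race_def)
  finally show ?thesis
    by (simp add: capture_prob_eq_race_value)
qed

lemma capture_prob_start_both:
  fixes G :: "'v::countable ugraph"
  shows "capture_prob G z z z = 1 / 2"
proof -
  have "race_value G z z z = (\<integral>\<^sup>+x. race x 0 \<partial>hit_law G z z)"
    unfolding race_value_def by (intro nn_integral_cong nn_integral_hit_law_start) measurable
  also have "\<dots> = race 0 0"
    by (rule nn_integral_hit_law_start) measurable
  finally show ?thesis
    by (simp add: capture_prob_eq_race_value race_def del: ennreal_half)
qed

section \<open>The Dirichlet problem and its solution\<close>

instance hl_vertex :: countable
  by countable_datatype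

text \<open>The absolute difference D of the two solutions is bounded by its averages, so where it
  attains its maximum M it does so at all neighbors of the first walk's position as well. Following
  a path to z with the second walk frozen at b0 carries M to the boundary, where D = 0.\<close>

lemma capture_prob_unique:
  fixes G :: "'v::countable ugraph" and F :: "'v \<Rightarrow> 'v \<Rightarrow> real"
  assumes fin: "finite (verts G)" and ne: "\<And>a. a \<in> verts G \<Longrightarrow> neighbors G a \<noteq> {}"
    and reach: "\<And>a. a \<in> verts G \<Longrightarrow> (a, z) \<in> {(v, w). v \<in> verts G \<and> w \<in> neighbors G v}\<^sup>*"
    and left: "\<And>b. b \<in> verts G \<Longrightarrow> b \<noteq> z \<Longrightarrow> F z b = 1"
    and right: "\<And>a. a \<in> verts G \<Longrightarrow> a \<noteq> z \<Longrightarrow> F a z = 0"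
    and both: "F z z = 1 / 2"
    and step: "\<And>a b. a \<in> verts G \<Longrightarrow> b \<in> verts G \<Longrightarrow> a \<noteq> z \<Longrightarrow> b \<noteq> z \<Longrightarrow>
      F a b = ((\<Sum>a'\<in>neighbors G a. F a' b) / card (neighbors G a)
        + (\<Sum>b'\<in>neighbors G b. F a b') / card (neighbors G b)) / 2"
    and ab: "a \<in> verts G" "b \<in> verts G"
  shows "capture_prob G z a b = F a b"
proof -
  let ?V = "verts G"
  have nb: "neighbors G v \<subseteq> ?V" for v
    by (auto simp: neighbors_def)
  have finN: "finite (neighbors G v)" for v
    using fin nb by (rule finite_subset[rotated])
  define D where "D a b = \<bar>capture_prob G z a b - F a b\<bar>" for a b
  define M where "M = Max ((\<lambda>(a, b). D a b) ` (?V \<times> ?V))"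
  have le_M: "D x y \<le> M" if "x \<in> ?V" "y \<in> ?V" for x y
    unfolding M_def using fin that by (intro Max_ge) auto
  have "M \<in> (\<lambda>(a, b). D a b) ` (?V \<times> ?V)"
    unfolding M_def using fin ab by (intro Max_in) auto
  then obtain a0 b0 where a0b0: "a0 \<in> ?V" "b0 \<in> ?V" "D a0 b0 = M"
    by auto
  have bdry: "D x y = 0" if "x \<in> ?V" "y \<in> ?V" "x = z \<or> y = z" for x y
    using that left right both unfolding D_def
    by (cases "x = z"; cases "y = z")
       (auto simp: capture_prob_start_left capture_prob_start_right capture_prob_start_both)
  have D_step: "D x y \<le> ((\<Sum>x'\<in>neighbors G x. D x' y) / card (neighbors G x)
      + (\<Sum>y'\<in>neighbors G y. D x y') / card (neighbors G y)) / 2"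
    if xy: "x \<in> ?V" "y \<in> ?V" "x \<noteq> z" "y \<noteq> z" for x y
  proof -
    have diff: "u = (A + B) / 2 \<Longrightarrow> v = (A' + B') / 2 \<Longrightarrow> u - v = (A - A' + (B - B')) / 2"
      for u v A B A' B' :: real
      by simp
    define \<delta> where "\<delta> a b = capture_prob G z a b - F a b" for a b
    have "\<delta> x y = ((\<Sum>x'\<in>neighbors G x. \<delta> x' y) / card (neighbors G x)
      + (\<Sum>y'\<in>neighbors G y. \<delta> x y') / card (neighbors G y)) / 2"
      unfolding \<delta>_def sum_subtractf diff_divide_distrib
      by (rule diff[OF capture_prob_first_step[OF xy finN ne[OF xy(1)] finN ne[OF xy(2)]] step[OF xy]])
    then have "\<bar>\<delta> x y\<bar> \<le> (\<bar>\<Sum>x'\<in>neighbors G x. \<delta> x' y\<bar> / card (neighbors G x)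
      + \<bar>\<Sum>y'\<in>neighbors G y. \<delta> x y'\<bar> / card (neighbors G y)) / 2"
      using abs_triangle_ineq[of "(\<Sum>x'\<in>neighbors G x. \<delta> x' y) / card (neighbors G x)"
          "(\<Sum>y'\<in>neighbors G y. \<delta> x y') / card (neighbors G y)"]
      by simp
    also have "\<dots> \<le> ((\<Sum>x'\<in>neighbors G x. \<bar>\<delta> x' y\<bar>) / card (neighbors G x)
      + (\<Sum>y'\<in>neighbors G y. \<bar>\<delta> x y'\<bar>) / card (neighbors G y)) / 2"
      by (intro divide_right_mono add_mono sum_abs) auto
    finally show ?thesis
      by (simp add: D_def \<delta>_def)
  qed
  have avg_le: "(\<Sum>x'\<in>neighbors G v. g x') / card (neighbors G v) \<le> M"
    if "v \<in> ?V" "\<And>x'. x' \<in> neighbors G v \<Longrightarrow> g x' \<le> M" for v and g :: "'v \<Rightarrow> real"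
  proof -
    have "(\<Sum>x'\<in>neighbors G v. g x') \<le> card (neighbors G v) * M"
      using that by (intro sum_bounded_above) auto
    moreover have "0 < card (neighbors G v)"
      using finN ne that by (auto simp: card_gt_0_iff)
    ultimately show ?thesis
      by (simp add: field_simps)
  qed
  have "D x b0 = M \<longrightarrow> M = 0" if "(x, z) \<in> {(v, w). v \<in> ?V \<and> w \<in> neighbors G v}\<^sup>*" "x \<in> ?V" for x
    using that
  proof (induction rule: converse_rtrancl_induct)
    case base
    then show ?case
      using bdry a0b0 by auto
  next
    case (step x x')
    then have x': "x' \<in> neighbors G x" "x' \<in> ?V"
      using nb by auto
    show ?case
    proof
      assume eq: "D x b0 = M"
      show "M = 0"
      proof (cases "x = z \<or> b0 = z")
        case True
        then show ?thesis
          using bdry eq step.prems a0b0 by auto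
      next
        case False
        have card: "0 < card (neighbors G x)"
          using finN x' by (auto simp: card_gt_0_iff)
        have "D x b0 \<le> ((\<Sum>x'\<in>neighbors G x. D x' b0) / card (neighbors G x)
            + (\<Sum>y'\<in>neighbors G b0. D x y') / card (neighbors G b0)) / 2"
          using False step.prems a0b0 by (intro D_step) auto
        \<comment> \<open>One average is at most M and the mean of the two is at least M, so the
          other is at least M too, which leaves no room for a neighbor with D below M.\<close>
        moreover have "(\<Sum>y'\<in>neighbors G b0. D x y') / card (neighbors G b0) \<le> M"
          using step.prems a0b0 nb by (intro avg_le le_M) auto
        ultimately have "M \<le> (\<Sum>x'\<in>neighbors G x. D x' b0) / card (neighbors G x)"
          using eq by simp
        then have *: "card (neighbors G x) * M \<le> (\<Sum>x'\<in>neighbors G x. D x' b0)"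
          using card by (simp add: field_simps)
        have "D x' b0 = M"
        proof (rule ccontr)
          assume "D x' b0 \<noteq> M"
          then have "D x' b0 < M"
            using le_M[of x' b0] x' a0b0 by auto
          then have "(\<Sum>x'\<in>neighbors G x. D x' b0) < (\<Sum>x'\<in>neighbors G x. M)"
            using x' a0b0 nb by (intro sum_strict_mono_ex1 finN ballI le_M bexI[of _ x']) auto
          with * show False
            by simp
        qed
        with step.IH x' show ?thesis
          by blast
      qed
    qed
  qed
  with reach a0b0 have "M = 0"
    by blast
  then have "D a b \<le> 0"
    using le_M ab by auto
  then show ?thesis
    by (simp add: D_def)
qed

text \<open>The classes are the orbits of the automorphisms that fix z. For a hub target: 0 the hub
  itself, 1 its leaves, 2 the other hubs, 3 their leaves.\<close>

fun vertex_class :: "hl_vertex \<Rightarrow> hl_vertex \<Rightarrow> nat" where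
  "vertex_class (Hub c) (Hub i) = (if i = c then 0 else 2)"
| "vertex_class (Hub c) (Leaf i n) = (if i = c then 1 else 3)"
| "vertex_class (Leaf c m) (Hub i) = (if i = c then 1 else 3)"
| "vertex_class (Leaf c m) (Leaf i n) = (if i \<noteq> c then 4 else if n = m then 0 else 2)"

lemma vertex_class_eq_0_iff: "vertex_class z v = 0 \<longleftrightarrow> v = z"
  by (cases "(z, v)" rule: vertex_class.cases) auto

text \<open>
  For a leaf target below the hub \<open>c\<close>, a racer of class \<open>x\<close> beats one of class \<open>y\<close> with probability
  \<open>1/2 + Mxy / (2 L)\<close>, where \<open>p = k - 2\<close> and \<open>s = r - 2\<close>. The classes are: 1 the hub \<open>c\<close>, 2 the other
  leaves at \<open>c\<close>, 3 the other hubs, 4 their leaves; the target has class 0. The polynomials come from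
  solving the linear system \<open>leaf_system\<close> below.
\<close>

definition M12 :: "real \<Rightarrow> real \<Rightarrow> real" where
  "M12 p s = (888 + 884 * s + 292 * s^2 + 32 * s^3)
     + p * (618 + 411 * s + 68 * s^2)
     + p^2 * (147 + 49 * s)
     + p^3 * 12"

definition M13 :: "real \<Rightarrow> real \<Rightarrow> real" where
  "M13 p s = (2512 + 3364 * s + 1694 * s^2 + 380 * s^3 + 32 * s^4)
     + p * (2376 + 2406 * s + 814 * s^2 + 92 * s^3)
     + p^2 * (845 + 575 * s + 98 * s^2)
     + p^3 * (134 + 46 * s)
     + p^4 * 8"

definition M14 :: "real \<Rightarrow> real \<Rightarrow> real" where
  "M14 p s = (2952 + 3804 * s + 1840 * s^2 + 396 * s^3 + 32 * s^4)
     + p * (2718 + 2634 * s + 852 * s^2 + 92 * s^3)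
     + p^2 * (935 + 605 * s + 98 * s^2)
     + p^3 * (142 + 46 * s)
     + p^4 * 8"

definition M23 :: "real \<Rightarrow> real \<Rightarrow> real" where
  "M23 p s = (1920 + 2824 * s + 1532 * s^2 + 364 * s^3 + 32 * s^4)
     + p * (1964 + 2154 * s + 776 * s^2 + 92 * s^3)
     + p^2 * (747 + 545 * s + 98 * s^2)
     + p^3 * (126 + 46 * s)
     + p^4 * 8"

definition M24 :: "real \<Rightarrow> real \<Rightarrow> real" where
  "M24 p s = (2436 + 3314 * s + 1686 * s^2 + 380 * s^3 + 32 * s^4)
     + p * (2341 + 2394 * s + 814 * s^2 + 92 * s^3)
     + p^2 * (841 + 575 * s + 98 * s^2)
     + p^3 * (134 + 46 * s)
     + p^4 * 8"

definition M34 :: "real \<Rightarrow> real \<Rightarrow> real" where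
  "M34 p s = (492 + 470 * s + 150 * s^2 + 16 * s^3)
     + p * (371 + 237 * s + 38 * s^2)
     + p^2 * (94 + 30 * s)
     + p^3 * 8"

text \<open>A margin is a winning probability minus 1/2, tabulated for x < y. Substituting u13 =
  (1/2 + u12) / 2 leaves one equation for u12, in which u12 has coefficient (2k + 3r) / 2. The pair
  (2, 3) decouples, with coefficient k + 2r.\<close>

definition hub_margin :: "nat \<Rightarrow> nat \<Rightarrow> nat \<Rightarrow> nat \<Rightarrow> real" where
  "hub_margin k r x y =
    (if x = 0 then 1 / 2
     else if x = 1 \<and> y = 2 then (2 * real k + 3 * real r - 4) / (2 * (2 * real k + 3 * real r))
     else if x = 1 \<and> y = 3 then (2 * real k + 3 * real r - 2) / (2 * (2 * real k + 3 * real r))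
     else 1 / (2 * (real k + 2 * real r)))"

definition leaf_margin :: "nat \<Rightarrow> nat \<Rightarrow> nat \<Rightarrow> nat \<Rightarrow> real" where
  "leaf_margin k r x y =
    (let p = real k - 2; s = real r - 2 in
     if x = 0 then 1 / 2
     else (if x = 1 \<and> y = 2 then M12 p s else if x = 1 \<and> y = 3 then M13 p s
       else if x = 1 \<and> y = 4 then M14 p s else if x = 2 \<and> y = 3 then M23 p s
       else if x = 2 \<and> y = 4 then M24 p s else M34 p s) / (2 * L_poly p s))"

text \<open>Exchanging the racers complements the winning probability, so the margin changes sign
  and the entries with x < y determine all others.\<close>

definition skew :: "(nat \<Rightarrow> nat \<Rightarrow> real) \<Rightarrow> nat \<Rightarrow> nat \<Rightarrow> real" where
  "skew u x y = (if x = y then 0 else if x < y then u x y else - u y x)"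

lemma skew_swap: "skew u y x = - skew u x y"
  by (auto simp: skew_def)

definition target_margin :: "nat \<Rightarrow> nat \<Rightarrow> hl_vertex \<Rightarrow> nat \<Rightarrow> nat \<Rightarrow> real" where
  "target_margin k r z = skew (case z of Hub _ \<Rightarrow> hub_margin k r | Leaf _ _ \<Rightarrow> leaf_margin k r)"

text \<open>\<open>class_step k r z x f\<close> is the average of \<open>f\<close> over the classes of the neighbors of a vertex of class \<open>x\<close>.\<close>

definition class_step :: "nat \<Rightarrow> nat \<Rightarrow> hl_vertex \<Rightarrow> nat \<Rightarrow> (nat \<Rightarrow> real) \<Rightarrow> real" where
  "class_step k r z x f = (case z of
     Hub _ \<Rightarrow> if x = 1 then f 0
       else if x = 2 then (f 0 + (real k - 2) * f 2 + real r * f 3) / (real k - 1 + real r)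
       else f 2
   | Leaf _ _ \<Rightarrow> if x = 1 then (f 0 + (real r - 1) * f 2 + (real k - 1) * f 3) / (real k - 1 + real r)
       else if x = 2 then f 1
       else if x = 3 then (f 1 + (real k - 2) * f 3 + real r * f 4) / (real k - 1 + real r)
       else f 3)"

lemma class_step_minus: "class_step k r z x (\<lambda>v. - f v) = - class_step k r z x f"
  by (cases z) (auto simp: class_step_def algebra_simps minus_divide_left diff_divide_distrib add_divide_distrib)

text \<open>At r = 1, that is s = -1, the powers of s alternate in sign. In q = s + 1 all
  coefficients are positive, so positivity for every r \<ge> 1 can be read off.
  \<open>H_poly\<close> is treated in the same way.\<close>

lemma L_poly_shift:
  "L_poly p (q - 1) =
     (1352 + 2836 * q + 2208 * q^2 + 756 * q^3 + 96 * q^4)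
     + p * (2418 + 4044 * q + 2346 * q^2 + 528 * q^3 + 32 * q^4)
     + p^2 * (1736 + 2169 * q + 832 * q^2 + 92 * q^3)
     + p^3 * (624 + 517 * q + 98 * q^2) + p^4 * (112 + 46 * q) + 8 * p^5"
  unfolding L_poly_def by algebra

lemma L_poly_pos:
  assumes "0 \<le> p" "-1 \<le> s"
  shows "0 < L_poly p s"
proof -
  have "0 < L_poly p ((s + 1) - 1)"
    unfolding L_poly_shift using assms by (intro add_pos_nonneg) (auto intro!: add_nonneg_nonneg mult_nonneg_nonneg add_pos_nonneg)
  then show ?thesis
    by simp
qed

text \<open>These are the first-step equations of the six pairs of classes, cleared of denominators
  by the factor 2 L and, where a hub takes a step, by its degree p + s + 3 = k - 1 + r. A boundary
  margin 1/2 turns into \<open>L_poly\<close>, terms with equal classes vanish, and reversed pairs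
  appear with a minus sign.\<close>

lemma leaf_system:
  fixes p s :: real
  shows "2 * (p + s + 3) * M12 p s = L_poly p s - (p + 1) * M23 p s"
    and "2 * (p + s + 3) * M13 p s = L_poly p s + (s + 1) * M23 p s + p * M13 p s + (s + 2) * M14 p s"
    and "2 * (p + s + 3) * M14 p s = L_poly p s + (s + 1) * M24 p s + (p + 1) * M34 p s + (p + s + 3) * M13 p s"
    and "2 * (p + s + 3) * M23 p s = (p + s + 3) * M13 p s - M12 p s + p * M23 p s + (s + 2) * M24 p s"
    and "2 * M24 p s = M14 p s + M23 p s"
    and "2 * (p + s + 3) * M34 p s = M14 p s + p * M34 p s"
  unfolding M12_def M13_def M14_def M23_def M24_def M34_def L_poly_def by algebra+

lemma half_sum_eqI:
  fixes n u a b :: real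
  assumes "0 < n" "2 * n * u = n * a + b"
  shows "u = (a + b / n) / 2" "u = (b / n + a) / 2"
  using assms by (simp_all add: field_simps)

lemma half_sum_divide_eqI:
  fixes n u a b :: real
  assumes "0 < n" "2 * n * u = a + b"
  shows "u = (a / n + b / n) / 2"
  using assms by (simp add: field_simps)

lemma hub_class_system:
  assumes "2 \<le> k" "1 \<le> r" "x \<in> {1, 2, 3}" "y \<in> {1, 2, 3}" "x < y"
  shows "target_margin k r (Hub c) x y
    = (class_step k r (Hub c) x (\<lambda>x'. target_margin k r (Hub c) x' y)
      + class_step k r (Hub c) y (\<lambda>y'. target_margin k r (Hub c) x y')) / 2"
proof -
  define n K B where "n = real k - 1 + real r" and "K = 2 * real k + 3 * real r"
    and "B = real k + 2 * real r"
  have pos: "0 < n" "0 < K" "0 < B"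
    using assms by (auto simp: n_def K_def B_def)
  define u12 u13 u23 where "u12 = (K - 4) / (2 * K)" and "u13 = (K - 2) / (2 * K)"
    and "u23 = 1 / (2 * B)"
  have T: "x \<noteq> 0 \<Longrightarrow> target_margin k r (Hub c) 0 x = 1 / 2"
    "x \<noteq> 0 \<Longrightarrow> target_margin k r (Hub c) x 0 = - 1 / 2" for x
    by (simp_all add: target_margin_def skew_def hub_margin_def)
  have T': "target_margin k r (Hub c) 1 2 = u12" "target_margin k r (Hub c) 1 3 = u13"
    "target_margin k r (Hub c) 2 3 = u23" "target_margin k r (Hub c) 2 1 = - u12"
    "target_margin k r (Hub c) 3 1 = - u13" "target_margin k r (Hub c) 3 2 = - u23"
    "target_margin k r (Hub c) x x = 0" for x
    by (simp_all add: target_margin_def skew_def hub_margin_def u12_def u13_def u23_def K_def B_def)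
  \<comment> \<open>A leaf of the target hub against another hub. Writing 1/2 as
    \<open>K / (2 * K)\<close> puts all terms over 2 K and leaves the polynomial identity
    \<open>poly\<close>.\<close>
  have *: "2 * n * u12 = n * (1 / 2) + (- 1 / 2 + (real k - 2) * u12 + real r * u13)"
  proof -
    have half: "K / (2 * K) = 1 / 2" "- K / (2 * K) = - 1 / 2"
      using pos by simp_all
    have poly: "2 * n * (K - 4) = n * K + (- K + (real k - 2) * (K - 4) + real r * (K - 2))"
      unfolding n_def K_def by algebra
    have "2 * n * u12 = n * (K / (2 * K)) + (- K / (2 * K) + (real k - 2) * u12 + real r * u13)"
      unfolding u12_def u13_def times_divide_eq_right add_divide_distrib[symmetric] poly ..
    then show ?thesis
      unfolding half .
  qed
  have **: "u13 = (1 / 2 + u12) / 2"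
    using pos by (simp add: u12_def u13_def field_simps)
  have ***: "2 * n * u23 = n * 0 + (1 / 2 + (real k - 2) * u23 + real r * 0) + n * 0"
  proof -
    have "2 * n = B + (real k - 2)"
      by (simp add: n_def B_def)
    then have "2 * n / (2 * B) = (B + (real k - 2)) / (2 * B)"
      by simp
    then show ?thesis
      using pos by (simp add: u23_def add_divide_distrib)
  qed
  have "(x = 1 \<and> y = 2) \<or> (x = 1 \<and> y = 3) \<or> (x = 2 \<and> y = 3)"
    using assms by auto
  then show ?thesis
  proof (elim disjE conjE)
    assume xy: "x = 1" "y = 2"
    then show ?thesis
      using half_sum_eqI(1)[OF pos(1) *] by (simp add: class_step_def T T'[unfolded One_nat_def] n_def)
  next
    assume xy: "x = 1" "y = 3"
    then show ?thesis
      using ** by (simp add: class_step_def T T'[unfolded One_nat_def])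
  next
    assume xy: "x = 2" "y = 3"
    then show ?thesis
      using half_sum_eqI(2)[of n u23 0 "1 / 2 + (real k - 2) * u23"] pos ***
      by (simp add: class_step_def T T'[unfolded One_nat_def] n_def)
  qed
qed

lemma leaf_class_system:
  assumes "2 \<le> k" "1 \<le> r" "x \<in> {1, 2, 3, 4}" "y \<in> {1, 2, 3, 4}" "x < y"
  shows "target_margin k r (Leaf c m) x y
    = (class_step k r (Leaf c m) x (\<lambda>x'. target_margin k r (Leaf c m) x' y)
      + class_step k r (Leaf c m) y (\<lambda>y'. target_margin k r (Leaf c m) x y')) / 2"
proof -
  define p s where "p = real k - 2" and "s = real r - 2"
  have kr: "real k = p + 2" "real r = s + 2"
    by (simp_all add: p_def s_def)
  define L2 where "L2 = 2 * L_poly p s"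
  have "0 < L_poly p s"
    using assms by (intro L_poly_pos) (auto simp: p_def s_def)
  then have half: "L_poly p s / L2 = 1 / 2"
    by (simp add: L2_def)
  have n: "0 < p + s + 3"
    using assms by (simp add: p_def s_def)
  define u12 u13 u14 u23 u24 u34 where "u12 = M12 p s / L2" and "u13 = M13 p s / L2"
    and "u14 = M14 p s / L2" and "u23 = M23 p s / L2" and "u24 = M24 p s / L2" and "u34 = M34 p s / L2"
  note u_defs = u12_def u13_def u14_def u23_def u24_def u34_def
  have T: "x \<noteq> 0 \<Longrightarrow> target_margin k r (Leaf c m) 0 x = 1 / 2"
    "x \<noteq> 0 \<Longrightarrow> target_margin k r (Leaf c m) x 0 = - 1 / 2" for x
    by (simp_all add: target_margin_def skew_def leaf_margin_def Let_def)
  have T': "target_margin k r (Leaf c m) 1 2 = u12" "target_margin k r (Leaf c m) 1 3 = u13"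
    "target_margin k r (Leaf c m) 1 4 = u14" "target_margin k r (Leaf c m) 2 3 = u23"
    "target_margin k r (Leaf c m) 2 4 = u24" "target_margin k r (Leaf c m) 3 4 = u34"
    "target_margin k r (Leaf c m) 2 1 = - u12" "target_margin k r (Leaf c m) 3 1 = - u13"
    "target_margin k r (Leaf c m) 4 1 = - u14" "target_margin k r (Leaf c m) 3 2 = - u23"
    "target_margin k r (Leaf c m) 4 2 = - u24" "target_margin k r (Leaf c m) 4 3 = - u34"
    "target_margin k r (Leaf c m) x x = 0" for x
    by (simp_all add: target_margin_def skew_def leaf_margin_def Let_def u_defs L2_def p_def s_def)
  \<comment> \<open>Collects each equation over the common denominator \<open>L2\<close>, so that
    \<open>leaf_system\<close> rewrites its numerator.\<close>
  note combine = times_divide_eq_right add_divide_distrib[symmetric] diff_divide_distrib[symmetric]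
  have "2 * (p + s + 3) * u12 = L_poly p s / L2 - (p + 1) * u23"
    unfolding u_defs by (simp only: combine leaf_system)
  \<comment> \<open>The zero term is the move of the class 2 racer to the hub of class 1, where it
    meets its opponent's class; in \<open>e34\<close> it is the move from class 4 to class
    3.\<close>
  then have e12: "2 * (p + s + 3) * u12 = (p + s + 3) * 0 + (1 / 2 - (p + 1) * u23)"
    unfolding half by simp
  have "2 * (p + s + 3) * u13 = L_poly p s / L2 + (s + 1) * u23 + p * u13 + (s + 2) * u14"
    unfolding u_defs by (simp only: combine leaf_system)
  then have e13: "2 * (p + s + 3) * u13 = (1 / 2 + (s + 1) * u23) + (p * u13 + (s + 2) * u14)"
    unfolding half by simp
  have "2 * (p + s + 3) * u14 = L_poly p s / L2 + (s + 1) * u24 + (p + 1) * u34 + (p + s + 3) * u13"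
    unfolding u_defs by (simp only: combine leaf_system)
  then have e14: "2 * (p + s + 3) * u14 = (p + s + 3) * u13 + (1 / 2 + (s + 1) * u24 + (p + 1) * u34)"
    unfolding half by simp
  have "2 * (p + s + 3) * u23 = (p + s + 3) * u13 - u12 + p * u23 + (s + 2) * u24"
    unfolding u_defs by (simp only: combine leaf_system)
  then have e23: "2 * (p + s + 3) * u23 = (p + s + 3) * u13 + (- u12 + p * u23 + (s + 2) * u24)"
    by simp
  have e24: "2 * u24 = u14 + u23"
    unfolding u_defs by (simp only: combine leaf_system)
  have "2 * (p + s + 3) * u34 = u14 + p * u34"
    unfolding u_defs by (simp only: combine leaf_system)
  then have e34: "2 * (p + s + 3) * u34 = (p + s + 3) * 0 + (u14 + p * u34)"
    by simp
  note step = class_step_def T T'[unfolded One_nat_def] kr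
  have "(x = 1 \<and> y = 2) \<or> (x = 1 \<and> y = 3) \<or> (x = 1 \<and> y = 4) \<or> (x = 2 \<and> y = 3)
      \<or> (x = 2 \<and> y = 4) \<or> (x = 3 \<and> y = 4)"
    using assms by auto
  then show ?thesis
  proof (elim disjE conjE)
    assume xy: "x = 1" "y = 2"
    show ?thesis
      unfolding xy using half_sum_eqI(2)[OF n e12] by (simp add: step ac_simps)
  next
    assume xy: "x = 1" "y = 3"
    show ?thesis
      unfolding xy using half_sum_divide_eqI[OF n e13] by (simp add: step ac_simps)
  next
    assume xy: "x = 1" "y = 4"
    show ?thesis
      unfolding xy using half_sum_eqI(2)[OF n e14] by (simp add: step ac_simps)
  next
    assume xy: "x = 2" "y = 3"
    show ?thesis
      unfolding xy using half_sum_eqI(1)[OF n e23] by (simp add: step ac_simps)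
  next
    assume xy: "x = 2" "y = 4"
    show ?thesis
      unfolding xy using e24 by (simp add: step ac_simps)
  next
    assume xy: "x = 3" "y = 4"
    show ?thesis
      unfolding xy using half_sum_eqI(2)[OF n e34] by (simp add: step ac_simps)
  qed
qed

section \<open>First passage on the hub-leaf graph\<close>

lemma verts_hub_leaf_graph: "verts (hub_leaf_graph k r) = hubs k \<union> all_leaves k r"
  by (simp add: hub_leaf_graph_def)

lemma Hub_in_verts [simp]: "Hub i \<in> verts (hub_leaf_graph k r) \<longleftrightarrow> i \<in> {1..k}"
  by (auto simp: verts_hub_leaf_graph hubs_def all_leaves_def leaves_at_def)

lemma Leaf_in_verts [simp]: "Leaf i n \<in> verts (hub_leaf_graph k r) \<longleftrightarrow> i \<in> {1..k} \<and> n \<in> {1..r}"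
  by (auto simp: verts_hub_leaf_graph hubs_def all_leaves_def leaves_at_def image_iff)

lemma finite_verts_hub_leaf_graph: "finite (verts (hub_leaf_graph k r))"
  by (simp add: verts_hub_leaf_graph hubs_def all_leaves_def leaves_at_def)

lemma sum_verts_hub_leaf_graph:
  "(\<Sum>v\<in>verts (hub_leaf_graph k r). g v)
    = (\<Sum>i=1..k. g (Hub i)) + (\<Sum>i=1..k. \<Sum>n=1..r. g (Leaf i n))"
  for g :: "hl_vertex \<Rightarrow> 'a::comm_monoid_add"
proof -
  have "(\<Sum>v\<in>hubs k \<union> all_leaves k r. g v) = sum g (hubs k) + sum g (all_leaves k r)"
    by (rule sum.union_disjoint) (auto simp: hubs_def all_leaves_def leaves_at_def)
  also have "sum g (hubs k) = (\<Sum>i=1..k. g (Hub i))"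
    unfolding hubs_def by (subst sum.reindex) (auto simp: inj_on_def)
  also have "sum g (all_leaves k r) = (\<Sum>i=1..k. sum g (leaves_at r i))"
    unfolding all_leaves_def by (rule sum.UNION_disjoint) (auto simp: leaves_at_def)
  also have "\<dots> = (\<Sum>i=1..k. \<Sum>n=1..r. g (Leaf i n))"
    unfolding leaves_at_def by (intro sum.cong refl, subst sum.reindex) (auto simp: inj_on_def)
  finally show ?thesis
    by (simp add: verts_hub_leaf_graph)
qed

lemma neighbors_Hub:
  assumes "i \<in> {1..k}"
  shows "neighbors (hub_leaf_graph k r) (Hub i) = Hub ` ({1..k} - {i}) \<union> Leaf i ` {1..r}"
  using assms
  by (auto simp: neighbors_def hub_leaf_graph_def hubs_def all_leaves_def leaves_at_def doubleton_eq_iff; blast)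

lemma neighbors_Leaf:
  assumes "i \<in> {1..k}" "n \<in> {1..r}"
  shows "neighbors (hub_leaf_graph k r) (Leaf i n) = {Hub i}"
  using assms
  by (auto simp: neighbors_def hub_leaf_graph_def hubs_def all_leaves_def leaves_at_def doubleton_eq_iff)

lemma sum_if_eq_else:
  assumes "finite A" "c \<in> A"
  shows "(\<Sum>j\<in>A. if j = c then x else y) = x + (real (card A) - 1) * y"
proof -
  have "(\<Sum>j\<in>A. if j = c then x else y) = x + (\<Sum>j\<in>A - {c}. y)"
    using assms by (subst sum.remove[of A c]) auto
  also have "\<dots> = x + (real (card A) - 1) * y"
  proof -
    have "0 < card A"
      using assms by (auto simp: card_gt_0_iff)
    then show ?thesis
      using assms by (simp add: card_Diff_singleton of_nat_diff)
  qed
  finally show ?thesis .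
qed

lemma sum_neighbors_Hub:
  fixes g :: "hl_vertex \<Rightarrow> real"
  assumes "i \<in> {1..k}"
  shows "(\<Sum>v\<in>neighbors (hub_leaf_graph k r) (Hub i). g v)
    = (\<Sum>j\<in>{1..k} - {i}. g (Hub j)) + (\<Sum>n=1..r. g (Leaf i n))"
proof -
  have "(\<Sum>v\<in>Hub ` ({1..k} - {i}) \<union> Leaf i ` {1..r}. g v)
      = sum g (Hub ` ({1..k} - {i})) + sum g (Leaf i ` {1..r})"
    by (rule sum.union_disjoint) auto
  then show ?thesis
    unfolding neighbors_Hub[OF assms] by (simp add: sum.reindex inj_on_def)
qed

lemma card_neighbors_Hub:
  assumes "i \<in> {1..k}"
  shows "real (card (neighbors (hub_leaf_graph k r) (Hub i))) = real k - 1 + real r"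
  using sum_neighbors_Hub[OF assms, of "\<lambda>_. 1" r] assms by (simp add: of_nat_diff)

text \<open>The walk is lumpable: how many neighbors of a lie in each class depends only on the
  class of a. This turns the Dirichlet problem on vertices into one on classes.\<close>

lemma average_neighbors:
  assumes "z \<in> verts (hub_leaf_graph k r)" "a \<in> verts (hub_leaf_graph k r)" "a \<noteq> z"
  shows "(\<Sum>v\<in>neighbors (hub_leaf_graph k r) a. f (vertex_class z v))
      / card (neighbors (hub_leaf_graph k r) a) = class_step k r z (vertex_class z a) f"
proof (cases a)
  case (Leaf i n)
  then have "neighbors (hub_leaf_graph k r) a = {Hub i}"
    using assms by (simp add: neighbors_Leaf)
  then show ?thesis
    using Leaf assms by (cases z) (auto simp: class_step_def)
next
  case (Hub i)
  then have i: "i \<in> {1..k}"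
    using assms by simp
  have card: "card ({1..k} - {i}) = k - 1" "1 \<le> k"
    using i by auto
  show ?thesis
  proof (cases z)
    case (Hub c)
    with assms \<open>a = Hub i\<close> have c: "c \<in> {1..k} - {i}"
      by auto
    have "(\<Sum>j\<in>{1..k} - {i}. f (vertex_class z (Hub j))) = (\<Sum>j\<in>{1..k} - {i}. if j = c then f 0 else f 2)"
      unfolding Hub by (intro sum.cong) auto
    also have "\<dots> = f 0 + (real k - 2) * f 2"
      using sum_if_eq_else[OF _ c] card by (simp add: of_nat_diff)
    finally show ?thesis
      using c unfolding \<open>a = Hub i\<close> sum_neighbors_Hub[OF i] card_neighbors_Hub[OF i]
      by (simp add: Hub class_step_def)
  next
    case (Leaf c m)
    show ?thesis
    proof (cases "i = c")
      case True
      have "(\<Sum>n=1..r. f (vertex_class z (Leaf i n))) = (\<Sum>n=1..r. if n = m then f 0 else f 2)"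
        unfolding Leaf True by (intro sum.cong) auto
      also have "\<dots> = f 0 + (real r - 1) * f 2"
        using assms Leaf by (subst sum_if_eq_else) auto
      finally have eq: "(\<Sum>n=1..r. f (vertex_class z (Leaf i n))) = f 0 + (real r - 1) * f 2" .
      have "(\<Sum>j\<in>{1..k} - {i}. f (vertex_class z (Hub j))) = (\<Sum>j\<in>{1..k} - {i}. f 3)"
        unfolding Leaf True by (intro sum.cong) auto
      then show ?thesis
        using card True
        unfolding \<open>a = Hub i\<close> sum_neighbors_Hub[OF i] card_neighbors_Hub[OF i] eq
        by (simp add: Leaf class_step_def of_nat_diff algebra_simps)
    next
      case False
      with assms Leaf i have c: "c \<in> {1..k} - {i}"
        by auto
      have "(\<Sum>j\<in>{1..k} - {i}. f (vertex_class z (Hub j))) = (\<Sum>j\<in>{1..k} - {i}. if j = c then f 1 else f 3)"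
        unfolding Leaf by (intro sum.cong) auto
      also have "\<dots> = f 1 + (real k - 2) * f 3"
        using sum_if_eq_else[OF _ c] card by (simp add: of_nat_diff)
      finally show ?thesis
        using c False unfolding \<open>a = Hub i\<close> sum_neighbors_Hub[OF i] card_neighbors_Hub[OF i]
        by (simp add: Leaf class_step_def)
    qed
  qed
qed

lemma reach_hub_leaf_graph:
  assumes "2 \<le> k" "z \<in> verts (hub_leaf_graph k r)" "a \<in> verts (hub_leaf_graph k r)"
  shows "(a, z) \<in> {(v, w). v \<in> verts (hub_leaf_graph k r) \<and> w \<in> neighbors (hub_leaf_graph k r) v}\<^sup>*"
    (is "_ \<in> ?E\<^sup>*")
proof -
  define hub where "hub v = (case v of Hub i \<Rightarrow> i | Leaf i n \<Rightarrow> i)" for v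
  have hub_in: "hub v \<in> {1..k}" if "v \<in> verts (hub_leaf_graph k r)" for v
    using that by (cases v) (auto simp: hub_def)
  have "(a, Hub (hub a)) \<in> ?E\<^sup>*"
  proof (cases a)
    case (Leaf i n)
    then have "(a, Hub i) \<in> ?E"
      using assms by (auto simp: neighbors_Leaf)
    then show ?thesis
      unfolding Leaf hub_def by auto
  qed (simp add: hub_def)
  also have "(Hub (hub a), Hub (hub z)) \<in> ?E\<^sup>*"
  proof (cases "hub a = hub z")
    case False
    then have "(Hub (hub a), Hub (hub z)) \<in> ?E"
      using hub_in assms by (auto simp: neighbors_Hub)
    then show ?thesis
      by auto
  qed simp
  also have "(Hub (hub z), z) \<in> ?E\<^sup>*"
  proof (cases z)
    case (Leaf i n)
    then have "(Hub i, z) \<in> ?E"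
      using assms by (auto simp: neighbors_Hub)
    then show ?thesis
      unfolding Leaf hub_def by auto
  qed (simp add: hub_def)
  finally show ?thesis .
qed

definition margin :: "nat \<Rightarrow> nat \<Rightarrow> hl_vertex \<Rightarrow> hl_vertex \<Rightarrow> hl_vertex \<Rightarrow> real" where
  "margin k r z a b = target_margin k r z (vertex_class z a) (vertex_class z b)"

lemma target_margin_swap: "target_margin k r z y x = - target_margin k r z x y"
  unfolding target_margin_def by (rule skew_swap)

lemma target_margin_self [simp]: "target_margin k r z x x = 0"
  by (simp add: target_margin_def skew_def)

text \<open>Extends the equations from x < y to all pairs by antisymmetry: for equal classes the two
  averages cancel, and x > y is the negated equation for the swapped pair.\<close>

lemma class_system:
  assumes "2 \<le> k" "1 \<le> r" "a \<noteq> z" "b \<noteq> z"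
  defines "x \<equiv> vertex_class z a" and "y \<equiv> vertex_class z b"
  shows "target_margin k r z x y
    = (class_step k r z x (\<lambda>x'. target_margin k r z x' y)
      + class_step k r z y (\<lambda>y'. target_margin k r z x y')) / 2"
proof -
  let ?S = "case z of Hub _ \<Rightarrow> {1, 2, 3} | Leaf _ _ \<Rightarrow> {1, 2, 3, 4 :: nat}"
  have range: "vertex_class z v \<in> ?S" if "v \<noteq> z" for v
    using that by (cases "(z, v)" rule: vertex_class.cases) auto
  have less: "target_margin k r z x y
    = (class_step k r z x (\<lambda>x'. target_margin k r z x' y)
      + class_step k r z y (\<lambda>y'. target_margin k r z x y')) / 2"
    if "x \<in> ?S" "y \<in> ?S" "x < y" for x y
    using that assms(1,2) hub_class_system[of k r x y] leaf_class_system[of k r x y]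
    by (cases z) auto
  have neg: "class_step k r z u (\<lambda>w. target_margin k r z v w) = - class_step k r z u (\<lambda>w. target_margin k r z w v)" for u v
    unfolding target_margin_swap[of k r z v] by (simp only: class_step_minus minus_minus)
  consider "x < y" | "x = y" | "y < x"
    by linarith
  then show ?thesis
  proof cases
    case 1
    then show ?thesis
      using less range assms by simp
  next
    case 2
    then show ?thesis
      by (simp add: neg)
  next
    case 3
    then have "target_margin k r z y x
      = (class_step k r z y (\<lambda>x'. target_margin k r z x' x)
        + class_step k r z x (\<lambda>y'. target_margin k r z y y')) / 2"
      using less range assms by simp
    then show ?thesis
      unfolding neg[of x y] neg[of y x] target_margin_swap[of k r z x y] by simp
  qed
qed

lemma capture_prob_hub_leaf_graph:
  assumes "2 \<le> k" "1 \<le> r" and z: "z \<in> verts (hub_leaf_graph k r)"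
    and ab: "a \<in> verts (hub_leaf_graph k r)" "b \<in> verts (hub_leaf_graph k r)"
  shows "capture_prob (hub_leaf_graph k r) z a b = 1 / 2 + margin k r z a b"
proof (rule capture_prob_unique[where F = "\<lambda>a b. 1 / 2 + margin k r z a b"])
  let ?G = "hub_leaf_graph k r"
  show ne: "neighbors ?G a \<noteq> {}" if "a \<in> verts ?G" for a
    using that assms by (cases a) (auto simp: neighbors_Hub neighbors_Leaf)
  have T: "v \<noteq> 0 \<Longrightarrow> target_margin k r z 0 v = 1 / 2" for v
    by (cases z) (auto simp: target_margin_def skew_def hub_margin_def leaf_margin_def Let_def)
  show "1 / 2 + margin k r z z b = 1" if "b \<noteq> z" for b
    using that T[of "vertex_class z b"] vertex_class_eq_0_iff[of z b] vertex_class_eq_0_iff[of z z]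
    by (simp add: margin_def)
  show "1 / 2 + margin k r z a z = 0" if "a \<noteq> z" for a
    using that T[of "vertex_class z a"] vertex_class_eq_0_iff[of z a] vertex_class_eq_0_iff[of z z]
      target_margin_swap[of k r z "vertex_class z a" 0]
    by (simp add: margin_def)
  show "1 / 2 + margin k r z z z = 1 / 2"
    by (simp add: margin_def)
  fix a b assume ab: "a \<in> verts ?G" "b \<in> verts ?G" "a \<noteq> z" "b \<noteq> z"
  have card: "card (neighbors ?G v) \<noteq> 0" if "v \<in> verts ?G" for v
    using ne[OF that] finite_subset[OF _ finite_verts_hub_leaf_graph, of "neighbors ?G v" k r]
    by (auto simp: neighbors_def)
  have avg: "(\<Sum>v\<in>neighbors ?G u. 1 / 2 + f (vertex_class z v)) / card (neighbors ?G u)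
      = 1 / 2 + class_step k r z (vertex_class z u) f" if "u \<in> verts ?G" "u \<noteq> z" for u f
    using average_neighbors[OF z that(1,2), of f] card[OF that(1)]
    by (simp add: sum.distrib add_divide_distrib)
  show "1 / 2 + margin k r z a b =
      ((\<Sum>a'\<in>neighbors ?G a. 1 / 2 + margin k r z a' b) / card (neighbors ?G a)
      + (\<Sum>b'\<in>neighbors ?G b. 1 / 2 + margin k r z a b') / card (neighbors ?G b)) / 2"
    unfolding margin_def avg[OF ab(1,3), of "\<lambda>x'. target_margin k r z x' (vertex_class z b)"]
      avg[OF ab(2,4), of "\<lambda>y'. target_margin k r z (vertex_class z a) y'"]
    using class_system[OF assms(1,2) ab(3,4)] by simp
qed (use assms reach_hub_leaf_graph finite_verts_hub_leaf_graph in auto)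

lemma centered_payoff_hub_leaf_graph:
  assumes "2 \<le> k" "1 \<le> r" "a \<in> verts (hub_leaf_graph k r)" "b \<in> verts (hub_leaf_graph k r)"
  shows "centered_payoff (hub_leaf_graph k r) a b = (\<Sum>z\<in>verts (hub_leaf_graph k r). margin k r z a b)"
  unfolding centered_payoff_def payoff_def using assms
  by (simp add: capture_prob_hub_leaf_graph sum.distrib)

lemma centered_payoff_swap:
  assumes "2 \<le> k" "1 \<le> r" "a \<in> verts (hub_leaf_graph k r)" "b \<in> verts (hub_leaf_graph k r)"
  shows "centered_payoff (hub_leaf_graph k r) b a = - centered_payoff (hub_leaf_graph k r) a b"
  using assms
  by (simp add: centered_payoff_hub_leaf_graph margin_def target_margin_swap[of k r _ "vertex_class _ a"]
      sum_negf)

text \<open>One transposition of hub indices, together with one transposition of leaf labels applied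
  at every hub, already exchanges any two hubs and any two leaves.\<close>

definition swap_vertex :: "nat \<Rightarrow> nat \<Rightarrow> nat \<Rightarrow> nat \<Rightarrow> hl_vertex \<Rightarrow> hl_vertex" where
  "swap_vertex i j m n v = (case v of
     Hub x \<Rightarrow> Hub (Transposition.transpose i j x) | Leaf x y \<Rightarrow> Leaf (Transposition.transpose i j x) (Transposition.transpose m n y))"

lemma transpose_eq_transpose_iff: "Transposition.transpose i j x = Transposition.transpose i j y \<longleftrightarrow> x = y"
  by (metis transpose_involutory)

lemma margin_swap_vertex:
  "margin k r (swap_vertex i j m n z) (swap_vertex i j m n a) (swap_vertex i j m n b) = margin k r z a b"
proof -
  have "vertex_class (swap_vertex i j m n z) (swap_vertex i j m n v) = vertex_class z v" for v
    by (cases "(z, v)" rule: vertex_class.cases) (auto simp: swap_vertex_def transpose_eq_transpose_iff)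
  then show ?thesis
    by (cases z) (simp_all add: margin_def target_margin_def swap_vertex_def)
qed

text \<open>An automorphism exchanging \<open>a\<close> and \<open>b\<close> turns \<open>A(a, b)\<close> into \<open>A(b, a) = - A(a, b)\<close>.\<close>

lemma centered_payoff_eq_0_of_swap:
  assumes "2 \<le> k" "1 \<le> r" "a \<in> verts (hub_leaf_graph k r)" "b \<in> verts (hub_leaf_graph k r)"
    and ij: "i \<in> {1..k}" "j \<in> {1..k}" "m \<in> {1..r}" "n \<in> {1..r}"
    and ab: "swap_vertex i j m n a = b"
  shows "centered_payoff (hub_leaf_graph k r) a b = 0"
proof -
  let ?V = "verts (hub_leaf_graph k r)" and ?s = "swap_vertex i j m n"
  have inv: "?s (?s v) = v" for v
    by (cases v) (auto simp: swap_vertex_def)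
  have V: "?s v \<in> ?V" if "v \<in> ?V" for v
    using that ij by (cases v) (auto simp: swap_vertex_def Transposition.transpose_def)
  have "(\<Sum>z\<in>?V. margin k r z a b) = (\<Sum>z\<in>?V. margin k r (?s z) a b)"
    by (rule sum.reindex_bij_witness[of _ ?s ?s]) (auto simp: inv V)
  also have "\<dots> = (\<Sum>z\<in>?V. margin k r z b a)"
    using margin_swap_vertex[of k r i j m n _ b a] ab inv[of a] by simp
  also have "\<dots> = - (\<Sum>z\<in>?V. margin k r z a b)"
    by (simp add: margin_def target_margin_swap[of k r _ "vertex_class _ a"] sum_negf)
  finally show ?thesis
    using assms by (simp add: centered_payoff_hub_leaf_graph)
qed

lemma centered_payoff_Hub_Hub:
  assumes "2 \<le> k" "1 \<le> r" "i \<in> {1..k}" "j \<in> {1..k}"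
  shows "centered_payoff (hub_leaf_graph k r) (Hub i) (Hub j) = 0"
  using assms
  by (intro centered_payoff_eq_0_of_swap[where i = i and j = j and m = 1 and n = 1])
     (auto simp: swap_vertex_def)

lemma centered_payoff_Leaf_Leaf:
  assumes "2 \<le> k" "1 \<le> r" "i \<in> {1..k}" "j \<in> {1..k}" "m \<in> {1..r}" "n \<in> {1..r}"
  shows "centered_payoff (hub_leaf_graph k r) (Leaf i m) (Leaf j n) = 0"
  using assms
  by (intro centered_payoff_eq_0_of_swap[where i = i and j = j and m = m and n = n])
     (auto simp: swap_vertex_def)

section \<open>Closed forms of the two nonzero payoff entries\<close>

definition hub_gain :: "nat \<Rightarrow> nat \<Rightarrow> real" where
  "hub_gain k r = (let p = real k - 2; s = real r - 2 in
     H_poly p s / (2 * (real k + 2 * real r) * L_poly p s))"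

definition hub_loss :: "nat \<Rightarrow> nat \<Rightarrow> real" where
  "hub_loss k r = (let p = real k - 2; s = real r - 2 in
     D_poly p s / (2 * (real k + 2 * real r) * (2 * real k + 3 * real r) * L_poly p s))"

text \<open>The sum of margins for a hub against its own leaf, over the denominator 2 B L with B = p
  + 2 s + 6 = k + 2r. The part with factor L comes from hub targets, the part with factor B from
  leaf targets.\<close>

lemma H_poly_identity:
  "H_poly p s = (p + 1) * L_poly p s
     + (p + 2 * s + 6) * ((s + 1) * M12 p s + (p + 1) * (s + 2) * M34 p s)"
  unfolding H_poly_def L_poly_def M12_def M34_def by algebra

text \<open>The same for a hub against a leaf of another hub, over 2 B K L with K = 2k + 3r. The
  factor K enters through the margin of a leaf over a foreign hub in the race to the leaf's own
  hub.\<close>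

lemma D_poly_identity:
  fixes p s :: real
  defines "B \<equiv> p + 2 * s + 6" and "K \<equiv> 2 * p + 3 * s + 10"
  shows "- D_poly p s = - (K - 4) * B * L_poly p s + p * K * L_poly p s
     + ((s + 2) * M14 p s - (s + 1) * M23 p s + p * (s + 2) * M34 p s) * B * K"
  unfolding D_poly_def L_poly_def M14_def M23_def M34_def B_def K_def by algebra

section \<open>The payoff matrix\<close>

lemma target_margin_less:
  assumes "x < y"
  shows "target_margin k r (Hub c) x y = hub_margin k r x y"
    and "target_margin k r (Hub c) y x = - hub_margin k r x y"
    and "target_margin k r (Leaf c m) x y = leaf_margin k r x y"
    and "target_margin k r (Leaf c m) y x = - leaf_margin k r x y"
  using assms by (simp_all add: target_margin_def skew_def)

lemma sum_if_eq_else2: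
  assumes "finite A" "i \<in> A" "j \<in> A" "i \<noteq> j"
  shows "(\<Sum>c\<in>A. if c = i then x else if c = j then y else z) = x + y + (real (card A) - 2) * z"
proof -
  have "(\<Sum>c\<in>A. if c = i then x else if c = j then y else z)
      = x + (\<Sum>c\<in>A - {i}. if c = j then y else z)"
    using assms by (subst sum.remove[of A i]) (auto intro!: sum.cong)
  also have "(\<Sum>c\<in>A - {i}. if c = j then y else z) = y + (real (card (A - {i})) - 1) * z"
    using assms by (intro sum_if_eq_else) auto
  also have "real (card (A - {i})) = real (card A) - 1"
  proof -
    have "0 < card A"
      using assms by (auto simp: card_gt_0_iff)
    then show ?thesis
      using assms by (simp add: card_Diff_singleton of_nat_diff)
  qed
  finally show ?thesis
    by simp
qed

text \<open>The two starting points, taken as targets, contribute 1/2 and -1/2 and cancel. There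
  remain k - 1 other hubs with classes 2 and 3, r - 1 sibling leaves with classes 1 and 2, and (k -
  1) r distant leaves with classes 3 and 4.\<close>

lemma centered_payoff_Hub_Leaf:
  assumes kr: "2 \<le> k" "1 \<le> r" and "i \<in> {1..k}" "m \<in> {1..r}"
  shows "centered_payoff (hub_leaf_graph k r) (Hub i) (Leaf i m) = hub_gain k r"
proof -
  define p s where "p = real k - 2" and "s = real r - 2"
  have kr': "real k = p + 2" "real r = s + 2"
    by (simp_all add: p_def s_def)
  have L: "0 < L_poly p s"
    using kr by (intro L_poly_pos) (auto simp: p_def s_def)
  have B: "0 < p + 2 * s + 6"
    using kr by (simp add: p_def s_def)
  have "(\<Sum>c=1..k. margin k r (Hub c) (Hub i) (Leaf i m))
      = (\<Sum>c=1..k. if c = i then 1 / 2 else hub_margin k r 2 3)"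
    by (intro sum.cong) (auto simp: margin_def target_margin_less hub_margin_def)
  also have "\<dots> = 1 / 2 + (real k - 1) * hub_margin k r 2 3"
    using assms by (subst sum_if_eq_else) auto
  finally have hub: "(\<Sum>c=1..k. margin k r (Hub c) (Hub i) (Leaf i m))
      = 1 / 2 + (real k - 1) * hub_margin k r 2 3" .
  have own: "(\<Sum>n=1..r. margin k r (Leaf i n) (Hub i) (Leaf i m)) = - 1 / 2 + (real r - 1) * leaf_margin k r 1 2"
  proof -
    have "(\<Sum>n=1..r. margin k r (Leaf i n) (Hub i) (Leaf i m))
        = (\<Sum>n=1..r. if n = m then - 1 / 2 else leaf_margin k r 1 2)"
      by (intro sum.cong) (auto simp: margin_def target_margin_less leaf_margin_def Let_def)
    also have "\<dots> = - 1 / 2 + (real r - 1) * leaf_margin k r 1 2"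
      using assms by (subst sum_if_eq_else) auto
    finally show ?thesis .
  qed
  have "(\<Sum>c=1..k. \<Sum>n=1..r. margin k r (Leaf c n) (Hub i) (Leaf i m))
      = (\<Sum>c=1..k. if c = i then - 1 / 2 + (real r - 1) * leaf_margin k r 1 2
          else real r * leaf_margin k r 3 4)"
    by (intro sum.cong) (use own in \<open>auto simp: margin_def target_margin_less\<close>)
  also have "\<dots> = - 1 / 2 + (real r - 1) * leaf_margin k r 1 2
      + (real k - 1) * (real r * leaf_margin k r 3 4)"
    using assms by (subst sum_if_eq_else) auto
  finally have "centered_payoff (hub_leaf_graph k r) (Hub i) (Leaf i m)
      = (real k - 1) * hub_margin k r 2 3 + (real r - 1) * leaf_margin k r 1 2
        + (real k - 1) * (real r * leaf_margin k r 3 4)"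
    using assms hub by (simp add: centered_payoff_hub_leaf_graph sum_verts_hub_leaf_graph)
  also have "\<dots> = (p + 1) / (2 * (p + 2 * s + 6))
      + ((s + 1) * M12 p s + (p + 1) * (s + 2) * M34 p s) / (2 * L_poly p s)"
    by (simp add: hub_margin_def leaf_margin_def Let_def p_def[symmetric] s_def[symmetric] kr'
        add_divide_distrib algebra_simps)
  also have "\<dots> = hub_gain k r"
  proof -
    have frac: "(a * c + b * x) / (2 * b * c) = a / (2 * b) + x / (2 * c)"
      if "0 < b" "0 < c" for a b c x :: real
      using that by (simp add: field_simps)
    have "hub_gain k r = H_poly p s / (2 * (p + 2 * s + 6) * L_poly p s)"
      by (simp add: hub_gain_def Let_def p_def[symmetric] s_def[symmetric] kr' algebra_simps)
    then show ?thesis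
      unfolding H_poly_identity using frac[OF B L] by simp
  qed
  finally show ?thesis .
qed

text \<open>Again the two starting points cancel as targets. \<open>Hub j\<close> contributes the
  pair (2, 1), the other k - 2 hubs (2, 3); the leaves at i contribute (1, 4), the siblings at j (3,
  2), all remaining leaves (3, 4).\<close>

lemma centered_payoff_Hub_other_Leaf:
  assumes kr: "2 \<le> k" "1 \<le> r" and ij: "i \<in> {1..k}" "j \<in> {1..k}" "j \<noteq> i" and "m \<in> {1..r}"
  shows "centered_payoff (hub_leaf_graph k r) (Hub i) (Leaf j m) = - hub_loss k r"
proof -
  define p s where "p = real k - 2" and "s = real r - 2"
  have kr': "real k = p + 2" "real r = s + 2"
    by (simp_all add: p_def s_def)
  define L B K where "L = L_poly p s" and "B = p + 2 * s + 6" and "K = 2 * p + 3 * s + 10"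
  have pos: "0 < L" "0 < B" "0 < K"
    using kr L_poly_pos[of p s] by (simp_all add: p_def s_def L_def B_def K_def)
  have "(\<Sum>c=1..k. margin k r (Hub c) (Hub i) (Leaf j m))
      = (\<Sum>c=1..k. if c = i then 1 / 2 else if c = j then - hub_margin k r 1 2 else hub_margin k r 2 3)"
    using ij by (intro sum.cong) (auto simp: margin_def target_margin_less hub_margin_def)
  also have "\<dots> = 1 / 2 - hub_margin k r 1 2 + (real k - 2) * hub_margin k r 2 3"
    using ij by (subst sum_if_eq_else2) auto
  finally have hub: "(\<Sum>c=1..k. margin k r (Hub c) (Hub i) (Leaf j m))
      = 1 / 2 - hub_margin k r 1 2 + (real k - 2) * hub_margin k r 2 3" .
  have own: "(\<Sum>n=1..r. margin k r (Leaf j n) (Hub i) (Leaf j m)) = - 1 / 2 - (real r - 1) * leaf_margin k r 2 3"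
  proof -
    have "(\<Sum>n=1..r. margin k r (Leaf j n) (Hub i) (Leaf j m))
        = (\<Sum>n=1..r. if n = m then - 1 / 2 else - leaf_margin k r 2 3)"
      using ij by (intro sum.cong) (auto simp: margin_def target_margin_less leaf_margin_def Let_def)
    also have "\<dots> = - 1 / 2 - (real r - 1) * leaf_margin k r 2 3"
      using assms by (subst sum_if_eq_else) auto
    finally show ?thesis .
  qed
  have "(\<Sum>c=1..k. \<Sum>n=1..r. margin k r (Leaf c n) (Hub i) (Leaf j m))
      = (\<Sum>c=1..k. if c = i then real r * leaf_margin k r 1 4
          else if c = j then - 1 / 2 - (real r - 1) * leaf_margin k r 2 3
          else real r * leaf_margin k r 3 4)"
    by (intro sum.cong) (use own ij in \<open>auto simp: margin_def target_margin_less\<close>)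
  also have "\<dots> = real r * leaf_margin k r 1 4 + (- 1 / 2 - (real r - 1) * leaf_margin k r 2 3)
      + (real k - 2) * (real r * leaf_margin k r 3 4)"
    using ij by (subst sum_if_eq_else2) auto
  finally have "centered_payoff (hub_leaf_graph k r) (Hub i) (Leaf j m)
      = - hub_margin k r 1 2 + (real k - 2) * hub_margin k r 2 3 + real r * leaf_margin k r 1 4
        - (real r - 1) * leaf_margin k r 2 3 + (real k - 2) * (real r * leaf_margin k r 3 4)"
    using assms hub by (simp add: centered_payoff_hub_leaf_graph sum_verts_hub_leaf_graph)
  also have "\<dots> = - (K - 4) / (2 * K) + p / (2 * B)
      + ((s + 2) * M14 p s - (s + 1) * M23 p s + p * (s + 2) * M34 p s) / (2 * L)"
  proof -
    have "hub_margin k r 1 2 = (K - 4) / (2 * K)"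
      by (simp add: hub_margin_def kr' K_def algebra_simps)
    moreover have "hub_margin k r 2 3 = 1 / (2 * B)"
      by (simp add: hub_margin_def kr' B_def algebra_simps)
    ultimately show ?thesis
      by (simp add: leaf_margin_def Let_def p_def[symmetric] s_def[symmetric] kr' L_def
          add_divide_distrib diff_divide_distrib ac_simps)
  qed
  also have "\<dots> = - hub_loss k r"
  proof -
    have frac: "(- a * b * l + p * c * l + x * b * c) / (2 * b * c * l) = - a / (2 * c) + p / (2 * b) + x / (2 * l)"
      if "0 < b" "0 < c" "0 < l" for a b c l x p :: real
      using that by (simp add: field_simps)
    have "- hub_loss k r = - D_poly p s / (2 * B * K * L)"
      by (simp add: hub_loss_def Let_def p_def[symmetric] s_def[symmetric] kr' L_def B_def K_def algebra_simps)
    moreover have "- D_poly p s = - (K - 4) * B * L + p * K * L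
        + ((s + 2) * M14 p s - (s + 1) * M23 p s + p * (s + 2) * M34 p s) * B * K"
      unfolding B_def K_def L_def by (rule D_poly_identity)
    ultimately show ?thesis
      by (simp only: frac[OF pos(2,3,1)])
  qed
  finally show ?thesis .
qed

section \<open>Signs of the payoff entries\<close>

lemma H_poly_shift:
  "H_poly p (q - 1) =
     (1976 + 5700 * q + 6348 * q^2 + 3444 * q^3 + 916 * q^4 + 96 * q^5)
     + p * (5238 + 12102 * q + 10410 * q^2 + 4082 * q^3 + 688 * q^4 + 32 * q^5)
     + p^2 * (5426 + 9767 * q + 6134 * q^2 + 1552 * q^3 + 124 * q^4)
     + p^3 * (2884 + 3811 * q + 1556 * q^2 + 190 * q^3)
     + p^4 * (840 + 725 * q + 144 * q^2) + p^5 * (128 + 54 * q) + 8 * p^6"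
  unfolding H_poly_def by algebra

lemma H_poly_pos:
  assumes "0 \<le> p" "-1 \<le> s"
  shows "0 < H_poly p s"
proof -
  have "0 < H_poly p ((s + 1) - 1)"
    unfolding H_poly_shift using assms
    by (intro add_pos_nonneg) (auto intro!: add_nonneg_nonneg mult_nonneg_nonneg add_pos_nonneg)
  then show ?thesis
    by simp
qed

lemma D_poly_pos:
  assumes "0 \<le> p" "0 \<le> s"
  shows "0 < D_poly p s"
  unfolding D_poly_def using assms
  by (intro add_pos_nonneg) (auto intro!: add_nonneg_nonneg mult_nonneg_nonneg add_pos_nonneg)

text \<open>At s = -1 the coefficient 16 + 16 s of p^6 vanishes and every remaining coefficient is
  negative.\<close>

lemma D_poly_neg:
  assumes "0 \<le> p"
  shows "D_poly p (- 1) < 0"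
proof -
  have "D_poly p (- 1) = - (1248 + 2936 * p + 2544 * p^2 + 1048 * p^3 + 208 * p^4 + 16 * p^5)"
    unfolding D_poly_def by algebra
  moreover have "0 < 1248 + 2936 * p + 2544 * p^2 + 1048 * p^3 + 208 * p^4 + 16 * p^5"
    using assms by (intro add_pos_nonneg) auto
  ultimately show ?thesis
    by simp
qed

lemma hub_gain_pos:
  assumes "2 \<le> k" "1 \<le> r"
  shows "0 < hub_gain k r"
  using assms unfolding hub_gain_def Let_def
  by (intro divide_pos_pos mult_pos_pos H_poly_pos L_poly_pos) auto

lemma hub_loss_pos:
  assumes "2 \<le> k" "2 \<le> r"
  shows "0 < hub_loss k r"
  using assms unfolding hub_loss_def Let_def
  by (intro divide_pos_pos mult_pos_pos D_poly_pos L_poly_pos) auto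

lemma hub_loss_neg:
  assumes "2 \<le> k"
  shows "hub_loss k 1 < 0"
  using assms D_poly_neg[of "real k - 2"] L_poly_pos[of "real k - 2" "- 1"] unfolding hub_loss_def Let_def
  by (intro divide_neg_pos mult_pos_pos) auto

section \<open>Skew games\<close>

text \<open>Centering changes mixed payoffs only by the constant |V| / 2, so best replies stay the
  same while the bilinear form becomes antisymmetric in a skew game.\<close>

definition mixed_value :: "'v ugraph \<Rightarrow> 'v pmf \<Rightarrow> 'v pmf \<Rightarrow> real" where
  "mixed_value G \<mu> \<nu> = (\<Sum>a\<in>verts G. \<Sum>b\<in>verts G. pmf \<mu> a * pmf \<nu> b * centered_payoff G a b)"

lemma mixed_payoff_eq_mixed_value:
  assumes fin: "finite (verts G)" and "\<mu> \<in> strategies_on (verts G)" "\<nu> \<in> strategies_on (verts G)"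
  shows "mixed_payoff G \<mu> \<nu> = mixed_value G \<mu> \<nu> + real (card (verts G)) / 2"
proof -
  let ?V = "verts G" and ?n = "real (card (verts G)) / 2"
  have sub: "set_pmf \<mu> \<subseteq> ?V" "set_pmf \<nu> \<subseteq> ?V"
    using assms by (auto simp: strategies_on_def)
  have "mixed_payoff G \<mu> \<nu> = (\<Sum>x\<in>?V \<times> ?V. (case x of (a, b) \<Rightarrow> payoff G a b) * pmf (pair_pmf \<mu> \<nu>) x)"
    unfolding mixed_payoff_def by (rule integral_measure_pmf_real) (use fin sub in auto)
  also have "\<dots> = (\<Sum>a\<in>?V. \<Sum>b\<in>?V. payoff G a b * (pmf \<mu> a * pmf \<nu> b))"
    by (subst sum.cartesian_product) (auto simp: pmf_pair intro!: sum.cong)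
  also have "\<dots> = (\<Sum>a\<in>?V. \<Sum>b\<in>?V. pmf \<mu> a * pmf \<nu> b * centered_payoff G a b + pmf \<mu> a * pmf \<nu> b * ?n)"
    by (intro sum.cong) (auto simp: centered_payoff_def algebra_simps)
  also have "\<dots> = mixed_value G \<mu> \<nu> + (\<Sum>a\<in>?V. \<Sum>b\<in>?V. pmf \<mu> a * pmf \<nu> b) * ?n"
    unfolding mixed_value_def sum_distrib_right by (simp only: sum.distrib)
  also have "(\<Sum>a\<in>?V. \<Sum>b\<in>?V. pmf \<mu> a * pmf \<nu> b) = (\<Sum>a\<in>?V. pmf \<mu> a) * (\<Sum>b\<in>?V. pmf \<nu> b)"
    by (rule sum_product[symmetric])
  also have "(\<Sum>a\<in>?V. pmf \<mu> a) = 1"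
    by (rule sum_pmf_eq_1[OF fin sub(1)])
  also have "(\<Sum>b\<in>?V. pmf \<nu> b) = 1"
    by (rule sum_pmf_eq_1[OF fin sub(2)])
  finally show ?thesis
    by simp
qed

lemma mixed_value_return:
  assumes "finite (verts G)" "b \<in> verts G"
  shows "mixed_value G \<mu> (return_pmf b) = (\<Sum>a\<in>verts G. pmf \<mu> a * centered_payoff G a b)"
proof -
  have "(\<Sum>b'\<in>verts G. pmf \<mu> a * pmf (return_pmf b) b' * centered_payoff G a b')
      = pmf \<mu> a * centered_payoff G a b" for a
  proof -
    have "(\<Sum>b'\<in>verts G. pmf \<mu> a * pmf (return_pmf b) b' * centered_payoff G a b')
        = (\<Sum>b'\<in>verts G. if b' = b then pmf \<mu> a * centered_payoff G a b' else 0)"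
      by (intro sum.cong) (auto simp: indicator_def)
    then show ?thesis
      using assms by simp
  qed
  then show ?thesis
    by (simp add: mixed_value_def)
qed

locale skew_game =
  fixes G :: "'v ugraph"
  assumes finite_verts: "finite (verts G)"
    and skew: "a \<in> verts G \<Longrightarrow> b \<in> verts G \<Longrightarrow> centered_payoff G b a = - centered_payoff G a b"
begin

lemma mixed_value_swap: "mixed_value G \<nu> \<mu> = - mixed_value G \<mu> \<nu>"
proof -
  have "mixed_value G \<nu> \<mu> = (\<Sum>b\<in>verts G. \<Sum>a\<in>verts G. pmf \<nu> a * pmf \<mu> b * centered_payoff G a b)"
    unfolding mixed_value_def by (rule sum.swap)
  also have "\<dots> = (\<Sum>b\<in>verts G. \<Sum>a\<in>verts G. - (pmf \<mu> b * pmf \<nu> a * centered_payoff G b a))"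
  proof (intro sum.cong refl)
    fix a b assume "b \<in> verts G" "a \<in> verts G"
    then show "pmf \<nu> a * pmf \<mu> b * centered_payoff G a b = - (pmf \<mu> b * pmf \<nu> a * centered_payoff G b a)"
      using skew[of b a] by simp
  qed
  finally show ?thesis
    by (simp add: mixed_value_def sum_negf)
qed

text \<open>By linearity in the opponent's strategy, nonnegativity against point masses is
  nonnegativity against all mixtures.\<close>

lemma optimal_strategies_mixed_value:
  "\<mu> \<in> optimal_strategies G \<longleftrightarrow>
    \<mu> \<in> strategies_on (verts G) \<and> (\<forall>\<nu>\<in>strategies_on (verts G). 0 \<le> mixed_value G \<mu> \<nu>)"
proof (intro iffI conjI ballI)
  assume opt: "\<mu> \<in> optimal_strategies G"
  then show "\<mu> \<in> strategies_on (verts G)"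
    by (simp add: optimal_strategies_def)
  fix \<nu>
  have "mixed_value G \<mu> \<nu> = (\<Sum>b\<in>verts G. \<Sum>a\<in>verts G. pmf \<mu> a * pmf \<nu> b * centered_payoff G a b)"
    unfolding mixed_value_def by (rule sum.swap)
  also have "\<dots> = (\<Sum>b\<in>verts G. pmf \<nu> b * (\<Sum>a\<in>verts G. pmf \<mu> a * centered_payoff G a b))"
    by (simp add: sum_distrib_left mult_ac)
  also have "0 \<le> \<dots>"
  proof (rule sum_nonneg)
    fix b assume "b \<in> verts G"
    then show "0 \<le> pmf \<nu> b * (\<Sum>a\<in>verts G. pmf \<mu> a * centered_payoff G a b)"
      using opt by (simp add: optimal_strategies_def)
  qed
  finally show "0 \<le> mixed_value G \<mu> \<nu>" .
next
  assume *: "\<mu> \<in> strategies_on (verts G) \<and> (\<forall>\<nu>\<in>strategies_on (verts G). 0 \<le> mixed_value G \<mu> \<nu>)"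
  have "0 \<le> (\<Sum>a\<in>verts G. pmf \<mu> a * centered_payoff G a b)" if "b \<in> verts G" for b
  proof -
    have "return_pmf b \<in> strategies_on (verts G)"
      using that by (simp add: strategies_on_def)
    then show ?thesis
      using * mixed_value_return[OF finite_verts that, of \<mu>] by auto
  qed
  then show "\<mu> \<in> optimal_strategies G"
    using * by (simp add: optimal_strategies_def)
qed

text \<open>Deviating to the opponent's own strategy yields 0, so in equilibrium both values are
  nonnegative; being opposite, both are 0. Then no deviation gains anything against either strategy,
  which by antisymmetry is optimality.\<close>

lemma MNE_eq: "MNE G = optimal_strategies G \<times> optimal_strategies G"
proof -
  let ?S = "strategies_on (verts G)"
  have MNE: "(\<mu>, \<nu>) \<in> MNE G \<longleftrightarrow> \<mu> \<in> ?S \<and> \<nu> \<in> ?S \<and>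
      (\<forall>\<mu>'\<in>?S. mixed_value G \<mu>' \<nu> \<le> mixed_value G \<mu> \<nu>) \<and>
      (\<forall>\<nu>'\<in>?S. mixed_value G \<nu>' \<mu> \<le> mixed_value G \<nu> \<mu>)" for \<mu> \<nu>
    by (auto simp: MNE_def mixed_payoff_eq_mixed_value[OF finite_verts])
  have self: "mixed_value G \<mu> \<mu> = 0" for \<mu>
    using mixed_value_swap[of \<mu> \<mu>] by simp
  have "(\<mu>, \<nu>) \<in> MNE G \<longleftrightarrow> \<mu> \<in> optimal_strategies G \<and> \<nu> \<in> optimal_strategies G" for \<mu> \<nu>
  proof
    assume N: "(\<mu>, \<nu>) \<in> MNE G"
    then have S: "\<mu> \<in> ?S" "\<nu> \<in> ?S"
      by (auto simp: MNE)
    have "0 \<le> mixed_value G \<mu> \<nu>" "0 \<le> mixed_value G \<nu> \<mu>"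
      using N S self by (metis MNE)+
    then have "mixed_value G \<mu> \<nu> = 0" "mixed_value G \<nu> \<mu> = 0"
      using mixed_value_swap[of \<nu> \<mu>] by auto
    then have "mixed_value G \<sigma> \<nu> \<le> 0" "mixed_value G \<sigma> \<mu> \<le> 0" if "\<sigma> \<in> ?S" for \<sigma>
      using N that by (auto simp: MNE)
    then show "\<mu> \<in> optimal_strategies G \<and> \<nu> \<in> optimal_strategies G"
      using S mixed_value_swap by (metis optimal_strategies_mixed_value neg_0_le_iff_le)
  next
    assume O: "\<mu> \<in> optimal_strategies G \<and> \<nu> \<in> optimal_strategies G"
    then have S: "\<mu> \<in> ?S" "\<nu> \<in> ?S"
      by (auto simp: optimal_strategies_mixed_value)
    have nonneg: "0 \<le> mixed_value G \<mu> \<sigma>" "0 \<le> mixed_value G \<nu> \<sigma>" if "\<sigma> \<in> ?S" for \<sigma>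
      using O that by (auto simp: optimal_strategies_mixed_value)
    have zero: "mixed_value G \<mu> \<nu> = 0" "mixed_value G \<nu> \<mu> = 0"
      using nonneg(1)[OF S(2)] nonneg(2)[OF S(1)] mixed_value_swap[of \<nu> \<mu>] by auto
    have "mixed_value G \<sigma> \<nu> \<le> 0" "mixed_value G \<sigma> \<mu> \<le> 0" if "\<sigma> \<in> ?S" for \<sigma>
      using nonneg[OF that] mixed_value_swap[of \<nu> \<sigma>] mixed_value_swap[of \<mu> \<sigma>] by auto
    then show "(\<mu>, \<nu>) \<in> MNE G"
      using S zero by (simp add: MNE)
  qed
  then show ?thesis
    by auto
qed

text \<open>The imitation argument of \<open>MNE_eq\<close> carried out with pure
  strategies.\<close>

lemma PNE_eq:
  "PNE G = {a \<in> verts G. \<forall>b\<in>verts G. 0 \<le> centered_payoff G a b}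
    \<times> {a \<in> verts G. \<forall>b\<in>verts G. 0 \<le> centered_payoff G a b}" (is "_ = ?O \<times> ?O")
proof -
  let ?A = "centered_payoff G"
  have PNE: "(a, b) \<in> PNE G \<longleftrightarrow> a \<in> verts G \<and> b \<in> verts G \<and>
      (\<forall>a'\<in>verts G. ?A a' b \<le> ?A a b) \<and> (\<forall>b'\<in>verts G. ?A b' a \<le> ?A b a)" for a b
    by (auto simp: PNE_def centered_payoff_def)
  have "(a, b) \<in> PNE G \<longleftrightarrow> a \<in> ?O \<and> b \<in> ?O" if ab: "a \<in> verts G" "b \<in> verts G" for a b
  proof
    assume N: "(a, b) \<in> PNE G"
    have "?A b b \<le> ?A a b" "?A a a \<le> ?A b a"
      using N ab by (auto simp: PNE)
    then have zero: "?A a b = 0" "?A b a = 0"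
      using skew[of a a] skew[of b b] skew[of a b] ab by auto
    have "0 \<le> ?A a c" "0 \<le> ?A b c" if "c \<in> verts G" for c
    proof -
      have "?A c b \<le> 0" "?A c a \<le> 0"
        using N that zero by (auto simp: PNE)
      then show "0 \<le> ?A a c" "0 \<le> ?A b c"
        using skew[of c a] skew[of c b] ab that by auto
    qed
    then show "a \<in> ?O \<and> b \<in> ?O"
      using ab by simp
  next
    assume O: "a \<in> ?O \<and> b \<in> ?O"
    have "0 \<le> ?A a b" "0 \<le> ?A b a"
      using O ab by auto
    then have zero: "?A a b = 0" "?A b a = 0"
      using skew[of a b] ab by auto
    have "?A c b \<le> 0" "?A c a \<le> 0" if "c \<in> verts G" for c
      using O that skew[of a c] skew[of b c] by auto
    then show "(a, b) \<in> PNE G"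
      using ab zero by (simp add: PNE)
  qed
  then have "(a, b) \<in> PNE G \<longleftrightarrow> a \<in> ?O \<and> b \<in> ?O" for a b
    by (cases "a \<in> verts G \<and> b \<in> verts G") (auto simp only: PNE mem_Collect_eq)
  then show ?thesis
    by (intro set_eqI) (simp only: split_paired_all mem_Times_iff fst_conv snd_conv)
qed

end

section \<open>Optimality conditions on the hub-leaf graph\<close>

lemma skew_game_hub_leaf_graph:
  assumes "2 \<le> k" "1 \<le> r"
  shows "skew_game (hub_leaf_graph k r)"
  by (rule skew_game.intro[OF finite_verts_hub_leaf_graph centered_payoff_swap[OF assms]])

lemma prob_leaves_at: "measure_pmf.prob \<mu> (leaves_at r i) = (\<Sum>n=1..r. pmf \<mu> (Leaf i n))"
  unfolding leaves_at_def by (subst measure_measure_pmf_finite) (auto simp: sum.reindex inj_on_def)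

lemma strategy_total:
  assumes "\<mu> \<in> strategies_on (verts (hub_leaf_graph k r))"
  shows "(\<Sum>i=1..k. pmf \<mu> (Hub i)) + (\<Sum>i=1..k. measure_pmf.prob \<mu> (leaves_at r i)) = 1"
proof -
  have "(\<Sum>v\<in>verts (hub_leaf_graph k r). pmf \<mu> v) = 1"
    using assms by (intro sum_pmf_eq_1 finite_verts_hub_leaf_graph) (auto simp: strategies_on_def)
  then show ?thesis
    by (simp add: sum_verts_hub_leaf_graph prob_leaves_at)
qed

lemma sum_if_eq_mult:
  fixes x :: "nat \<Rightarrow> real"
  assumes "j \<in> {1..k}"
  shows "(\<Sum>i=1..k. x i * (if i = j then u else v)) = (u - v) * x j + v * (\<Sum>i=1..k. x i)"
proof -
  have "(\<Sum>i=1..k. x i * (if i = j then u else v)) = (\<Sum>i=1..k. (if i = j then (u - v) * x i else 0) + v * x i)"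
    by (intro sum.cong) (auto simp: algebra_simps)
  then show ?thesis
    using assms by (simp add: sum.distrib sum_distrib_left)
qed

text \<open>The hub-hub and leaf-leaf blocks of A vanish, so a leaf of \<open>Hub j\<close> tests
  only the hub masses and \<open>Hub j\<close> tests only the leaf masses. The inequalities are kept
  undivided so that they also serve r = 1, where d < 0.\<close>

lemma optimal_strategies_hub_leaf_graph:
  assumes kr: "2 \<le> k" "1 \<le> r"
  defines "h \<equiv> hub_gain k r" and "d \<equiv> hub_loss k r"
  shows "\<mu> \<in> optimal_strategies (hub_leaf_graph k r) \<longleftrightarrow>
    \<mu> \<in> strategies_on (verts (hub_leaf_graph k r)) \<and>
    (\<forall>j\<in>{1..k}. d * (\<Sum>i=1..k. pmf \<mu> (Hub i)) \<le> (h + d) * pmf \<mu> (Hub j) \<and>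
      (h + d) * measure_pmf.prob \<mu> (leaves_at r j) \<le> d * (\<Sum>i=1..k. measure_pmf.prob \<mu> (leaves_at r i)))"
proof -
  let ?V = "verts (hub_leaf_graph k r)" and ?A = "centered_payoff (hub_leaf_graph k r)"
  have leaf: "(\<Sum>a\<in>?V. pmf \<mu> a * ?A a (Leaf j n))
      = (h + d) * pmf \<mu> (Hub j) - d * (\<Sum>i=1..k. pmf \<mu> (Hub i))"
    if j: "j \<in> {1..k}" "n \<in> {1..r}" for j n
  proof -
    have "(\<Sum>a\<in>?V. pmf \<mu> a * ?A a (Leaf j n)) = (\<Sum>i=1..k. pmf \<mu> (Hub i) * ?A (Hub i) (Leaf j n))"
      using centered_payoff_Leaf_Leaf[OF kr _ j(1) _ j(2)] by (simp add: sum_verts_hub_leaf_graph)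
    also have "\<dots> = (\<Sum>i=1..k. pmf \<mu> (Hub i) * (if i = j then h else - d))"
      using centered_payoff_Hub_Leaf[OF kr j] centered_payoff_Hub_other_Leaf[OF kr _ j(1) _ j(2)]
      by (intro sum.cong) (auto simp: h_def d_def)
    finally show ?thesis
      unfolding sum_if_eq_mult[OF j(1)] by simp
  qed
  have hub: "(\<Sum>a\<in>?V. pmf \<mu> a * ?A a (Hub j))
      = d * (\<Sum>i=1..k. measure_pmf.prob \<mu> (leaves_at r i)) - (h + d) * measure_pmf.prob \<mu> (leaves_at r j)"
    if j: "j \<in> {1..k}" for j
  proof -
    have A: "?A (Leaf i n) (Hub j) = (if i = j then - h else d)" if "i \<in> {1..k}" "n \<in> {1..r}" for i n
      using that j centered_payoff_swap[OF kr, of "Hub j" "Leaf i n"]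
        centered_payoff_Hub_Leaf[OF kr j, of n] centered_payoff_Hub_other_Leaf[OF kr j, of i n]
      by (auto simp: h_def d_def)
    have "(\<Sum>a\<in>?V. pmf \<mu> a * ?A a (Hub j)) = (\<Sum>i=1..k. \<Sum>n=1..r. pmf \<mu> (Leaf i n) * ?A (Leaf i n) (Hub j))"
      using centered_payoff_Hub_Hub[OF kr _ j] by (simp add: sum_verts_hub_leaf_graph)
    also have "\<dots> = (\<Sum>i=1..k. \<Sum>n=1..r. pmf \<mu> (Leaf i n) * (if i = j then - h else d))"
      using A by (intro sum.cong) auto
    also have "\<dots> = (\<Sum>i=1..k. measure_pmf.prob \<mu> (leaves_at r i) * (if i = j then - h else d))"
      by (simp only: prob_leaves_at sum_distrib_right)
    finally show ?thesis
      unfolding sum_if_eq_mult[OF j] by (simp add: algebra_simps)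
  qed
  have "(\<forall>b\<in>?V. 0 \<le> (\<Sum>a\<in>?V. pmf \<mu> a * ?A a b)) \<longleftrightarrow>
      (\<forall>j\<in>{1..k}. 0 \<le> (\<Sum>a\<in>?V. pmf \<mu> a * ?A a (Hub j))
        \<and> (\<forall>n\<in>{1..r}. 0 \<le> (\<Sum>a\<in>?V. pmf \<mu> a * ?A a (Leaf j n))))"
    (is "?L \<longleftrightarrow> ?R")
  proof
    assume R: ?R
    show ?L
    proof
      fix b assume b: "b \<in> ?V"
      show "0 \<le> (\<Sum>a\<in>?V. pmf \<mu> a * ?A a b)"
      proof (cases b)
        case (Hub j)
        then show ?thesis using R b by simp
      next
        case (Leaf j n)
        then show ?thesis using R b by simp
      qed
    qed
  qed simp
  also have "\<dots> \<longleftrightarrow> (\<forall>j\<in>{1..k}. d * (\<Sum>i=1..k. pmf \<mu> (Hub i)) \<le> (h + d) * pmf \<mu> (Hub j) \<and>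
      (h + d) * measure_pmf.prob \<mu> (leaves_at r j) \<le> d * (\<Sum>i=1..k. measure_pmf.prob \<mu> (leaves_at r i)))"
  proof (rule ball_cong[OF refl])
    fix j assume j: "j \<in> {1..k}"
    \<comment> \<open>Every hub has a leaf, so the test against leaves is not vacuous and yields the
      bound on the hub mass.\<close>
    have "1 \<in> {1..r}"
      using kr by simp
    then show "(0 \<le> (\<Sum>a\<in>?V. pmf \<mu> a * ?A a (Hub j))
        \<and> (\<forall>n\<in>{1..r}. 0 \<le> (\<Sum>a\<in>?V. pmf \<mu> a * ?A a (Leaf j n)))) \<longleftrightarrow>
      (d * (\<Sum>i=1..k. pmf \<mu> (Hub i)) \<le> (h + d) * pmf \<mu> (Hub j) \<and>
      (h + d) * measure_pmf.prob \<mu> (leaves_at r j) \<le> d * (\<Sum>i=1..k. measure_pmf.prob \<mu> (leaves_at r i)))"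
      unfolding hub[OF j] using leaf[OF j] by auto
  qed
  finally show ?thesis
    by (simp add: optimal_strategies_def)
qed

section \<open>Optimal strategies and equilibria\<close>

lemma strategies_on_hubs_iff:
  assumes "\<mu> \<in> strategies_on (verts (hub_leaf_graph k r))"
  shows "\<mu> \<in> strategies_on (hubs k) \<longleftrightarrow> (\<Sum>i=1..k. measure_pmf.prob \<mu> (leaves_at r i)) = 0"
proof -
  have "(\<Sum>i=1..k. measure_pmf.prob \<mu> (leaves_at r i)) = 0 \<longleftrightarrow>
      (\<forall>i\<in>{1..k}. \<forall>n\<in>{1..r}. Leaf i n \<notin> set_pmf \<mu>)"
    by (simp add: prob_leaves_at sum_nonneg_eq_0_iff sum_nonneg set_pmf_iff)
  also have "\<dots> \<longleftrightarrow> set_pmf \<mu> \<inter> all_leaves k r = {}"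
    by (auto simp: all_leaves_def leaves_at_def)
  also have "\<dots> \<longleftrightarrow> set_pmf \<mu> \<subseteq> hubs k"
  proof -
    have "hubs k \<inter> all_leaves k r = {}"
      by (auto simp: hubs_def all_leaves_def leaves_at_def)
    then show ?thesis
      using assms by (auto simp: strategies_on_def verts_hub_leaf_graph)
  qed
  finally show ?thesis
    by (simp add: strategies_on_def)
qed

lemma strategies_on_all_leaves_iff:
  assumes "\<mu> \<in> strategies_on (verts (hub_leaf_graph k r))"
  shows "\<mu> \<in> strategies_on (all_leaves k r) \<longleftrightarrow> (\<Sum>i=1..k. pmf \<mu> (Hub i)) = 0"
proof -
  have "(\<Sum>i=1..k. pmf \<mu> (Hub i)) = 0 \<longleftrightarrow> (\<forall>i\<in>{1..k}. Hub i \<notin> set_pmf \<mu>)"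
    by (simp add: sum_nonneg_eq_0_iff set_pmf_iff)
  also have "\<dots> \<longleftrightarrow> set_pmf \<mu> \<inter> hubs k = {}"
    by (auto simp: hubs_def)
  also have "\<dots> \<longleftrightarrow> set_pmf \<mu> \<subseteq> all_leaves k r"
  proof -
    have "hubs k \<inter> all_leaves k r = {}"
      by (auto simp: hubs_def all_leaves_def leaves_at_def)
    then show ?thesis
      using assms by (auto simp: strategies_on_def verts_hub_leaf_graph)
  qed
  finally show ?thesis
    by (simp add: strategies_on_def)
qed

lemma strategies_on_mono: "\<mu> \<in> strategies_on A \<Longrightarrow> A \<subseteq> B \<Longrightarrow> \<mu> \<in> strategies_on B"
  by (auto simp: strategies_on_def)

text \<open>With y the mass at a leaf and Y the total leaf mass, d < 0 gives h y \<le> d (Y - y)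
  \<le> 0, hence y = 0. The hub condition d (X - x) \<le> h x holds for any hub masses, its left
  side being nonpositive.\<close>

lemma optimal_strategies_one_leaf:
  assumes k: "2 \<le> k"
  shows "optimal_strategies (hub_leaf_graph k 1) = strategies_on (hubs k)"
proof -
  define h d where "h = hub_gain k 1" and "d = hub_loss k 1"
  have hd: "0 < h" "d < 0"
    using k hub_gain_pos[of k 1] hub_loss_neg[of k] by (auto simp: h_def d_def)
  note opt = optimal_strategies_hub_leaf_graph[OF k order_refl, folded h_def d_def]
  let ?y = "\<lambda>\<mu> i. measure_pmf.prob \<mu> (leaves_at 1 i)"
  have part: "f j \<le> (\<Sum>i=1..k. f i)" if "j \<in> {1..k}" "\<And>i. 0 \<le> f i" for f :: "nat \<Rightarrow> real" and j
    using that by (intro member_le_sum) auto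
  show ?thesis
  proof (intro equalityI subsetI)
    fix \<mu> assume mu: "\<mu> \<in> optimal_strategies (hub_leaf_graph k 1)"
    have "?y \<mu> j = 0" if j: "j \<in> {1..k}" for j
    proof -
      have "(h + d) * ?y \<mu> j \<le> d * (\<Sum>i=1..k. ?y \<mu> i)"
        using mu j unfolding opt by blast
      then have "h * ?y \<mu> j \<le> d * ((\<Sum>i=1..k. ?y \<mu> i) - ?y \<mu> j)"
        by (simp add: algebra_simps)
      also have "\<dots> \<le> 0"
        using hd part[OF j, of "?y \<mu>"] by (intro mult_nonpos_nonneg) auto
      finally show ?thesis
        using hd by (auto simp: mult_le_0_iff measure_le_0_iff)
    qed
    then have "(\<Sum>i=1..k. ?y \<mu> i) = 0"
      by (intro sum.neutral) blast
    then show "\<mu> \<in> strategies_on (hubs k)"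
      using mu strategies_on_hubs_iff unfolding opt by blast
  next
    fix \<mu> assume mu: "\<mu> \<in> strategies_on (hubs k)"
    then have S: "\<mu> \<in> strategies_on (verts (hub_leaf_graph k 1))"
      by (rule strategies_on_mono) (simp add: verts_hub_leaf_graph)
    then have Y: "(\<Sum>i=1..k. ?y \<mu> i) = 0"
      using mu strategies_on_hubs_iff by blast
    then have y: "?y \<mu> j = 0" if "j \<in> {1..k}" for j
      using that by (subst (asm) sum_nonneg_eq_0_iff) auto
    have "d * (\<Sum>i=1..k. pmf \<mu> (Hub i)) \<le> (h + d) * pmf \<mu> (Hub j)" if j: "j \<in> {1..k}" for j
    proof -
      have "d * ((\<Sum>i=1..k. pmf \<mu> (Hub i)) - pmf \<mu> (Hub j)) \<le> 0"
        using hd part[OF j, of "\<lambda>i. pmf \<mu> (Hub i)"] by (intro mult_nonpos_nonneg) auto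
      also have "0 \<le> h * pmf \<mu> (Hub j)"
        using hd by simp
      finally show ?thesis
        by (simp add: algebra_simps)
    qed
    moreover have "(h + d) * ?y \<mu> j \<le> d * (\<Sum>i=1..k. ?y \<mu> i)" if "j \<in> {1..k}" for j
      unfolding Y y[OF that] by simp
    ultimately show "\<mu> \<in> optimal_strategies (hub_leaf_graph k 1)"
      using S unfolding opt by blast
  qed
qed

lemma PNE_one_leaf:
  assumes k: "2 \<le> k"
  shows "PNE (hub_leaf_graph k 1) = hubs k \<times> hubs k"
proof -
  let ?G = "hub_leaf_graph k 1"
  interpret skew_game ?G
    using k by (intro skew_game_hub_leaf_graph) auto
  have "{a \<in> verts ?G. \<forall>b\<in>verts ?G. 0 \<le> centered_payoff ?G a b} = hubs k"
  proof (intro equalityI subsetI)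
    fix a assume a: "a \<in> {a \<in> verts ?G. \<forall>b\<in>verts ?G. 0 \<le> centered_payoff ?G a b}"
    show "a \<in> hubs k"
    proof (cases a)
      case (Hub i)
      then show ?thesis
        using a by (simp add: hubs_def)
    next
      case (Leaf i n)
      then have "i \<in> {1..k}" "n \<in> {1..1}" "0 \<le> centered_payoff ?G (Leaf i n) (Hub i)"
        using a by auto
      then show ?thesis
        using k centered_payoff_Hub_Leaf[of k 1 i n] skew[of "Leaf i n" "Hub i"] hub_gain_pos[of k 1] by auto
    qed
  next
    fix a assume "a \<in> hubs k"
    then obtain i where i: "i \<in> {1..k}" "a = Hub i"
      by (auto simp: hubs_def)
    have "0 \<le> centered_payoff ?G a b" if "b \<in> verts ?G" for b
    proof (cases b)
      case (Hub j)
      then show ?thesis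
        using that k i centered_payoff_Hub_Hub[of k 1 i j] by auto
    next
      case (Leaf j n)
      then show ?thesis
        using that k i centered_payoff_Hub_Leaf[of k 1 i n] centered_payoff_Hub_other_Leaf[of k 1 i j n]
          hub_gain_pos[of k 1] hub_loss_neg[of k] by (cases "j = i") auto
    qed
    then show "a \<in> {a \<in> verts ?G. \<forall>b\<in>verts ?G. 0 \<le> centered_payoff ?G a b}"
      using i by simp
  qed
  then show ?thesis
    unfolding PNE_eq by simp
qed

text \<open>No row of A is nonnegative: a hub loses to a leaf of another hub, and a leaf loses to
  its own hub.\<close>

lemma PNE_many_leaves:
  assumes k: "2 \<le> k" "2 \<le> r"
  shows "PNE (hub_leaf_graph k r) = {}"
proof -
  let ?G = "hub_leaf_graph k r"
  interpret skew_game ?G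
    using k by (intro skew_game_hub_leaf_graph) auto
  have "\<exists>b\<in>verts ?G. centered_payoff ?G a b < 0" if a: "a \<in> verts ?G" for a
  proof (cases a)
    case (Hub i)
    obtain j where j: "j \<in> {1..k}" "j \<noteq> i"
    proof (cases "i = 1")
      case True
      then show ?thesis
        using k by (intro that[of 2]) auto
    next
      case False
      then show ?thesis
        using k by (intro that[of 1]) auto
    qed
    then show ?thesis
      using a Hub k centered_payoff_Hub_other_Leaf[of k r i j 1] hub_loss_pos[of k r]
      by (intro bexI[of _ "Leaf j 1"]) auto
  next
    case (Leaf i n)
    then show ?thesis
      using a k centered_payoff_Hub_Leaf[of k r i n] skew[of "Leaf i n" "Hub i"] hub_gain_pos[of k r]
      by (intro bexI[of _ "Hub i"]) auto
  qed
  then have "{a \<in> verts ?G. \<forall>b\<in>verts ?G. 0 \<le> centered_payoff ?G a b} = {}"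
    by (auto simp: not_le)
  then show ?thesis
    unfolding PNE_eq by simp
qed

section \<open>The three threshold regimes for at least two leaves per hub\<close>

definition hub_threshold :: "nat \<Rightarrow> nat \<Rightarrow> real" where
  "hub_threshold k r = hub_loss k r / (hub_gain k r + hub_loss k r)"

lemma hub_threshold_pos:
  assumes "2 \<le> k" "2 \<le> r"
  shows "0 < hub_threshold k r"
  using hub_gain_pos[of k r] hub_loss_pos[of k r] assms by (simp add: hub_threshold_def)

lemma optimal_strategies_threshold:
  assumes "2 \<le> k" "2 \<le> r"
  defines "t \<equiv> hub_threshold k r"
  shows "\<mu> \<in> optimal_strategies (hub_leaf_graph k r) \<longleftrightarrow>
    \<mu> \<in> strategies_on (verts (hub_leaf_graph k r)) \<and>
    (\<forall>j\<in>{1..k}. t * (\<Sum>i=1..k. pmf \<mu> (Hub i)) \<le> pmf \<mu> (Hub j) \<and>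
      measure_pmf.prob \<mu> (leaves_at r j) \<le> t * (\<Sum>i=1..k. measure_pmf.prob \<mu> (leaves_at r i)))"
proof -
  have pos: "0 < hub_gain k r + hub_loss k r"
    using hub_gain_pos[of k r] hub_loss_pos[of k r] assms by simp
  have "t * u \<le> v \<longleftrightarrow> hub_loss k r * u \<le> (hub_gain k r + hub_loss k r) * v"
    "v \<le> t * u \<longleftrightarrow> (hub_gain k r + hub_loss k r) * v \<le> hub_loss k r * u" for u v
    using pos by (simp_all add: t_def hub_threshold_def field_simps)
  then show ?thesis
    using assms by (subst optimal_strategies_hub_leaf_graph) auto
qed

lemma sum_indicator_Hub:
  fixes x :: "nat \<Rightarrow> real"
  shows "(\<Sum>i=1..k. x i * indicator {Hub i} v) = (case v of Hub j \<Rightarrow> if j \<in> {1..k} then x j else 0 | Leaf _ _ \<Rightarrow> 0)"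
proof (cases v)
  case (Hub j)
  then have "(\<Sum>i=1..k. x i * indicator {Hub i} v) = (\<Sum>i=1..k. if i = j then x i else 0)"
    by (intro sum.cong) (auto simp: indicator_def)
  then show ?thesis
    using Hub by simp
qed (simp add: indicator_def)

text \<open>Summing the leaf bounds gives Y \<le> k t Y, so kt < 1 forces the leaf mass Y to vanish.
  Each hub then carries mass at least t > 0, which makes the support all k hubs.\<close>

lemma optimal_strategies_small_threshold:
  assumes kr: "2 \<le> k" "2 \<le> r"
  defines "t \<equiv> hub_threshold k r"
  assumes small: "real k * t < 1"
  shows "optimal_strategies (hub_leaf_graph k r) =
      {\<mu>. \<exists>x :: nat \<Rightarrow> real. (\<Sum>i=1..k. x i) = 1 \<and> (\<forall>i\<in>{1..k}. x i \<ge> t) \<and>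
         (\<forall>v. pmf \<mu> v = (\<Sum>i=1..k. x i * indicator {Hub i} v))}" (is "?O = ?X")
    and "\<forall>\<mu>\<in>optimal_strategies (hub_leaf_graph k r). card (set_pmf \<mu>) = k"
proof -
  let ?y = "\<lambda>\<mu> i. measure_pmf.prob \<mu> (leaves_at r i)"
  note opt = optimal_strategies_threshold[OF kr, folded t_def]
  show eq: "?O = ?X"
  proof (intro equalityI subsetI)
    fix \<mu> assume mu: "\<mu> \<in> ?O"
    then have S: "\<mu> \<in> strategies_on (verts (hub_leaf_graph k r))"
      by (simp add: opt)
    define Y where "Y = (\<Sum>i=1..k. ?y \<mu> i)"
    have "Y \<le> (\<Sum>i=1..k. t * Y)"
      unfolding Y_def using mu by (intro sum_mono) (simp add: opt)
    then have "(1 - real k * t) * Y \<le> 0"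
      by (simp add: algebra_simps)
    moreover have "0 \<le> Y"
      unfolding Y_def by (simp add: sum_nonneg)
    ultimately have "Y = 0"
      using small by (simp add: mult_le_0_iff)
    then have X: "(\<Sum>i=1..k. pmf \<mu> (Hub i)) = 1" and H: "\<mu> \<in> strategies_on (hubs k)"
      using strategy_total[OF S] strategies_on_hubs_iff[OF S] by (simp_all add: Y_def)
    have t_le: "\<forall>i\<in>{1..k}. t \<le> pmf \<mu> (Hub i)"
      using mu X by (simp add: opt)
    have "\<forall>v. pmf \<mu> v = (\<Sum>i=1..k. pmf \<mu> (Hub i) * indicator {Hub i} v)"
    proof
      fix v
      show "pmf \<mu> v = (\<Sum>i=1..k. pmf \<mu> (Hub i) * indicator {Hub i} v)"
      proof (cases "v \<in> hubs k")
        case True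
        then show ?thesis
          unfolding sum_indicator_Hub by (auto simp: hubs_def)
      next
        case False
        then have "pmf \<mu> v = 0"
          using H by (auto simp: strategies_on_def pmf_eq_0_set_pmf)
        then show ?thesis
          unfolding sum_indicator_Hub using False by (auto simp: hubs_def split: hl_vertex.split)
      qed
    qed
    with X t_le show "\<mu> \<in> ?X"
      by (intro CollectI exI[of _ "\<lambda>i. pmf \<mu> (Hub i)"] conjI)
  next
    fix \<mu> assume "\<mu> \<in> ?X"
    then obtain x :: "nat \<Rightarrow> real" where x: "(\<Sum>i=1..k. x i) = 1" "\<forall>i\<in>{1..k}. x i \<ge> t"
      "\<And>v. pmf \<mu> v = (case v of Hub j \<Rightarrow> if j \<in> {1..k} then x j else 0 | Leaf _ _ \<Rightarrow> 0)"
      unfolding sum_indicator_Hub by auto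
    have "v \<in> hubs k" if "v \<in> set_pmf \<mu>" for v
      using that x(3)[of v] by (cases v) (auto simp: set_pmf_iff hubs_def split: if_splits)
    then have H: "\<mu> \<in> strategies_on (hubs k)"
      by (auto simp: strategies_on_def)
    then have S: "\<mu> \<in> strategies_on (verts (hub_leaf_graph k r))"
      by (rule strategies_on_mono) (simp add: verts_hub_leaf_graph)
    have "?y \<mu> i = 0" for i
      by (simp add: prob_leaves_at x(3))
    moreover have "(\<Sum>i=1..k. pmf \<mu> (Hub i)) = 1"
      using x(1) by (simp add: x(3))
    ultimately show "\<mu> \<in> ?O"
      using S x by (simp add: opt)
  qed
  show "\<forall>\<mu>\<in>?O. card (set_pmf \<mu>) = k"
  proof
    fix \<mu> assume "\<mu> \<in> ?O"
    then obtain x :: "nat \<Rightarrow> real" where x: "\<forall>i\<in>{1..k}. x i \<ge> t"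
      "\<And>v. pmf \<mu> v = (case v of Hub j \<Rightarrow> if j \<in> {1..k} then x j else 0 | Leaf _ _ \<Rightarrow> 0)"
      unfolding eq sum_indicator_Hub by auto
    have t: "0 < t"
      using hub_threshold_pos[OF kr] by (simp add: t_def)
    have "x j \<noteq> 0" if "j \<in> {1..k}" for j
      using bspec[OF x(1) that] t by simp
    then have "set_pmf \<mu> = hubs k"
      by (intro set_eqI) (auto simp: set_pmf_iff x(2) hubs_def split: hl_vertex.split)
    then show "card (set_pmf \<mu>) = k"
      by (simp add: hubs_def card_image inj_on_def)
  qed
qed

text \<open>Summing the hub bounds gives k t X \<le> X, so kt > 1 forces the hub mass X to vanish.
  As each leaf set holds mass at most t, at least 1/t leaf sets must be met, and one leaf in each
  suffices.\<close>

lemma optimal_strategies_large_threshold: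
  assumes kr: "2 \<le> k" "2 \<le> r"
  defines "t \<equiv> hub_threshold k r"
  assumes large: "real k * t > 1"
  shows "optimal_strategies (hub_leaf_graph k r) =
      {\<mu> \<in> strategies_on (all_leaves k r). \<forall>i\<in>{1..k}. measure_pmf.prob \<mu> (leaves_at r i) \<le> t}" (is "?O = ?Y")
    and "\<exists>\<mu>\<in>optimal_strategies (hub_leaf_graph k r). int (card (set_pmf \<mu>)) = \<lceil>1 / t\<rceil>"
    and "\<forall>\<mu>\<in>optimal_strategies (hub_leaf_graph k r). \<lceil>1 / t\<rceil> \<le> int (card (set_pmf \<mu>))"
proof -
  let ?y = "\<lambda>\<mu> i. measure_pmf.prob \<mu> (leaves_at r i)"
  note opt = optimal_strategies_threshold[OF kr, folded t_def]
  have t: "0 < t"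
    using hub_threshold_pos[OF kr] by (simp add: t_def)
  show eq: "?O = ?Y"
  proof (intro equalityI subsetI)
    fix \<mu> assume mu: "\<mu> \<in> ?O"
    then have S: "\<mu> \<in> strategies_on (verts (hub_leaf_graph k r))"
      by (simp add: opt)
    define X where "X = (\<Sum>i=1..k. pmf \<mu> (Hub i))"
    have "(\<Sum>i=1..k. t * X) \<le> X"
      unfolding X_def using mu by (intro sum_mono) (simp add: opt)
    then have "(real k * t - 1) * X \<le> 0"
      by (simp add: algebra_simps)
    moreover have "0 \<le> X"
      unfolding X_def by (simp add: sum_nonneg)
    ultimately have "X = 0"
      using large by (simp add: mult_le_0_iff)
    then have "(\<Sum>i=1..k. ?y \<mu> i) = 1" "\<mu> \<in> strategies_on (all_leaves k r)"
      using strategy_total[OF S] strategies_on_all_leaves_iff[OF S] by (simp_all add: X_def)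
    then show "\<mu> \<in> ?Y"
      using mu by (simp add: opt)
  next
    fix \<mu> assume mu: "\<mu> \<in> ?Y"
    then have S: "\<mu> \<in> strategies_on (verts (hub_leaf_graph k r))"
      by (auto intro: strategies_on_mono simp: verts_hub_leaf_graph)
    then have X: "(\<Sum>i=1..k. pmf \<mu> (Hub i)) = 0"
      using mu strategies_on_all_leaves_iff by blast
    moreover have "(\<Sum>i=1..k. ?y \<mu> i) = 1"
      using strategy_total[OF S] X by simp
    ultimately show "\<mu> \<in> ?O"
      using S mu by (simp add: opt)
  qed
  show "\<forall>\<mu>\<in>?O. \<lceil>1 / t\<rceil> \<le> int (card (set_pmf \<mu>))"
  proof
    fix \<mu> assume mu: "\<mu> \<in> ?O"
    then have S: "\<mu> \<in> strategies_on (verts (hub_leaf_graph k r))"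
      and y: "\<And>i. i \<in> {1..k} \<Longrightarrow> ?y \<mu> i \<le> t"
      and X: "(\<Sum>i=1..k. pmf \<mu> (Hub i)) = 0"
      using strategies_on_all_leaves_iff[of \<mu> k r] unfolding opt[of \<mu>]
      using mu eq by auto
    have fin: "finite (set_pmf \<mu>)"
      using S finite_verts_hub_leaf_graph by (auto simp: strategies_on_def intro: finite_subset)
    \<comment> \<open>The index of the hub to which a vertex belongs; counting the sites met bounds
      the support size from below.\<close>
    define site where "site v = (case v of Hub i \<Rightarrow> i | Leaf i n \<Rightarrow> i)" for v
    define I where "I = site ` set_pmf \<mu>"
    have out: "?y \<mu> i = 0" if "i \<notin> I" for i
    proof -
      have "pmf \<mu> (Leaf i n) = 0" for n
        using that by (force simp: I_def site_def pmf_eq_0_set_pmf)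
      then show ?thesis
        by (simp add: prob_leaves_at)
    qed
    have "1 = (\<Sum>i=1..k. ?y \<mu> i)"
      using strategy_total[OF S] X by simp
    also have "\<dots> = (\<Sum>i\<in>{1..k} \<inter> I. ?y \<mu> i)"
      using out by (intro sum.mono_neutral_right) auto
    also have "\<dots> \<le> real (card ({1..k} \<inter> I)) * t"
      using y by (intro sum_bounded_above) auto
    also have "\<dots> \<le> real (card (set_pmf \<mu>)) * t"
    proof -
      have "card ({1..k} \<inter> I) \<le> card I"
        using fin by (intro card_mono) (auto simp: I_def)
      also have "\<dots> \<le> card (set_pmf \<mu>)"
        unfolding I_def using fin by (rule card_image_le)
      finally show ?thesis
        using t by (intro mult_right_mono) auto
    qed
    finally show "\<lceil>1 / t\<rceil> \<le> int (card (set_pmf \<mu>))"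
      using t by (simp add: ceiling_le_iff field_simps)
  qed
  show "\<exists>\<mu>\<in>?O. int (card (set_pmf \<mu>)) = \<lceil>1 / t\<rceil>"
  proof -
    \<comment> \<open>The uniform measure on one leaf at each of n hubs attains the minimum: its
      mass 1/n per leaf set is at most t, and kt > 1 ensures that n hubs are available.\<close>
    define n where "n = nat \<lceil>1 / t\<rceil>"
    have "0 < \<lceil>1 / t\<rceil>"
      using t by (subst zero_less_ceiling) simp
    then have n_int: "int n = \<lceil>1 / t\<rceil>" and n_pos: "0 < n"
      unfolding n_def by linarith+
    have "1 / t \<le> real n"
      using n_int le_of_int_ceiling[of "1 / t"] by linarith
    then have n_t: "1 / real n \<le> t"
      using t n_pos by (simp add: field_simps)
    have "1 / t \<le> real k"
      using large t by (simp add: field_simps)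
    then have n_k: "n \<le> k"
      by (simp add: n_def ceiling_le_iff nat_le_iff)
    define S where "S = (\<lambda>i. Leaf i 1) ` {1..n}"
    have S: "finite S" "S \<noteq> {}" "card S = n"
      using n_pos by (auto simp: S_def card_image inj_on_def)
    have "measure_pmf.prob (pmf_of_set S) (leaves_at r i) \<le> t" for i
    proof -
      have "card (S \<inter> leaves_at r i) \<le> card {Leaf i 1}"
        by (intro card_mono) (auto simp: S_def leaves_at_def)
      then have "measure_pmf.prob (pmf_of_set S) (leaves_at r i) \<le> 1 / real n"
        using S by (simp add: measure_pmf_of_set divide_right_mono)
      then show ?thesis
        using n_t by linarith
    qed
    moreover have "S \<subseteq> all_leaves k r"
      using n_k kr by (auto simp: S_def all_leaves_def leaves_at_def image_iff)
    ultimately have "pmf_of_set S \<in> ?O"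
      unfolding eq using S by (simp add: strategies_on_def)
    then show ?thesis
      using S n_int by (intro bexI[of _ "pmf_of_set S"]) simp_all
  qed
qed

lemma sum_le_average_eq:
  fixes f :: "nat \<Rightarrow> real"
  assumes "\<And>j. j \<in> {1..k} \<Longrightarrow> f j \<le> c" "(\<Sum>j=1..k. f j) = real k * c" "j \<in> {1..k}"
  shows "f j = c"
proof -
  have "(\<Sum>j=1..k. c - f j) = 0"
    using assms(2) by (simp add: sum_subtractf)
  then have "\<forall>j\<in>{1..k}. c - f j = 0"
    by (subst (asm) sum_nonneg_eq_0_iff) (use assms(1) in auto)
  then show ?thesis
    using assms(3) by auto
qed

text \<open>At kt = 1 the k bounds on each side add up to an equality, so every single one is an
  equality: hub masses are equal, leaf-set masses are equal, and only the split X remains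
  free.\<close>

lemma optimal_strategies_critical_threshold:
  assumes kr: "2 \<le> k" "2 \<le> r"
  defines "t \<equiv> hub_threshold k r"
  assumes critical: "real k * t = 1"
  shows "optimal_strategies (hub_leaf_graph k r) =
    {\<mu> \<in> strategies_on (verts (hub_leaf_graph k r)).
       \<exists>X\<in>{0..1}. \<forall>i\<in>{1..k}. pmf \<mu> (Hub i) = X / real k \<and>
         measure_pmf.prob \<mu> (leaves_at r i) = (1 - X) / real k}" (is "?O = ?Z")
proof -
  let ?y = "\<lambda>\<mu> i. measure_pmf.prob \<mu> (leaves_at r i)"
  note opt = optimal_strategies_threshold[OF kr, folded t_def]
  have t: "t = 1 / real k"
    using critical kr by (simp add: field_simps)
  show ?thesis
  proof (intro equalityI subsetI)
    fix \<mu> assume mu: "\<mu> \<in> ?O"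
    then have S: "\<mu> \<in> strategies_on (verts (hub_leaf_graph k r))"
      by (simp add: opt)
    define X Y where "X = (\<Sum>i=1..k. pmf \<mu> (Hub i))" and "Y = (\<Sum>i=1..k. ?y \<mu> i)"
    have XY: "X + Y = 1" "0 \<le> X" "0 \<le> Y"
      using strategy_total[OF S] by (simp_all add: X_def Y_def sum_nonneg)
    \<comment> \<open>The lower bound on the hub masses is negated so that
      \<open>sum_le_average_eq\<close>, which takes upper bounds, covers both families.\<close>
    have bounds: "- pmf \<mu> (Hub j) \<le> - (X / k)" "?y \<mu> j \<le> Y / k" if "j \<in> {1..k}" for j
      using mu that by (auto simp: opt t X_def Y_def)
    have "- pmf \<mu> (Hub j) = - (X / k)" "?y \<mu> j = Y / k" if "j \<in> {1..k}" for j
    proof -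
      show "- pmf \<mu> (Hub j) = - (X / k)"
        using kr by (intro sum_le_average_eq[where f = "\<lambda>j. - pmf \<mu> (Hub j)", OF bounds(1) _ that])
          (auto simp: sum_negf X_def)
      show "?y \<mu> j = Y / k"
        using kr by (intro sum_le_average_eq[where f = "?y \<mu>", OF bounds(2) _ that]) (auto simp: Y_def)
    qed
    then show "\<mu> \<in> ?Z"
      using S XY by (auto intro!: bexI[of _ X] simp: eq_diff_eq add.commute)
  next
    fix \<mu> assume "\<mu> \<in> ?Z"
    then obtain X where X: "\<mu> \<in> strategies_on (verts (hub_leaf_graph k r))"
      "\<And>i. i \<in> {1..k} \<Longrightarrow> pmf \<mu> (Hub i) = X / real k"
      "\<And>i. i \<in> {1..k} \<Longrightarrow> ?y \<mu> i = (1 - X) / real k"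
      by auto
    have "(\<Sum>i=1..k. pmf \<mu> (Hub i)) = X" "(\<Sum>i=1..k. ?y \<mu> i) = 1 - X"
      using kr by (simp_all add: X)
    then show "\<mu> \<in> ?O"
      using X by (simp add: opt t)
  qed
qed

theorem mainTheorem5:
  fixes k r :: nat
  assumes "k \<ge> 2" and "r \<ge> 1"
  defines "G \<equiv> hub_leaf_graph k r"
    and "p \<equiv> real k - 2"
    and "s \<equiv> real r - 2"
  shows "\<exists>h d :: real.
    (\<forall>i\<in>{1..k}. \<forall>j\<in>{1..k}. centered_payoff G (Hub i) (Hub j) = 0) \<and>
    (\<forall>l\<in>all_leaves k r. \<forall>l'\<in>all_leaves k r. centered_payoff G l l' = 0) \<and>
    (\<forall>i\<in>{1..k}. \<forall>l\<in>leaves_at r i. centered_payoff G (Hub i) l = h) \<and>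
    (\<forall>i\<in>{1..k}. \<forall>j\<in>{1..k}. j \<noteq> i \<longrightarrow>
       (\<forall>l\<in>leaves_at r j. centered_payoff G (Hub i) l = - d)) \<and>
    L_poly p s > 0 \<and>
    h = H_poly p s / (2 * (real k + 2 * real r) * L_poly p s) \<and>
    d = D_poly p s / (2 * (real k + 2 * real r) * (2 * real k + 3 * real r) * L_poly p s) \<and>
    h > 0 \<and>
    (r \<ge> 2 \<longrightarrow> d > 0) \<and>
    (r = 1 \<longrightarrow> d < 0) \<and>
    (r = 1 \<longrightarrow>
       optimal_strategies G = strategies_on (hubs k) \<and>
       PNE G = hubs k \<times> hubs k) \<and>
    (r \<ge> 2 \<longrightarrow>
       PNE G = {} \<and>
       (let t = d / (h + d) in
         (real k * t < 1 \<longrightarrow>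
            optimal_strategies G =
              {\<mu>. \<exists>x :: nat \<Rightarrow> real. (\<Sum>i=1..k. x i) = 1 \<and> (\<forall>i\<in>{1..k}. x i \<ge> t) \<and>
                   (\<forall>v. pmf \<mu> v = (\<Sum>i=1..k. x i * indicator {Hub i} v))} \<and>
            (\<forall>\<mu>\<in>optimal_strategies G. card (set_pmf \<mu>) = k)) \<and>
         (real k * t > 1 \<longrightarrow>
            optimal_strategies G =
              {\<mu> \<in> strategies_on (all_leaves k r).
                 \<forall>i\<in>{1..k}. measure_pmf.prob \<mu> (leaves_at r i) \<le> t} \<and>
            (\<exists>\<mu>\<in>optimal_strategies G. int (card (set_pmf \<mu>)) = \<lceil>1 / t\<rceil>) \<and>
            (\<forall>\<mu>\<in>optimal_strategies G. \<lceil>1 / t\<rceil> \<le> int (card (set_pmf \<mu>)))) \<and>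
         (real k * t = 1 \<longrightarrow>
            optimal_strategies G =
              {\<mu> \<in> strategies_on (verts G).
                 \<exists>X\<in>{0..1}. \<forall>i\<in>{1..k}. pmf \<mu> (Hub i) = X / real k \<and>
                   measure_pmf.prob \<mu> (leaves_at r i) = (1 - X) / real k}))) \<and>
    MNE G = optimal_strategies G \<times> optimal_strategies G"
proof -
  have kr: "2 \<le> k" "1 \<le> r"
    using assms by auto
  define h d where "h = hub_gain k r" and "d = hub_loss k r"
  have hub_hub: "\<forall>i\<in>{1..k}. \<forall>j\<in>{1..k}. centered_payoff G (Hub i) (Hub j) = 0"
    using centered_payoff_Hub_Hub[OF kr] by (simp add: G_def)
  have leaf_leaf: "\<forall>l\<in>all_leaves k r. \<forall>l'\<in>all_leaves k r. centered_payoff G l l' = 0"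
    using centered_payoff_Leaf_Leaf[OF kr] by (auto simp: G_def all_leaves_def leaves_at_def)
  have own: "\<forall>i\<in>{1..k}. \<forall>l\<in>leaves_at r i. centered_payoff G (Hub i) l = h"
    using centered_payoff_Hub_Leaf[OF kr] by (auto simp: G_def h_def leaves_at_def)
  have other: "\<forall>i\<in>{1..k}. \<forall>j\<in>{1..k}. j \<noteq> i \<longrightarrow> (\<forall>l\<in>leaves_at r j. centered_payoff G (Hub i) l = - d)"
    using centered_payoff_Hub_other_Leaf[OF kr] by (auto simp: G_def d_def leaves_at_def)
  have L: "L_poly p s > 0"
    using kr by (intro L_poly_pos) (auto simp: p_def s_def)
  have h: "h = H_poly p s / (2 * (real k + 2 * real r) * L_poly p s)"
    by (simp add: h_def hub_gain_def Let_def p_def s_def)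
  have d: "d = D_poly p s / (2 * (real k + 2 * real r) * (2 * real k + 3 * real r) * L_poly p s)"
    by (simp add: d_def hub_loss_def Let_def p_def s_def)
  have signs: "h > 0" "r \<ge> 2 \<longrightarrow> d > 0" "r = 1 \<longrightarrow> d < 0"
    using hub_gain_pos[OF kr] hub_loss_pos[OF kr(1)] hub_loss_neg[OF kr(1)] by (auto simp: h_def d_def)
  have one: "r = 1 \<longrightarrow> optimal_strategies G = strategies_on (hubs k) \<and> PNE G = hubs k \<times> hubs k"
    using optimal_strategies_one_leaf[OF kr(1)] PNE_one_leaf[OF kr(1)] by (simp add: G_def)
  have t: "d / (h + d) = hub_threshold k r"
    by (simp add: h_def d_def hub_threshold_def)
  have MNE: "MNE G = optimal_strategies G \<times> optimal_strategies G"
    unfolding G_def by (rule skew_game.MNE_eq[OF skew_game_hub_leaf_graph[OF kr]])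
  show ?thesis
  proof (rule exI[of _ h], rule exI[of _ d], intro conjI)
    show "r \<ge> 2 \<longrightarrow>
       PNE G = {} \<and>
       (let t = d / (h + d) in
         (real k * t < 1 \<longrightarrow>
            optimal_strategies G =
              {\<mu>. \<exists>x :: nat \<Rightarrow> real. (\<Sum>i=1..k. x i) = 1 \<and> (\<forall>i\<in>{1..k}. x i \<ge> t) \<and>
                   (\<forall>v. pmf \<mu> v = (\<Sum>i=1..k. x i * indicator {Hub i} v))} \<and>
            (\<forall>\<mu>\<in>optimal_strategies G. card (set_pmf \<mu>) = k)) \<and>
         (real k * t > 1 \<longrightarrow>
            optimal_strategies G =
              {\<mu> \<in> strategies_on (all_leaves k r).
                 \<forall>i\<in>{1..k}. measure_pmf.prob \<mu> (leaves_at r i) \<le> t} \<and>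
            (\<exists>\<mu>\<in>optimal_strategies G. int (card (set_pmf \<mu>)) = \<lceil>1 / t\<rceil>) \<and>
            (\<forall>\<mu>\<in>optimal_strategies G. \<lceil>1 / t\<rceil> \<le> int (card (set_pmf \<mu>)))) \<and>
         (real k * t = 1 \<longrightarrow>
            optimal_strategies G =
              {\<mu> \<in> strategies_on (verts G).
                 \<exists>X\<in>{0..1}. \<forall>i\<in>{1..k}. pmf \<mu> (Hub i) = X / real k \<and>
                   measure_pmf.prob \<mu> (leaves_at r i) = (1 - X) / real k}))"
      unfolding t Let_def G_def
    proof (intro impI conjI)
      assume r: "r \<ge> 2"
      show "PNE (hub_leaf_graph k r) = {}"
        by (rule PNE_many_leaves[OF kr(1) r])
    qed (rule optimal_strategies_small_threshold[OF kr(1)] optimal_strategies_large_threshold[OF kr(1)]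
        optimal_strategies_critical_threshold[OF kr(1)]; assumption)+
  qed (fact hub_hub leaf_leaf own other L h d signs one MNE)+
qed

end
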